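(* Let $\mathbb F$ be a finite field. The class of matroids represented over $\mathbb F$ under the null representation is equivalent under MSO encodings to the class of binary relations (i.e. there is an MSO encoding in each direction), and there is an MSO encoding of the class of matroids represented over $\mathbb F$ under the null representation into the class of matroids represented over $\mathbb F$ under the independence representation.
   Context: A matroid represented over a field $\mathbb F$ consists of a finite nonempty set of elements together with a function (vector representation) from the elements to a vector space over $\mathbb F$. Independence representation: the structure whose universe is the set of elements with one relation $\mathrm{independent}(X)$ on sets, holding iff the vectors representing the elements of $X$ are linearly independent (a set containing two elements represented by the same vector is dependent). Null representation: the universe is the set of elements, with one relation on $n=|\mathbb F|-1$ sets $X_1,\dots,X_n$ holding iff (sum of vectors representing $X_1$) $+\dots+$ (sum of vectors representing $X_n$) $=0$. The class of binary relations is the class of all structures over a vocabulary with a single binary relation on elements. MSO means monadic second-order logic with modulo-counting predicates. An MSO transduction is a binary relation between structures (closed under isomorphism) obtained by composing finitely many MSO interpretations, filterings by MSO sentences, $k$-copyings and $k$-colourings. For classes $\mathcal C,\mathcal D$ of structures, an MSO encoding of $\mathcal C$ into $\mathcal D$ is an MSO transduction $f$ with all outputs on $\mathcal C$ in $\mathcal D$, for which there is an MSO transduction $g$ with all outputs on $\mathcal D$ in $\mathcal C$ such that $f$ followed by $g$ is the identity on $\mathcal C$ (up to isomorphism). *)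

theory Defs
  imports "HOL.Vector_Spaces" "HOL-Library.Function_Algebras"
begin

section \<open>Structures whose relations take elements and sets as arguments\<close>

text \<open>
  A relation name is a position in the vocabulary, and its arity \<open>(m, n)\<close> says that it takes
  \<open>m\<close> elements followed by \<open>n\<close> sets of elements.
\<close>

type_synonym vocabulary = "(nat \<times> nat) list"

record 'a struct =
  univ :: "'a set"
  rel :: "nat \<Rightarrow> 'a list \<Rightarrow> 'a set list \<Rightarrow> bool"

text \<open>
  All structures are finite and nonempty.  The values of \<open>rel\<close> on positions outside the
  vocabulary, on argument lists of the wrong length, or on arguments outside the universe carry no
  meaning: they are ignored by isomorphisms and are never inspected by a well-formed formula.
\<close>

definition is_struct :: "'a struct \<Rightarrow> bool" where
  "is_struct A \<longleftrightarrow> finite (univ A) \<and> univ A \<noteq> {}"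

definition args :: "nat \<times> nat \<Rightarrow> 'a set \<Rightarrow> ('a list \<times> 'a set list) set" where
  "args mn U = {(xs, Xs). length xs = fst mn \<and> set xs \<subseteq> U \<and>
                          length Xs = snd mn \<and> (\<forall>X\<in>set Xs. X \<subseteq> U)}"

definition isomorphism :: "vocabulary \<Rightarrow> ('a \<Rightarrow> 'b) \<Rightarrow> 'a struct \<Rightarrow> 'b struct \<Rightarrow> bool" where
  "isomorphism voc h A B \<longleftrightarrow> bij_betw h (univ A) (univ B) \<and>
     (\<forall>i<length voc. \<forall>(xs, Xs)\<in>args (voc ! i) (univ A).
        rel A i xs Xs \<longleftrightarrow> rel B i (map h xs) (map ((`) h) Xs))"

definition isomorphic :: "vocabulary \<Rightarrow> 'a struct \<Rightarrow> 'b struct \<Rightarrow> bool" where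
  "isomorphic voc A B \<longleftrightarrow> (\<exists>h. isomorphism voc h A B)"


section \<open>Monadic second-order logic with modulo counting\<close>

text \<open>
  Element variables and set variables form two separate copies of \<^typ>\<open>nat\<close>.
  \<open>CardMod r m X\<close> says that the cardinality of \<open>X\<close> is congruent to \<open>r\<close> modulo \<open>m\<close>.
\<close>

datatype mso =
    Eq nat nat
  | Mem nat nat
  | Rel nat "nat list" "nat list"
  | CardMod nat nat nat
  | Neg mso
  | Conj mso mso
  | ExElem nat mso
  | ExSet nat mso

fun sat :: "'a struct \<Rightarrow> (nat \<Rightarrow> 'a) \<Rightarrow> (nat \<Rightarrow> 'a set) \<Rightarrow> mso \<Rightarrow> bool" where
  "sat A e s (Eq x y) \<longleftrightarrow> e x = e y"
| "sat A e s (Mem x X) \<longleftrightarrow> e x \<in> s X"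
| "sat A e s (Rel i xs Xs) \<longleftrightarrow> rel A i (map e xs) (map s Xs)"
| "sat A e s (CardMod r m X) \<longleftrightarrow> card (s X) mod m = r mod m"
| "sat A e s (Neg \<phi>) \<longleftrightarrow> \<not> sat A e s \<phi>"
| "sat A e s (Conj \<phi> \<psi>) \<longleftrightarrow> sat A e s \<phi> \<and> sat A e s \<psi>"
| "sat A e s (ExElem x \<phi>) \<longleftrightarrow> (\<exists>a\<in>univ A. sat A (e(x := a)) s \<phi>)"
| "sat A e s (ExSet X \<phi>) \<longleftrightarrow> (\<exists>S\<subseteq>univ A. sat A e (s(X := S)) \<phi>)"

fun elem_fv :: "mso \<Rightarrow> nat set" where
  "elem_fv (Eq x y) = {x, y}"
| "elem_fv (Mem x X) = {x}"
| "elem_fv (Rel i xs Xs) = set xs"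
| "elem_fv (CardMod r m X) = {}"
| "elem_fv (Neg \<phi>) = elem_fv \<phi>"
| "elem_fv (Conj \<phi> \<psi>) = elem_fv \<phi> \<union> elem_fv \<psi>"
| "elem_fv (ExElem x \<phi>) = elem_fv \<phi> - {x}"
| "elem_fv (ExSet X \<phi>) = elem_fv \<phi>"

fun set_fv :: "mso \<Rightarrow> nat set" where
  "set_fv (Eq x y) = {}"
| "set_fv (Mem x X) = {X}"
| "set_fv (Rel i xs Xs) = set Xs"
| "set_fv (CardMod r m X) = {X}"
| "set_fv (Neg \<phi>) = set_fv \<phi>"
| "set_fv (Conj \<phi> \<psi>) = set_fv \<phi> \<union> set_fv \<psi>"
| "set_fv (ExElem x \<phi>) = set_fv \<phi>"
| "set_fv (ExSet X \<phi>) = set_fv \<phi> - {X}"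

fun over_voc :: "vocabulary \<Rightarrow> mso \<Rightarrow> bool" where
  "over_voc voc (Eq x y) \<longleftrightarrow> True"
| "over_voc voc (Mem x X) \<longleftrightarrow> True"
| "over_voc voc (Rel i xs Xs) \<longleftrightarrow> i < length voc \<and> voc ! i = (length xs, length Xs)"
| "over_voc voc (CardMod r m X) \<longleftrightarrow> m > 0"
| "over_voc voc (Neg \<phi>) \<longleftrightarrow> over_voc voc \<phi>"
| "over_voc voc (Conj \<phi> \<psi>) \<longleftrightarrow> over_voc voc \<phi> \<and> over_voc voc \<psi>"
| "over_voc voc (ExElem x \<phi>) \<longleftrightarrow> over_voc voc \<phi>"
| "over_voc voc (ExSet X \<phi>) \<longleftrightarrow> over_voc voc \<phi>"

text \<open>
  Formulas over \<open>voc\<close> whose free variables are among the element variables \<open>0, \<dots>, m - 1\<close> and the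
  set variables \<open>0, \<dots>, n - 1\<close>, where \<open>(m, n)\<close> is the given arity.
\<close>

definition mso_formula :: "vocabulary \<Rightarrow> nat \<times> nat \<Rightarrow> mso \<Rightarrow> bool" where
  "mso_formula voc mn \<phi> \<longleftrightarrow>
     over_voc voc \<phi> \<and> elem_fv \<phi> \<subseteq> {..<fst mn} \<and> set_fv \<phi> \<subseteq> {..<snd mn}"

definition holds :: "'a struct \<Rightarrow> 'a list \<Rightarrow> 'a set list \<Rightarrow> mso \<Rightarrow> bool" where
  "holds A xs Xs \<phi> \<longleftrightarrow> sat A (\<lambda>i. xs ! i) (\<lambda>i. Xs ! i) \<phi>"


section \<open>MSO transductions\<close>

definition interpret_struct :: "mso \<Rightarrow> mso list \<Rightarrow> 'a struct \<Rightarrow> 'a struct" where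
  "interpret_struct \<phi> \<psi>s A =
     \<lparr>univ = {a \<in> univ A. holds A [a] [] \<phi>}, rel = (\<lambda>i xs Xs. holds A xs Xs (\<psi>s ! i))\<rparr>"

text \<open>
  In the \<open>k\<close>-copying, a relation of the input holds for arguments that all lie in one of the copies
  and satisfy the relation there.  The new relations are the binary relation ``is a copy of the
  same element'' and one unary predicate for each of the \<open>k\<close> copies.
\<close>

definition copy_voc :: "nat \<Rightarrow> vocabulary \<Rightarrow> vocabulary" where
  "copy_voc k voc = voc @ [(2, 0)] @ replicate k (1, 0)"

definition copy_struct :: "vocabulary \<Rightarrow> nat \<Rightarrow> 'a struct \<Rightarrow> ('a \<times> nat) struct" where
  "copy_struct voc k A =
     \<lparr>univ = univ A \<times> {..<k},
      rel = (\<lambda>i xs Xs.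
        if i < length voc then
          \<exists>j<k. (\<forall>p\<in>set xs. snd p = j) \<and> (\<forall>X\<in>set Xs. \<forall>p\<in>X. snd p = j) \<and>
                rel A i (map fst xs) (map ((`) fst) Xs)
        else if i = length voc then fst (xs ! 0) = fst (xs ! 1)
        else snd (xs ! 0) = i - length voc - 1)\<rparr>"

definition colour_voc :: "nat \<Rightarrow> vocabulary \<Rightarrow> vocabulary" where
  "colour_voc k voc = voc @ replicate k (1, 0)"

definition colour_struct :: "vocabulary \<Rightarrow> ('a \<Rightarrow> nat) \<Rightarrow> 'a struct \<Rightarrow> 'a struct" where
  "colour_struct voc c A =
     \<lparr>univ = univ A,
      rel = (\<lambda>i xs Xs. if i < length voc then rel A i xs Xs else c (xs ! 0) = i - length voc)\<rparr>"

text \<open>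
  Since all structures are finite and transductions are closed under isomorphism, it is enough to
  consider structures whose elements are natural numbers.  An interpretation has no output when the
  universe formula selects no element.
\<close>

inductive mso_transduction ::
  "vocabulary \<Rightarrow> vocabulary \<Rightarrow> (nat struct \<Rightarrow> nat struct \<Rightarrow> bool) \<Rightarrow> bool"
where
  interp:
    "mso_formula voc (1, 0) \<phi> \<Longrightarrow> length \<psi>s = length voc' \<Longrightarrow>
     (\<forall>i<length voc'. mso_formula voc (voc' ! i) (\<psi>s ! i)) \<Longrightarrow>
     mso_transduction voc voc' (\<lambda>A B.
       is_struct A \<and> is_struct B \<and> isomorphic voc' (interpret_struct \<phi> \<psi>s A) B)"
| filtering:
    "mso_formula voc (0, 0) \<phi> \<Longrightarrow>
     mso_transduction voc voc (\<lambda>A B.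
       is_struct A \<and> is_struct B \<and> holds A [] [] \<phi> \<and> isomorphic voc A B)"
| copying:
    "k > 0 \<Longrightarrow>
     mso_transduction voc (copy_voc k voc) (\<lambda>A B.
       is_struct A \<and> is_struct B \<and> isomorphic (copy_voc k voc) (copy_struct voc k A) B)"
| colouring:
    "k > 0 \<Longrightarrow>
     mso_transduction voc (colour_voc k voc) (\<lambda>A B.
       is_struct A \<and> is_struct B \<and>
       (\<exists>c. c ` univ A \<subseteq> {..<k} \<and> isomorphic (colour_voc k voc) (colour_struct voc c A) B))"
| composition:
    "mso_transduction voc1 voc2 f \<Longrightarrow> mso_transduction voc2 voc3 g \<Longrightarrow>
     mso_transduction voc1 voc3 (f OO g)"


section \<open>MSO encodings\<close>

type_synonym struct_class = "vocabulary \<times> nat struct set"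

definition mso_encoding ::
  "(nat struct \<Rightarrow> nat struct \<Rightarrow> bool) \<Rightarrow> struct_class \<Rightarrow> struct_class \<Rightarrow> bool"
where
  "mso_encoding f C D \<longleftrightarrow>
     mso_transduction (fst C) (fst D) f \<and>
     (\<forall>A\<in>snd C. \<forall>B. f A B \<longrightarrow> B \<in> snd D) \<and>
     (\<exists>g. mso_transduction (fst D) (fst C) g \<and>
          (\<forall>B\<in>snd D. \<forall>A. g B A \<longrightarrow> A \<in> snd C) \<and>
          (\<forall>A\<in>snd C. \<forall>A'. (f OO g) A A' \<longleftrightarrow> isomorphic (fst C) A A'))"


section \<open>The three classes\<close>

definition binary_relations :: struct_class where
  "binary_relations = ([(2, 0)], {A. is_struct A})"

definition null_rep :: "'e set \<Rightarrow> ('e \<Rightarrow> 'v::ab_group_add) \<Rightarrow> 'e struct" where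
  "null_rep E v =
     \<lparr>univ = E, rel = (\<lambda>_ _ Xs. (\<Sum>X\<leftarrow>Xs. \<Sum>e\<in>X. v e) = 0)\<rparr>"

definition independence_rep ::
  "('f::field \<Rightarrow> 'v \<Rightarrow> 'v::ab_group_add) \<Rightarrow> 'e set \<Rightarrow> ('e \<Rightarrow> 'v) \<Rightarrow> 'e struct"
where
  "independence_rep scale E v =
     \<lparr>univ = E,
      rel = (\<lambda>_ _ Xs. inj_on v (Xs ! 0) \<and> \<not> module.dependent scale (v ` (Xs ! 0)))\<rparr>"

definition null_voc :: "'f::{finite,field} itself \<Rightarrow> vocabulary" where
  "null_voc _ = [(0, card (UNIV :: 'f set) - 1)]"

definition independence_voc :: vocabulary where
  "independence_voc = [(0, 1)]"

text \<open>
  The vector space of the representation is arbitrary.  As one cannot quantify over types, the two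
  classes below use the space of all functions from the naturals to the field; the lemmas at the end
  show that a representation in any other space gives, up to isomorphism, the same structures.
\<close>

definition pointwise_scale :: "'f::field \<Rightarrow> (nat \<Rightarrow> 'f) \<Rightarrow> nat \<Rightarrow> 'f" where
  "pointwise_scale c x = (\<lambda>i. c * x i)"

definition null_matroids :: "'f::{finite,field} itself \<Rightarrow> struct_class" where
  "null_matroids F =
     (null_voc F,
      {A. \<exists>E (v :: nat \<Rightarrow> nat \<Rightarrow> 'f). finite E \<and> E \<noteq> {} \<and>
            isomorphic (null_voc F) (null_rep E v) A})"

definition independence_matroids :: "'f::{finite,field} itself \<Rightarrow> struct_class" where
  "independence_matroids F =
     (independence_voc,
      {A. \<exists>E (v :: nat \<Rightarrow> nat \<Rightarrow> 'f). finite E \<and> E \<noteq> {} \<and>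
            isomorphic independence_voc (independence_rep pointwise_scale E v) A})"

lemma vector_space_pointwise_scale: "vector_space (pointwise_scale :: 'f::field \<Rightarrow> _)"
  by unfold_locales (auto simp: pointwise_scale_def fun_eq_iff algebra_simps)

lemma embed_finite_span:
  fixes scale :: "'f::field \<Rightarrow> 'v \<Rightarrow> 'v::ab_group_add"
  assumes "vector_space scale" and "finite S"
  obtains T where "Vector_Spaces.linear scale pointwise_scale T"
    and "inj_on T (module.span scale S)"
proof -
  interpret vector_space_pair scale "pointwise_scale :: 'f \<Rightarrow> _"
    using assms(1) vector_space_pointwise_scale by (simp add: vector_space_pair_def)
  obtain B where B: "B \<subseteq> S" "vs1.independent B" "S \<subseteq> vs1.span B"
    using vs1.maximal_independent_subset by metis
  have "finite B" using B(1) assms(2) finite_subset by blast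
  then obtain idx :: "'v \<Rightarrow> nat" where idx: "inj_on idx B"
    using finite_imp_inj_to_nat_seg by metis
  define unit :: "'v \<Rightarrow> nat \<Rightarrow> 'f" where "unit b = (\<lambda>i. if i = idx b then 1 else 0)" for b
  have inj_unit: "inj_on unit B"
  proof (rule inj_onI)
    fix b b' assume bb: "b \<in> B" "b' \<in> B" and "unit b = unit b'"
    then have "unit b (idx b) = unit b' (idx b)" by simp
    then have "idx b = idx b'" unfolding unit_def by (metis zero_neq_one)
    then show "b = b'" using idx bb by (simp add: inj_on_def)
  qed
  have indep: "vs2.independent (unit ` B)"
  proof
    assume "vs2.dependent (unit ` B)"
    then obtain u w where u: "(\<Sum>x\<in>unit ` B. pointwise_scale (u x) x) = 0"
      and w: "w \<in> unit ` B" "u w \<noteq> 0"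
      using vs2.dependent_finite[of "unit ` B"] \<open>finite B\<close> by auto
    obtain b where b: "b \<in> B" "w = unit b" using w(1) by auto
    have app: "(\<Sum>x\<in>C. g x) j = (\<Sum>x\<in>C. g x j)" if "finite C"
      for C :: "'v set" and g :: "'v \<Rightarrow> nat \<Rightarrow> 'f" and j
      using that by induction auto
    have "0 = (\<Sum>x\<in>B. pointwise_scale (u (unit x)) (unit x)) (idx b)"
      using u by (simp add: sum.reindex[OF inj_unit])
    also have "\<dots> = (\<Sum>x\<in>B. if x = b then u (unit x) else 0)"
      unfolding app[OF \<open>finite B\<close>]
      using idx b(1) by (intro sum.cong) (auto simp: pointwise_scale_def unit_def inj_on_def)
    also have "\<dots> = u w" using b \<open>finite B\<close> by simp
    finally show False using w(2) by simp
  qed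
  obtain T where T: "Vector_Spaces.linear scale pointwise_scale T" "\<forall>b\<in>B. T b = unit b"
    using linear_independent_extend[OF B(2)] by blast
  have "T ` B = unit ` B" using T(2) by (auto intro!: image_cong)
  moreover have "inj_on T B" using inj_unit T(2) by (simp cong: inj_on_cong)
  ultimately have "inj_on T (vs1.span B)"
    using linear_inj_on_span_independent_image[OF T(1)] indep by metis
  moreover have "vs1.span S \<subseteq> vs1.span B"
    using B(3) by (simp add: vs1.span_minimal)
  ultimately show thesis using T(1) that[of T] inj_on_subset[of T] by simp
qed

lemma transfer_to_function_space:
  fixes scale :: "'f::{finite,field} \<Rightarrow> 'v \<Rightarrow> 'v::ab_group_add" and v :: "'e \<Rightarrow> 'v"
  assumes vs: "vector_space scale" and E: "finite E" "E \<noteq> {}"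
  obtains h :: "'e \<Rightarrow> nat" and w :: "nat \<Rightarrow> nat \<Rightarrow> 'f" where
    "finite (h ` E)" "h ` E \<noteq> {}"
    "isomorphism (null_voc TYPE('f)) h (null_rep E v) (null_rep (h ` E) w)"
    "isomorphism independence_voc h (independence_rep scale E v)
       (independence_rep pointwise_scale (h ` E) w)"
proof -
  interpret vector_space_pair scale "pointwise_scale :: 'f \<Rightarrow> _"
    using vs vector_space_pointwise_scale by (simp add: vector_space_pair_def)
  obtain T where lin: "Vector_Spaces.linear scale pointwise_scale T"
    and inj: "inj_on T (vs1.span (v ` E))"
    using embed_finite_span[OF vs, of "v ` E"] E(1) by blast
  interpret T: Vector_Spaces.linear scale "pointwise_scale :: 'f \<Rightarrow> _" T by (rule lin)
  obtain h :: "'e \<Rightarrow> nat" where h: "inj_on h E"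
    using finite_imp_inj_to_nat_seg[OF E(1)] by metis
  define w where "w = T \<circ> v \<circ> inv_into E h"
  have wh: "w (h e) = T (v e)" if "e \<in> E" for e
    using that h by (simp add: w_def)
  have sum_w: "(\<Sum>e\<in>h ` X. w e) = T (\<Sum>e\<in>X. v e)" if "X \<subseteq> E" for X
  proof -
    have "(\<Sum>e\<in>h ` X. w e) = (\<Sum>e\<in>X. w (h e))"
      using sum.reindex[OF inj_on_subset[OF h that], of w] by simp
    also have "\<dots> = (\<Sum>e\<in>X. T (v e))" using that wh by (intro sum.cong) auto
    finally show ?thesis by (simp add: T.sum)
  qed
  have null: "(\<Sum>X\<leftarrow>map ((`) h) Xs. \<Sum>e\<in>X. w e) = 0 \<longleftrightarrow> (\<Sum>X\<leftarrow>Xs. \<Sum>e\<in>X. v e) = 0"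
    if "\<forall>X\<in>set Xs. X \<subseteq> E" for Xs
  proof -
    have "(\<Sum>X\<leftarrow>map ((`) h) Xs. \<Sum>e\<in>X. w e) = T (\<Sum>X\<leftarrow>Xs. \<Sum>e\<in>X. v e)"
      using that by (induction Xs) (auto simp: T.add sum_w)
    moreover have "(\<Sum>e\<in>X. v e) \<in> vs1.span (v ` E)" if "X \<subseteq> E" for X
      using that by (intro vs1.span_sum vs1.span_base) auto
    then have "(\<Sum>X\<leftarrow>Xs. \<Sum>e\<in>X. v e) \<in> vs1.span (v ` E)"
      using that by (induction Xs) (simp_all add: vs1.span_zero vs1.span_add)
    ultimately show ?thesis using inj T.zero vs1.span_zero by (metis inj_onD)
  qed
  have ind: "inj_on w (h ` X) \<and> vs2.independent (w ` h ` X) \<longleftrightarrow>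
      inj_on v X \<and> vs1.independent (v ` X)" if X: "X \<subseteq> E" for X
  proof -
    have im: "w ` h ` X = T ` v ` X"
      using X wh by (simp add: image_image subset_iff cong: image_cong_simp)
    have "v ` X \<subseteq> v ` E" using X by blast
    then have sp: "inj_on T (vs1.span (v ` X))"
      using inj_on_subset[OF inj vs1.span_mono] by simp
    then have "inj_on T (v ` X)" using inj_on_subset vs1.span_superset by metis
    moreover have "inj_on w (h ` X) \<longleftrightarrow> inj_on (w \<circ> h) X"
      by (rule comp_inj_on_iff[OF inj_on_subset[OF h X]])
    moreover have "inj_on (w \<circ> h) X \<longleftrightarrow> inj_on (T \<circ> v) X"
      using X wh by (intro inj_on_cong) auto
    moreover have "inj_on (T \<circ> v) X \<longleftrightarrow> inj_on v X"
      using \<open>inj_on T (v ` X)\<close> comp_inj_on[of v X T] inj_on_imageI2[of T v X] by auto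
    ultimately have "inj_on w (h ` X) \<longleftrightarrow> inj_on v X" by simp
    moreover have "vs2.dependent (T ` v ` X)" if "vs1.dependent (v ` X)"
    proof -
      have fin: "finite (v ` X)" using X E(1) finite_subset by blast
      obtain u y where u: "(\<Sum>x\<in>v ` X. scale (u x) x) = 0" and y: "y \<in> v ` X" "u y \<noteq> 0"
        using vs1.dependent_finite[OF fin] \<open>vs1.dependent (v ` X)\<close> by auto
      define u' where "u' = u \<circ> inv_into (v ` X) T"
      have u': "u' (T x) = u x" if "x \<in> v ` X" for x
        using that \<open>inj_on T (v ` X)\<close> by (simp add: u'_def)
      have "(\<Sum>x\<in>T ` v ` X. pointwise_scale (u' x) x) =
          (\<Sum>x\<in>v ` X. pointwise_scale (u' (T x)) (T x))"
        by (simp add: sum.reindex[OF \<open>inj_on T (v ` X)\<close>])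
      also have "\<dots> = (\<Sum>x\<in>v ` X. T (scale (u x) x))"
        using u' by (intro sum.cong) (simp_all add: T.scale)
      also have "\<dots> = 0" using u T.sum T.zero by metis
      finally have "(\<Sum>x\<in>T ` v ` X. pointwise_scale (u' x) x) = 0" .
      moreover have "\<exists>x\<in>T ` v ` X. u' x \<noteq> 0"
        using y u'[of y] by (intro bexI[of _ "T y"]) simp_all
      ultimately have "\<exists>u. (\<exists>x\<in>T ` v ` X. u x \<noteq> 0) \<and>
          (\<Sum>x\<in>T ` v ` X. pointwise_scale (u x) x) = 0"
        by (intro exI[of _ u'] conjI)
      then show ?thesis
        by (subst vs2.dependent_finite) (simp_all only: fin finite_imageI)
    qed
    then have "vs2.independent (T ` v ` X) \<longleftrightarrow> vs1.independent (v ` X)"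
      using T.dependent_inj_imageD[OF _ sp] by argo
    ultimately show ?thesis by (simp add: im)
  qed
  have bij: "bij_betw h E (h ` E)" using h by (simp add: bij_betw_def)
  show thesis
  proof (rule that[of h w])
    show "finite (h ` E)" "h ` E \<noteq> {}" using E by auto
    show "isomorphism (null_voc TYPE('f)) h (null_rep E v) (null_rep (h ` E) w)"
      using bij null by (auto simp: isomorphism_def null_rep_def null_voc_def args_def)
    show "isomorphism independence_voc h (independence_rep scale E v)
       (independence_rep pointwise_scale (h ` E) w)"
      unfolding isomorphism_def
    proof (intro conjI allI impI ballI, goal_cases)
      case 1
      show ?case using bij by (simp add: independence_rep_def)
    next
      case (2 i p)
      then obtain X where "p = ([], [X])" "X \<subseteq> E"
        by (auto simp: args_def independence_voc_def independence_rep_def length_Suc_conv)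
      then show ?case using ind[of X] by (simp add: independence_rep_def)
    qed
  qed
qed

end

(*
  A null matroid is, up to isomorphism, a matrix over the prime field: choose (by colouring) a
  subset B of the elements that is maximal without a relation with prime-field coefficients; then
  every element has a unique coordinate vector indexed by B, and a combination of elements vanishes
  iff its coordinates vanish, which modulo counting expresses.  Only the prime field matters,
  because the null relation adds vectors without scaling them.  The matrix becomes a binary relation
  on p copies of the elements, where p is the characteristic, the entry r at (e, b) being stored as
  r edges into b from the copies of e.

  Conversely, the rows of an adjacency matrix serve as vectors, together with unit vectors and the
  vectors c_u + b_u that link the two coordinates belonging to a vertex u.  Repeating the unit
  vectors two, three or four times makes their kinds recognisable from the sizes of parallel
  classes, so that independence alone reveals the matrix.  The argument needs only the
  coefficients 0, 1 and -1, and therefore applies to independence over the whole field as well as to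
  independence over the prime field, which the null relation defines.
*)

theory Submission
  imports Defs "HOL-Library.Countable" "HOL-Number_Theory.Cong"
begin

section \<open>Isomorphisms\<close>

text \<open>An encoding is tested on whole classes: the decoder into null matroids must return a
  null matroid from every binary relation, not only from the intended graphs. It therefore reads an
  arbitrary relation as a matrix, and a vertex counts for an element only if this element is the
  sole looped vertex pointing to it; cardinalities then add up over disjoint sets. The arity |F| - 1
  suffices because the characteristic is at most |F|: the number of argument sets containing an
  element can be any residue, so the null relation expresses exactly the combinations with
  prime-field coefficients. Transductions relate structures over the naturals up to isomorphism,
  whereas copying yields pairs and colouring is a choice. \<open>realizes\<close> describes a
  composed transduction by the set of its concrete outputs. A colouring that is no basis is filtered
  out, and every surviving one leads back to the same matroid, so the choice is harmless. The third
  encoding is a composition through binary relations, hence independence only ever has to reveal a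
  matrix with entries 0 and 1, never scalars.\<close>

lemma sat_cong:
  assumes "\<And>x. x \<in> elem_fv \<phi> \<Longrightarrow> e x = e' x" and "\<And>X. X \<in> set_fv \<phi> \<Longrightarrow> s X = s' X"
  shows "sat A e s \<phi> \<longleftrightarrow> sat A e' s' \<phi>"
  using assms
proof (induction \<phi> arbitrary: e e' s s')
  case (Rel i xs Xs)
  then have "map e xs = map e' xs" "map s Xs = map s' Xs" by auto
  then show ?case by (simp only: sat.simps)
next
  case (ExElem x \<phi>)
  have "sat A (e(x := a)) s \<phi> \<longleftrightarrow> sat A (e'(x := a)) s' \<phi>" for a
    by (rule ExElem.IH) (use ExElem.prems in auto)
  then show ?case by simp
next
  case (ExSet X \<phi>)
  have "sat A e (s(X := a)) \<phi> \<longleftrightarrow> sat A e' (s'(X := a)) \<phi>" for a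
    by (rule ExSet.IH) (use ExSet.prems in auto)
  then show ?case by simp
next
  case (Conj \<phi> \<psi>)
  have "sat A e s \<phi> \<longleftrightarrow> sat A e' s' \<phi>" "sat A e s \<psi> \<longleftrightarrow> sat A e' s' \<psi>"
    by (rule Conj.IH; use Conj.prems in simp)+
  then show ?case by simp
next
  case (Neg \<phi>)
  have "sat A e s \<phi> \<longleftrightarrow> sat A e' s' \<phi>"
    by (rule Neg.IH) (use Neg.prems in simp_all)
  then show ?case by simp
qed simp_all

lemma isomorphism_rel:
  "isomorphism voc h A B \<Longrightarrow> i < length voc \<Longrightarrow> (xs, Xs) \<in> args (voc ! i) (univ A) \<Longrightarrow>
    rel A i xs Xs \<longleftrightarrow> rel B i (map h xs) (map ((`) h) Xs)"
  by (auto simp: isomorphism_def)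

text \<open>The hypotheses concern free variables only: \<open>holds\<close> evaluates variables by
  list indexing, whose values beyond the length of the list are arbitrary and may lie outside the
  universe.\<close>

lemma sat_isomorphism:
  assumes iso: "isomorphism voc h A B" and "over_voc voc \<phi>"
    and "\<And>x. x \<in> elem_fv \<phi> \<Longrightarrow> e x \<in> univ A" and "\<And>X. X \<in> set_fv \<phi> \<Longrightarrow> s X \<subseteq> univ A"
  shows "sat A e s \<phi> \<longleftrightarrow> sat B (\<lambda>x. h (e x)) (\<lambda>X. h ` s X) \<phi>"
proof -
  have bij: "bij_betw h (univ A) (univ B)" using iso by (simp add: isomorphism_def)
  then have inj: "inj_on h (univ A)" and img: "h ` univ A = univ B"
    by (auto simp: bij_betw_def)
  show ?thesis
    using assms(2-)
  proof (induction \<phi> arbitrary: e s)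
    case (Eq x y)
    then show ?case using inj_on_eq_iff[OF inj, of "e x" "e y"] by simp
  next
    case (Mem x X)
    then show ?case using inj_on_image_mem_iff[OF inj, of "e x" "s X"] by simp
  next
    case (Rel i xs Xs)
    then have "(map e xs, map s Xs) \<in> args (voc ! i) (univ A)" "i < length voc"
      by (auto simp: args_def)
    then have "rel A i (map e xs) (map s Xs) \<longleftrightarrow>
        rel B i (map h (map e xs)) (map ((`) h) (map s Xs))"
      by (intro isomorphism_rel[OF iso])
    then show ?case by (simp add: comp_def)
  next
    case (CardMod r m X)
    then have "card (h ` s X) = card (s X)"
      by (intro card_image inj_on_subset[OF inj]) auto
    then show ?case by simp
  next
    case (Neg \<phi>)
    have "sat A e s \<phi> \<longleftrightarrow> sat B (\<lambda>x. h (e x)) (\<lambda>X. h ` s X) \<phi>"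
      by (rule Neg.IH) (use Neg.prems in simp_all)
    then show ?case by simp
  next
    case (Conj \<phi> \<psi>)
    have "sat A e s \<phi> \<longleftrightarrow> sat B (\<lambda>x. h (e x)) (\<lambda>X. h ` s X) \<phi>"
      "sat A e s \<psi> \<longleftrightarrow> sat B (\<lambda>x. h (e x)) (\<lambda>X. h ` s X) \<psi>"
      by (rule Conj.IH; use Conj.prems in simp)+
    then show ?case by simp
  next
    case (ExElem x \<phi>)
    have "sat A (e(x := a)) s \<phi> \<longleftrightarrow> sat B ((\<lambda>x. h (e x))(x := h a)) (\<lambda>X. h ` s X) \<phi>"
      if "a \<in> univ A" for a
    proof -
      have "(\<lambda>y. h ((e(x := a)) y)) = (\<lambda>x. h (e x))(x := h a)" by (rule ext) simp
      moreover have "sat A (e(x := a)) s \<phi> \<longleftrightarrow>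
          sat B (\<lambda>y. h ((e(x := a)) y)) (\<lambda>X. h ` s X) \<phi>"
        by (rule ExElem.IH) (use ExElem.prems that in auto)
      ultimately show ?thesis by (simp only:)
    qed
    then show ?case unfolding sat.simps img[symmetric] by (simp cong: bex_cong)
  next
    case (ExSet X \<phi>)
    have "sat A e (s(X := S)) \<phi> \<longleftrightarrow> sat B (\<lambda>x. h (e x)) ((\<lambda>X. h ` s X)(X := h ` S)) \<phi>"
      if "S \<subseteq> univ A" for S
    proof -
      have "(\<lambda>Y. h ` (s(X := S)) Y) = (\<lambda>X. h ` s X)(X := h ` S)" by (rule ext) simp
      moreover have "sat A e (s(X := S)) \<phi> \<longleftrightarrow>
          sat B (\<lambda>x. h (e x)) (\<lambda>Y. h ` (s(X := S)) Y) \<phi>"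
        by (rule ExSet.IH) (use ExSet.prems that in auto)
      ultimately show ?thesis by (simp only:)
    qed
    moreover have "(\<exists>T\<subseteq>univ B. P T) \<longleftrightarrow> (\<exists>S\<subseteq>univ A. P (h ` S))" for P
      unfolding img[symmetric] subset_image_iff by blast
    ultimately show ?case unfolding sat.simps by (simp cong: conj_cong)
  qed
qed

lemma holds_isomorphism:
  assumes iso: "isomorphism voc h A B" and \<phi>: "mso_formula voc mn \<phi>"
    and args: "(xs, Xs) \<in> args mn (univ A)"
  shows "holds A xs Xs \<phi> \<longleftrightarrow> holds B (map h xs) (map ((`) h) Xs) \<phi>"
proof -
  have len: "length xs = fst mn" "length Xs = snd mn" using args by (auto simp: args_def)
  have fv: "x \<in> elem_fv \<phi> \<Longrightarrow> x < length xs" "X \<in> set_fv \<phi> \<Longrightarrow> X < length Xs" for x X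
    using \<phi> len by (auto simp: mso_formula_def)
  have "holds A xs Xs \<phi> \<longleftrightarrow> sat B (\<lambda>x. h (xs ! x)) (\<lambda>X. h ` (Xs ! X)) \<phi>"
    unfolding holds_def
  proof (rule sat_isomorphism[OF iso])
    show "over_voc voc \<phi>" using \<phi> by (simp add: mso_formula_def)
    show "xs ! x \<in> univ A" if "x \<in> elem_fv \<phi>" for x
      using fv(1)[OF that] args nth_mem[of x xs] by (auto simp: args_def)
    show "Xs ! X \<subseteq> univ A" if "X \<in> set_fv \<phi>" for X
      using fv(2)[OF that] args nth_mem[of X Xs] by (auto simp: args_def)
  qed
  also have "\<dots> \<longleftrightarrow> holds B (map h xs) (map ((`) h) Xs) \<phi>"
    unfolding holds_def by (rule sat_cong) (use fv in auto)
  finally show ?thesis .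
qed

lemma args_map:
  "(xs, Xs) \<in> args mn U \<Longrightarrow> h ` U \<subseteq> V \<Longrightarrow> (map h xs, map ((`) h) Xs) \<in> args mn V"
  by (fastforce simp: args_def)

lemma isomorphism_id: "isomorphism voc id A A"
  by (simp add: isomorphism_def)

lemma isomorphic_refl: "isomorphic voc A A"
  using isomorphism_id unfolding isomorphic_def by blast

lemma isomorphic_sym:
  assumes "isomorphic voc A B"
  shows "isomorphic voc B A"
proof -
  obtain h where h: "isomorphism voc h A B" using assms by (auto simp: isomorphic_def)
  define g where "g = inv_into (univ A) h"
  have bij: "bij_betw h (univ A) (univ B)" using h by (simp add: isomorphism_def)
  then have g: "bij_betw g (univ B) (univ A)" by (simp add: g_def bij_betw_inv_into)
  have hg: "h (g b) = b" if "b \<in> univ B" for b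
    using bij that by (auto simp: g_def bij_betw_def f_inv_into_f)
  have "rel B i xs Xs \<longleftrightarrow> rel A i (map g xs) (map ((`) g) Xs)"
    if "i < length voc" and args: "(xs, Xs) \<in> args (voc ! i) (univ B)" for i xs Xs
  proof -
    have *: "(map g xs, map ((`) g) Xs) \<in> args (voc ! i) (univ A)"
      using args_map[OF args, of g] g by (simp add: bij_betw_def)
    have "map h (map g xs) = xs" using args hg by (auto simp: args_def intro!: map_idI)
    moreover have "map ((`) h) (map ((`) g) Xs) = Xs"
      unfolding map_map
    proof (rule map_idI)
      fix X assume "X \<in> set Xs"
      then have "X \<subseteq> univ B" using args by (auto simp: args_def)
      then have "h ` g ` X = id ` X" unfolding image_image by (intro image_cong) (auto simp: hg)
      then show "((`) h \<circ> (`) g) X = X" by simp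
    qed
    ultimately show ?thesis using isomorphism_rel[OF h that(1) *] by simp
  qed
  then have "isomorphism voc g B A" using g by (auto simp: isomorphism_def)
  then show ?thesis by (auto simp: isomorphic_def)
qed

lemma isomorphic_trans:
  assumes "isomorphic voc A B" "isomorphic voc B C"
  shows "isomorphic voc A C"
proof -
  obtain h g where h: "isomorphism voc h A B" and g: "isomorphism voc g B C"
    using assms by (auto simp: isomorphic_def)
  have "isomorphism voc (g \<circ> h) A C"
    unfolding isomorphism_def
  proof (intro conjI allI impI ballI, goal_cases)
    case 1
    then show ?case using h g by (auto simp: isomorphism_def intro: bij_betw_trans)
  next
    case (2 i p)
    obtain xs Xs where p: "p = (xs, Xs)" "(xs, Xs) \<in> args (voc ! i) (univ A)"
      using 2 by (cases p) auto
    have "h ` univ A \<subseteq> univ B" using h by (simp add: isomorphism_def bij_betw_def)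
    then have "(map h xs, map ((`) h) Xs) \<in> args (voc ! i) (univ B)" by (rule args_map[OF p(2)])
    then have "rel B i (map h xs) (map ((`) h) Xs) \<longleftrightarrow>
        rel C i (map g (map h xs)) (map ((`) g) (map ((`) h) Xs))"
      by (rule isomorphism_rel[OF g 2(1)])
    moreover have "rel A i xs Xs \<longleftrightarrow> rel B i (map h xs) (map ((`) h) Xs)"
      by (rule isomorphism_rel[OF h 2(1) p(2)])
    ultimately show ?case by (simp add: p(1) comp_def image_comp)
  qed
  then show ?thesis by (auto simp: isomorphic_def)
qed

lemma isomorphic_is_struct: "isomorphic voc A B \<Longrightarrow> is_struct A \<longleftrightarrow> is_struct B"
  unfolding isomorphic_def isomorphism_def is_struct_def
  by (metis bij_betw_empty1 bij_betw_empty2 bij_betw_finite)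

text \<open>Composition passes through a structure over the naturals, whereas copying naturally
  produces pairs; this supplies the intermediate structure.\<close>

lemma isomorphic_nat_struct:
  assumes "is_struct (X :: 'a struct)"
  shows "\<exists>B :: nat struct. is_struct B \<and> isomorphic voc X B"
proof -
  have fin: "finite (univ X)" using assms by (simp add: is_struct_def)
  obtain h :: "'a \<Rightarrow> nat" where h: "inj_on h (univ X)"
    using finite_imp_inj_to_nat_seg[OF fin] by metis
  define g where "g = inv_into (univ X) h"
  have gh: "g (h x) = x" if "x \<in> univ X" for x using that h by (simp add: g_def)
  define B where "B = \<lparr>univ = h ` univ X, rel = (\<lambda>i xs Xs. rel X i (map g xs) (map ((`) g) Xs))\<rparr>"
  have "rel X i xs Xs \<longleftrightarrow> rel B i (map h xs) (map ((`) h) Xs)"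
    if "(xs, Xs) \<in> args (voc ! i) (univ X)" for i xs Xs
  proof -
    have "map g (map h xs) = xs" using that gh by (auto simp: args_def intro!: map_idI)
    moreover have "map ((`) g) (map ((`) h) Xs) = Xs"
      unfolding map_map
    proof (rule map_idI)
      fix Y assume "Y \<in> set Xs"
      then have "Y \<subseteq> univ X" using that by (auto simp: args_def)
      then have "g ` h ` Y = id ` Y" unfolding image_image by (intro image_cong) (auto simp: gh)
      then show "((`) g \<circ> (`) h) Y = Y" by simp
    qed
    ultimately show ?thesis by (simp add: B_def)
  qed
  moreover have "bij_betw h (univ X) (univ B)" using h by (simp add: bij_betw_def B_def)
  ultimately have "isomorphism voc h X B" by (auto simp: isomorphism_def)
  then have iso: "isomorphic voc X B" by (auto simp: isomorphic_def)
  then show ?thesis using isomorphic_is_struct[OF iso] assms by blast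
qed

lemma interpret_struct_isomorphic:
  assumes "isomorphic voc X B" and \<phi>: "mso_formula voc (1, 0) \<phi>"
    and \<psi>s: "\<forall>i<length voc'. mso_formula voc (voc' ! i) (\<psi>s ! i)"
  shows "isomorphic voc' (interpret_struct \<phi> \<psi>s X) (interpret_struct \<phi> \<psi>s B)"
proof -
  obtain h where h: "isomorphism voc h X B"
    using assms(1) unfolding isomorphic_def by (rule exE)
  then have bij: "bij_betw h (univ X) (univ B)" by (simp add: isomorphism_def)
  have \<phi>_h: "holds X [a] [] \<phi> \<longleftrightarrow> holds B [h a] [] \<phi>" if "a \<in> univ X" for a
    using holds_isomorphism[OF h \<phi>, of "[a]" "[]"] that by (auto simp: args_def)
  have "bij_betw h {a \<in> univ X. holds X [a] [] \<phi>} {a \<in> univ B. holds B [a] [] \<phi>}"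
    unfolding bij_betw_def
  proof
    show "inj_on h {a \<in> univ X. holds X [a] [] \<phi>}"
      using bij by (auto simp: bij_betw_def intro: inj_on_subset)
    show "h ` {a \<in> univ X. holds X [a] [] \<phi>} = {a \<in> univ B. holds B [a] [] \<phi>}"
      using \<phi>_h by (auto simp: bij_betw_imp_surj_on[OF bij, symmetric])
  qed
  moreover have "holds X xs Xs (\<psi>s ! i) \<longleftrightarrow> holds B (map h xs) (map ((`) h) Xs) (\<psi>s ! i)"
    if "i < length voc'" "(xs, Xs) \<in> args (voc' ! i) {a \<in> univ X. holds X [a] [] \<phi>}" for i xs Xs
  proof (rule holds_isomorphism[OF h])
    show "mso_formula voc (voc' ! i) (\<psi>s ! i)" using \<psi>s that(1) by simp
    show "(xs, Xs) \<in> args (voc' ! i) (univ X)" using that(2) by (auto simp: args_def)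
  qed
  ultimately have "isomorphism voc' h (interpret_struct \<phi> \<psi>s X) (interpret_struct \<phi> \<psi>s B)"
    unfolding isomorphism_def interpret_struct_def by (simp add: split_paired_all)
  then show ?thesis by (auto simp: isomorphic_def)
qed

lemma copy_struct_isomorphic:
  assumes "isomorphic voc X B"
  shows "isomorphic (copy_voc k voc) (copy_struct voc k X) (copy_struct voc k B)"
proof -
  obtain h where h: "isomorphism voc h X B"
    using assms(1) unfolding isomorphic_def by (rule exE)
  then have bij: "bij_betw h (univ X) (univ B)" by (simp add: isomorphism_def)
  define H where "H = map_prod h (id :: nat \<Rightarrow> nat)"
  have [simp]: "fst (H p) = h (fst p)" "snd (H p) = snd p" for p by (auto simp: H_def)
  have "bij_betw H (univ X \<times> {..<k}) (univ B \<times> {..<k})"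
    unfolding H_def by (rule bij_betw_map_prod) (use bij in auto)
  moreover have "rel (copy_struct voc k X) i xs Xs \<longleftrightarrow>
      rel (copy_struct voc k B) i (map H xs) (map ((`) H) Xs)"
    if i: "i < length (copy_voc k voc)" and
      args: "(xs, Xs) \<in> args (copy_voc k voc ! i) (univ X \<times> {..<k})" for i xs Xs
  proof -
    consider "i < length voc" | "i = length voc" | "length voc < i" by linarith
    then show ?thesis
    proof cases
      case 1
      then have "(xs, Xs) \<in> args (voc ! i) (univ X \<times> {..<k})"
        using args by (simp add: copy_voc_def nth_append)
      then have "(map fst xs, map ((`) fst) Xs) \<in> args (voc ! i) (univ X)"
        by (rule args_map) auto
      then have "rel X i (map fst xs) (map ((`) fst) Xs) \<longleftrightarrow>
          rel B i (map h (map fst xs)) (map ((`) h) (map ((`) fst) Xs))"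
        by (rule isomorphism_rel[OF h 1])
      moreover have "map h (map fst xs) = map fst (map H xs)"
        "map ((`) h) (map ((`) fst) Xs) = map ((`) fst) (map ((`) H) Xs)"
        by (auto simp: image_image)
      moreover have "(\<forall>p\<in>set (map H xs). snd p = j) \<longleftrightarrow> (\<forall>p\<in>set xs. snd p = j)"
        "(\<forall>X\<in>set (map ((`) H) Xs). \<forall>p\<in>X. snd p = j) \<longleftrightarrow> (\<forall>X\<in>set Xs. \<forall>p\<in>X. snd p = j)"
        for j by auto
      ultimately show ?thesis using 1 by (simp only: copy_struct_def struct.simps if_True)
    next
      case 2
      then have "length xs = 2" "set xs \<subseteq> univ X \<times> {..<k}"
        using args by (auto simp: copy_voc_def nth_append args_def)
      then obtain p q where "xs = [p, q]" "fst p \<in> univ X" "fst q \<in> univ X"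
        by (auto simp: length_Suc_conv numeral_2_eq_2)
      then show ?thesis using 2 bij
        by (auto simp: copy_struct_def bij_betw_def inj_on_eq_iff)
    next
      case 3
      then have "copy_voc k voc ! i = (1, 0)"
        using i by (auto simp: copy_voc_def nth_append nth_Cons split: nat.splits)
      then have "length xs = 1" using args by (auto simp: args_def)
      then show ?thesis using 3 by (auto simp: copy_struct_def length_Suc_conv)
    qed
  qed
  ultimately have "isomorphism (copy_voc k voc) H (copy_struct voc k X) (copy_struct voc k B)"
    unfolding isomorphism_def by (simp add: copy_struct_def[where A = X] copy_struct_def[where A = B] split_paired_all)
  then show ?thesis by (auto simp: isomorphic_def)
qed

section \<open>Transductions realised by set-valued maps\<close>

lemma mso_transduction_is_struct:
  "mso_transduction voc voc' f \<Longrightarrow> f A B \<Longrightarrow> is_struct A \<and> is_struct B"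
proof (induction arbitrary: A B rule: mso_transduction.induct)
  case (composition voc1 voc2 f voc3 g)
  from composition.prems obtain C where "f A C" "g C B" by (rule relcomppE)
  then show ?case using composition.IH by simp
qed simp_all

lemma mso_transduction_isomorphic:
  "mso_transduction voc voc' f \<Longrightarrow> f A B \<Longrightarrow> isomorphic voc' B B' \<Longrightarrow> f A B'"
proof (induction arbitrary: A B B' rule: mso_transduction.induct)
  case (interp voc \<phi> \<psi>s voc')
  then show ?case
    by (simp add: isomorphic_is_struct[OF interp.prems(2)] isomorphic_trans[OF _ interp.prems(2)])
next
  case (filtering voc \<phi>)
  then show ?case
    by (simp add: isomorphic_is_struct[OF filtering.prems(2)]
        isomorphic_trans[OF _ filtering.prems(2)])
next
  case (copying k voc)
  then show ?case
    by (simp add: isomorphic_is_struct[OF copying.prems(2)] isomorphic_trans[OF _ copying.prems(2)])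
next
  case (colouring k voc)
  then show ?case
    using isomorphic_is_struct[OF colouring.prems(2)] isomorphic_trans[OF _ colouring.prems(2)]
    by blast
next
  case (composition voc1 voc2 f voc3 g)
  from composition.prems(1) obtain C where "f A C" "g C B" by (rule relcomppE)
  then show ?case using composition.IH(2)[OF _ composition.prems(2)] by (auto intro: relcomppI)
qed

text \<open>\<open>g\<close> followed by its decoder returns the intermediate structure only up to
  isomorphism. The outputs of \<open>f\<close> are closed under isomorphism, which absorbs the
  difference.\<close>

lemma mso_encoding_compose:
  assumes f: "mso_encoding f C D" and g: "mso_encoding g D E"
  shows "mso_encoding (f OO g) C E"
proof -
  from f have ft: "mso_transduction (fst C) (fst D) f"
    and fC: "\<And>A B. A \<in> snd C \<Longrightarrow> f A B \<Longrightarrow> B \<in> snd D"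
    by (simp_all add: mso_encoding_def)
  from g have gt: "mso_transduction (fst D) (fst E) g"
    and gD: "\<And>A B. A \<in> snd D \<Longrightarrow> g A B \<Longrightarrow> B \<in> snd E"
    by (simp_all add: mso_encoding_def)
  from f obtain f' where f': "mso_transduction (fst D) (fst C) f'"
    "\<forall>B\<in>snd D. \<forall>A. f' B A \<longrightarrow> A \<in> snd C"
    "\<forall>A\<in>snd C. \<forall>A'. (f OO f') A A' \<longleftrightarrow> isomorphic (fst C) A A'"
    unfolding mso_encoding_def by (elim conjE exE)
  from g obtain g' where g': "mso_transduction (fst E) (fst D) g'"
    "\<forall>B\<in>snd E. \<forall>A. g' B A \<longrightarrow> A \<in> snd D"
    "\<forall>A\<in>snd D. \<forall>A'. (g OO g') A A' \<longleftrightarrow> isomorphic (fst D) A A'"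
    unfolding mso_encoding_def by (elim conjE exE)
  have "((f OO g) OO (g' OO f')) A A' \<longleftrightarrow> isomorphic (fst C) A A'" if A: "A \<in> snd C" for A A'
  proof
    assume "((f OO g) OO (g' OO f')) A A'"
    then obtain B B' where B: "f A B" "(g OO g') B B'" "f' B' A'"
      by (elim relcomppE) (auto intro: relcomppI)
    have "isomorphic (fst D) B B'" using g'(3) fC[OF A B(1)] B(2) by simp
    then have "f A B'" by (rule mso_transduction_isomorphic[OF ft B(1)])
    then have "(f OO f') A A'" using B(3) by (rule relcomppI)
    then show "isomorphic (fst C) A A'" using f'(3) A by simp
  next
    assume "isomorphic (fst C) A A'"
    then have "(f OO f') A A'" using f'(3) A by simp
    then obtain B where B: "f A B" "f' B A'" by (rule relcomppE)
    have "(g OO g') B B" using g'(3) fC[OF A B(1)] isomorphic_refl by simp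
    then show "((f OO g) OO (g' OO f')) A A'"
      using B by (elim relcomppE) (auto intro!: relcomppI)
  qed
  then have *: "\<forall>A\<in>snd C. \<forall>A'. ((f OO g) OO (g' OO f')) A A' \<longleftrightarrow> isomorphic (fst C) A A'"
    by blast
  show ?thesis
    unfolding mso_encoding_def
  proof (intro conjI exI[of _ "g' OO f'"])
    show "\<forall>A\<in>snd C. \<forall>B. (f OO g) A B \<longrightarrow> B \<in> snd E" by (auto dest: fC gD elim!: relcomppE)
    show "\<forall>B\<in>snd E. \<forall>A. (g' OO f') B A \<longrightarrow> A \<in> snd C"
      using f'(2) g'(2) by (auto elim!: relcomppE)
  qed (fact * composition[OF ft gt] composition[OF g'(1) f'(1)])+
qed

text \<open>\<open>F A\<close> is a set because colourings are nondeterministic. Its members are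
  asked only to be finite: an interpretation may select no element, and the condition
  \<open>is_struct B\<close> then excludes an output.\<close>

definition realizes ::
  "vocabulary \<Rightarrow> vocabulary \<Rightarrow> (nat struct \<Rightarrow> nat struct \<Rightarrow> bool) \<Rightarrow>
    (nat struct \<Rightarrow> 'a struct set) \<Rightarrow> bool"
where
  "realizes voc voc' f F \<longleftrightarrow> mso_transduction voc voc' f \<and>
     (\<forall>A. is_struct A \<longrightarrow> (\<forall>X\<in>F A. finite (univ X))) \<and>
     (\<forall>A B. f A B \<longleftrightarrow> is_struct A \<and> is_struct B \<and> (\<exists>X\<in>F A. isomorphic voc' X B))"

text \<open>By \<open>inv\<close>, \<open>g\<close> can be computed on \<open>X\<close> itself
  instead of on its copy over the naturals. By \<open>ne\<close>, a nonempty final structure comes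
  from a nonempty intermediate one, which is then a legitimate middle point of the
  composition.\<close>

lemma realizes_step:
  assumes f: "realizes voc1 voc2 f F" and g: "mso_transduction voc2 voc3 g"
    and inv: "\<And>X B C. isomorphic voc2 X B \<Longrightarrow> is_struct X \<Longrightarrow> is_struct B \<Longrightarrow> is_struct C \<Longrightarrow>
      g B C \<longleftrightarrow> (\<exists>Y\<in>G X. isomorphic voc3 Y C)"
    and ne: "\<And>X Y. Y \<in> G X \<Longrightarrow> univ Y \<noteq> {} \<Longrightarrow> univ X \<noteq> {}"
    and fin: "\<And>X Y. Y \<in> G X \<Longrightarrow> finite (univ X) \<Longrightarrow> finite (univ Y)"
  shows "realizes voc1 voc3 (f OO g) (\<lambda>A. \<Union>(G ` F A))"
  unfolding realizes_def
proof (intro conjI allI impI ballI)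
  show "mso_transduction voc1 voc3 (f OO g)"
    using f g by (simp add: realizes_def composition[of voc1 voc2])
  show "finite (univ Y)" if "is_struct A" "Y \<in> \<Union>(G ` F A)" for A Y
    using that f fin by (auto simp: realizes_def)
  show "(f OO g) A C \<longleftrightarrow>
      is_struct A \<and> is_struct C \<and> (\<exists>Y\<in>\<Union>(G ` F A). isomorphic voc3 Y C)" for A C
  proof (intro iffI conjI)
    assume "(f OO g) A C"
    then obtain B where B: "f A B" "g B C" by (rule relcomppE)
    then obtain X where X: "X \<in> F A" "isomorphic voc2 X B" and A: "is_struct A" "is_struct B"
      using f by (auto simp: realizes_def)
    show "is_struct A" by fact
    show C: "is_struct C" using mso_transduction_is_struct[OF g B(2)] by simp
    show "\<exists>Y\<in>\<Union>(G ` F A). isomorphic voc3 Y C"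
      using inv[OF X(2) _ A(2) C] isomorphic_is_struct[OF X(2)] X(1) A B(2) by auto
  next
    assume "is_struct A \<and> is_struct C \<and> (\<exists>Y\<in>\<Union>(G ` F A). isomorphic voc3 Y C)"
    then obtain X Y where A: "is_struct A" "is_struct C" and X: "X \<in> F A" "Y \<in> G X"
      and Y: "isomorphic voc3 Y C" by blast
    have "univ Y \<noteq> {}" using isomorphic_is_struct[OF Y] A by (simp add: is_struct_def)
    then have X': "is_struct X" using f X A(1) ne by (auto simp: is_struct_def realizes_def)
    then obtain B :: "nat struct" where B: "is_struct B" "isomorphic voc2 X B"
      using isomorphic_nat_struct[OF X'] by blast
    then have "f A B" using f A X by (auto simp: realizes_def)
    moreover have "g B C" using inv[OF B(2) X' B(1) A(2)] X(2) Y by auto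
    ultimately show "(f OO g) A C" by (rule relcomppI)
  qed
qed

definition interpreting ::
  "vocabulary \<Rightarrow> mso \<Rightarrow> mso list \<Rightarrow> nat struct \<Rightarrow> nat struct \<Rightarrow> bool"
where
  "interpreting voc' \<phi> \<psi>s = (\<lambda>A B.
     is_struct A \<and> is_struct B \<and> isomorphic voc' (interpret_struct \<phi> \<psi>s A) B)"

lemma realizes_interpreting:
  assumes f: "realizes voc1 voc2 f F" and \<phi>: "mso_formula voc2 (1, 0) \<phi>"
    and \<psi>s: "length \<psi>s = length voc3" "\<forall>i<length voc3. mso_formula voc2 (voc3 ! i) (\<psi>s ! i)"
  shows "realizes voc1 voc3 (f OO interpreting voc3 \<phi> \<psi>s)
    (\<lambda>A. \<Union>((\<lambda>X. {interpret_struct \<phi> \<psi>s X}) ` F A))"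
  unfolding interpreting_def
proof (rule realizes_step[OF f interp[OF \<phi> \<psi>s]], goal_cases)
  case (1 X B C)
  have "isomorphic voc3 (interpret_struct \<phi> \<psi>s X) (interpret_struct \<phi> \<psi>s B)"
    by (rule interpret_struct_isomorphic[OF 1(1) \<phi> \<psi>s(2)])
  then have "isomorphic voc3 (interpret_struct \<phi> \<psi>s B) C \<longleftrightarrow>
      isomorphic voc3 (interpret_struct \<phi> \<psi>s X) C"
    using isomorphic_trans isomorphic_sym by meson
  then show ?case using 1 by simp
qed (auto simp: interpret_struct_def)

lemma realizes_filter:
  assumes f: "realizes voc1 voc2 f F" and \<phi>: "mso_formula voc2 (0, 0) \<phi>"
  shows "\<exists>g. realizes voc1 voc2 g (\<lambda>A. \<Union>((\<lambda>X. {Y. Y = X \<and> holds X [] [] \<phi>}) ` F A))"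
proof
  have tr: "mso_transduction voc2 voc2 (\<lambda>A B.
       is_struct A \<and> is_struct B \<and> holds A [] [] \<phi> \<and> isomorphic voc2 A B)"
    by (rule filtering[OF \<phi>])
  show "realizes voc1 voc2 (f OO (\<lambda>A B.
       is_struct A \<and> is_struct B \<and> holds A [] [] \<phi> \<and> isomorphic voc2 A B))
     (\<lambda>A. \<Union>((\<lambda>X. {Y. Y = X \<and> holds X [] [] \<phi>}) ` F A))"
  proof (rule realizes_step[OF f tr], goal_cases)
    case (1 X B C)
    have "holds X [] [] \<phi> \<longleftrightarrow> holds B [] [] \<phi>"
      using 1(1) holds_isomorphism[OF _ \<phi>, of _ X B "[]" "[]"]
      by (auto simp: isomorphic_def args_def)
    moreover have "isomorphic voc2 B C \<longleftrightarrow> isomorphic voc2 X C"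
      using isomorphic_trans isomorphic_sym 1(1) by meson
    ultimately show ?case using 1 by simp
  qed auto
qed

lemma realizes_copy:
  assumes f: "realizes voc1 voc2 f F" and k: "k > 0"
  shows "\<exists>g. realizes voc1 (copy_voc k voc2) g
    (\<lambda>A. \<Union>((\<lambda>X. {copy_struct voc2 k X}) ` F A))"
proof
  let ?v = "copy_voc k voc2"
  have tr: "mso_transduction voc2 ?v (\<lambda>A B.
       is_struct A \<and> is_struct B \<and> isomorphic ?v (copy_struct voc2 k A) B)"
    by (rule copying[OF k])
  show "realizes voc1 ?v (f OO (\<lambda>A B.
       is_struct A \<and> is_struct B \<and> isomorphic ?v (copy_struct voc2 k A) B))
     (\<lambda>A. \<Union>((\<lambda>X. {copy_struct voc2 k X}) ` F A))"
  proof (rule realizes_step[OF f tr], goal_cases)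
    case (1 X B C)
    have "isomorphic ?v (copy_struct voc2 k X) (copy_struct voc2 k B)"
      by (rule copy_struct_isomorphic[OF 1(1)])
    then have "isomorphic ?v (copy_struct voc2 k B) C \<longleftrightarrow> isomorphic ?v (copy_struct voc2 k X) C"
      using isomorphic_trans isomorphic_sym by meson
    then show ?case using 1 by simp
  qed (auto simp: copy_struct_def)
qed

lemma realizes_copy_base:
  assumes "k > 0"
  shows "\<exists>f. realizes voc (copy_voc k voc) f (\<lambda>A. {copy_struct voc k A})"
  unfolding realizes_def
  by (rule exI, rule conjI[OF copying[OF assms]]) (auto simp: copy_struct_def is_struct_def)

lemma realizes_colour_base:
  assumes "k > 0"
  shows "\<exists>f. realizes voc (colour_voc k voc) f
    (\<lambda>A. {colour_struct voc c A |c. c ` univ A \<subseteq> {..<k}})"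
  unfolding realizes_def
  by (rule exI, rule conjI[OF colouring[OF assms]]) (auto simp: colour_struct_def is_struct_def)

section \<open>Formulas for linear combinations\<close>

text \<open>Truth is a closed formula: \<open>Eq 0 0\<close> alone has a free element variable and
  could not occur in a formula without element arguments.\<close>

abbreviation "FTrue \<equiv> Neg (ExElem 0 (Neg (Eq 0 0)))"
abbreviation "FFalse \<equiv> Neg FTrue"
abbreviation "Or \<phi> \<psi> \<equiv> Neg (Conj (Neg \<phi>) (Neg \<psi>))"
abbreviation "Imp \<phi> \<psi> \<equiv> Neg (Conj \<phi> (Neg \<psi>))"
abbreviation "Iff \<phi> \<psi> \<equiv> Conj (Imp \<phi> \<psi>) (Imp \<psi> \<phi>)"
abbreviation "AllElem x \<phi> \<equiv> Neg (ExElem x (Neg \<phi>))"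

primrec Disj :: "mso list \<Rightarrow> mso" where
  "Disj [] = FFalse"
| "Disj (\<phi> # \<phi>s) = Or \<phi> (Disj \<phi>s)"

lemma sat_Disj [simp]: "sat A e s (Disj \<phi>s) \<longleftrightarrow> (\<exists>\<phi>\<in>set \<phi>s. sat A e s \<phi>)"
  by (induction \<phi>s) auto

lemma elem_fv_Disj [simp]: "elem_fv (Disj \<phi>s) = (\<Union>\<phi>\<in>set \<phi>s. elem_fv \<phi>)"
  and set_fv_Disj [simp]: "set_fv (Disj \<phi>s) = (\<Union>\<phi>\<in>set \<phi>s. set_fv \<phi>)"
  and over_voc_Disj [simp]: "over_voc voc (Disj \<phi>s) \<longleftrightarrow> (\<forall>\<phi>\<in>set \<phi>s. over_voc voc \<phi>)"
  by (induction \<phi>s) auto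

primrec ExSets :: "nat \<Rightarrow> nat \<Rightarrow> mso \<Rightarrow> mso" where
  "ExSets k 0 \<phi> = \<phi>"
| "ExSets k (Suc n) \<phi> = ExSet (k + n) (ExSets k n \<phi>)"

definition upd_sets :: "nat \<Rightarrow> 'a set list \<Rightarrow> (nat \<Rightarrow> 'a set) \<Rightarrow> nat \<Rightarrow> 'a set" where
  "upd_sets k Ys s = (\<lambda>i. if k \<le> i \<and> i < k + length Ys then Ys ! (i - k) else s i)"

lemma map_upd_sets: "map (upd_sets k Ys s) [k..<k + length Ys] = Ys"
  by (rule nth_equalityI) (auto simp: upd_sets_def)

lemma sat_ExSets:
  "sat A e s (ExSets k n \<phi>) \<longleftrightarrow>
    (\<exists>Ys. length Ys = n \<and> (\<forall>Y\<in>set Ys. Y \<subseteq> univ A) \<and> sat A e (upd_sets k Ys s) \<phi>)"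
proof (induction n arbitrary: s)
  case 0
  have "upd_sets k [] s = s" by (rule ext) (auto simp: upd_sets_def)
  then show ?case by simp
next
  case (Suc n)
  \<comment> \<open>The outermost quantifier binds the last set variable, so the induction extends
    the list of sets at its end.\<close>
  have *: "upd_sets k Ys (s(k + n := S)) = upd_sets k (Ys @ [S]) s" if "length Ys = n" for Ys S
    by (rule ext) (use that in \<open>auto simp: upd_sets_def nth_append less_Suc_eq\<close>)
  have "sat A e s (ExSets k (Suc n) \<phi>) \<longleftrightarrow> (\<exists>S\<subseteq>univ A. \<exists>Ys. length Ys = n \<and>
      (\<forall>Y\<in>set Ys. Y \<subseteq> univ A) \<and> sat A e (upd_sets k (Ys @ [S]) s) \<phi>)"
    unfolding ExSets.simps sat.simps Suc.IH by (simp only: * cong: conj_cong)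
  also have "\<dots> \<longleftrightarrow> (\<exists>Zs. length Zs = Suc n \<and> (\<forall>Y\<in>set Zs. Y \<subseteq> univ A) \<and>
      sat A e (upd_sets k Zs s) \<phi>)"
  proof
    assume "\<exists>S\<subseteq>univ A. \<exists>Ys. length Ys = n \<and>
      (\<forall>Y\<in>set Ys. Y \<subseteq> univ A) \<and> sat A e (upd_sets k (Ys @ [S]) s) \<phi>"
    then obtain S Ys where "S \<subseteq> univ A" "length Ys = n" "\<forall>Y\<in>set Ys. Y \<subseteq> univ A"
      "sat A e (upd_sets k (Ys @ [S]) s) \<phi>" by auto
    then show "\<exists>Zs. length Zs = Suc n \<and> (\<forall>Y\<in>set Zs. Y \<subseteq> univ A) \<and>
      sat A e (upd_sets k Zs s) \<phi>" by (intro exI[of _ "Ys @ [S]"]) auto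
  next
    assume "\<exists>Zs. length Zs = Suc n \<and> (\<forall>Y\<in>set Zs. Y \<subseteq> univ A) \<and>
      sat A e (upd_sets k Zs s) \<phi>"
    then obtain Zs where Z: "length Zs = Suc n" "\<forall>Y\<in>set Zs. Y \<subseteq> univ A"
      "sat A e (upd_sets k Zs s) \<phi>" by auto
    then obtain Ys S where YS: "Zs = Ys @ [S]" by (metis length_Suc_conv_rev)
    show "\<exists>S\<subseteq>univ A. \<exists>Ys. length Ys = n \<and>
      (\<forall>Y\<in>set Ys. Y \<subseteq> univ A) \<and> sat A e (upd_sets k (Ys @ [S]) s) \<phi>"
      by (rule exI[of _ S], rule conjI, use Z YS in simp, rule exI[of _ Ys]) (use Z YS in simp)
  qed
  finally show ?case .
qed

lemma elem_fv_ExSets [simp]: "elem_fv (ExSets k n \<phi>) = elem_fv \<phi>"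
  and set_fv_ExSets [simp]: "set_fv (ExSets k n \<phi>) = set_fv \<phi> - {k..<k + n}"
  and over_voc_ExSets [simp]: "over_voc voc (ExSets k n \<phi>) \<longleftrightarrow> over_voc voc \<phi>"
  by (induction n) auto

definition coef :: "('f::field \<times> 'a set) list \<Rightarrow> 'a \<Rightarrow> 'f" where
  "coef ps x = (\<Sum>(\<alpha>, Y)\<leftarrow>ps. if x \<in> Y then \<alpha> else 0)"

lemma coef_simps [simp]:
  "coef [] x = 0" "coef ((\<alpha>, Y) # ps) x = (if x \<in> Y then \<alpha> else 0) + coef ps x"
  by (simp_all add: coef_def)

text \<open>Exchange of summation. It turns weighted sums of set sums, the form in which the null
  relation adds vectors, into one linear combination over the whole universe.\<close>

lemma sum_coef:
  assumes "finite U" "\<forall>(\<alpha>, Y)\<in>set ps. Y \<subseteq> U"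
  shows "(\<Sum>x\<in>U. coef ps x * f x) = (\<Sum>(\<alpha>, Y)\<leftarrow>ps. \<alpha> * (\<Sum>x\<in>Y. f x))"
  using assms(2)
proof (induction ps)
  case (Cons p ps)
  obtain \<alpha> Y where p: "p = (\<alpha>, Y)" by (cases p)
  then have "Y \<subseteq> U" using Cons.prems by auto
  have "(\<Sum>x\<in>U. (if x \<in> Y then \<alpha> else 0) * f x) = (\<Sum>x\<in>U \<inter> Y. \<alpha> * f x)"
    by (subst sum.inter_restrict[OF assms(1)]) (auto intro!: sum.cong)
  also have "\<dots> = \<alpha> * (\<Sum>x\<in>Y. f x)"
    using \<open>Y \<subseteq> U\<close> by (simp add: sum_distrib_left Int_absorb1)
  finally show ?case using Cons by (simp add: p distrib_right sum.distrib)
qed simp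

text \<open>Membership in the listed sets is decided one set at a time while \<open>c\<close>
  collects the weight so far. Any predicate \<open>P\<close> on the final coefficient is thereby
  expressible, since it is evaluated when the formula is built.\<close>

primrec coef_fm :: "('f::field \<Rightarrow> bool) \<Rightarrow> nat \<Rightarrow> ('f \<times> nat) list \<Rightarrow> 'f \<Rightarrow> mso" where
  "coef_fm P x [] c = (if P c then FTrue else FFalse)"
| "coef_fm P x (p # ps) c = Or (Conj (Mem x (snd p)) (coef_fm P x ps (c + fst p)))
     (Conj (Neg (Mem x (snd p))) (coef_fm P x ps c))"

lemma sat_coef_fm:
  "sat A e s (coef_fm P x ps c) \<longleftrightarrow> P (c + coef (map (apsnd s) ps) (e x))"
  by (induction ps arbitrary: c) (auto simp: add.assoc split: if_splits)

lemma elem_fv_coef_fm: "elem_fv (coef_fm P x ps c) \<subseteq> {x}"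
  and set_fv_coef_fm: "set_fv (coef_fm P x ps c) \<subseteq> snd ` set ps"
  and over_voc_coef_fm [simp]: "over_voc voc (coef_fm P x ps c)"
  by (induction ps arbitrary: c) auto

text \<open>In the next two formulas \<open>W\<close> is an auxiliary set variable.\<close>

definition card_fm :: "nat \<Rightarrow> nat \<Rightarrow> nat \<Rightarrow> nat \<Rightarrow> mso \<Rightarrow> mso" where
  "card_fm r m W x \<theta> = ExSet W (Conj (AllElem x (Iff (Mem x W) \<theta>)) (CardMod r m W))"

lemma sat_card_fm:
  assumes "W \<notin> set_fv \<theta>"
  shows "sat A e s (card_fm r m W x \<theta>) \<longleftrightarrow>
    card {a \<in> univ A. sat A (e(x := a)) s \<theta>} mod m = r mod m"
proof -
  have *: "sat A (e(x := a)) (s(W := S)) \<theta> \<longleftrightarrow> sat A (e(x := a)) s \<theta>" for a S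
    by (rule sat_cong) (use assms in auto)
  have "sat A e s (card_fm r m W x \<theta>) \<longleftrightarrow>
      (\<exists>S\<subseteq>univ A. (\<forall>a\<in>univ A. a \<in> S \<longleftrightarrow> sat A (e(x := a)) s \<theta>) \<and> card S mod m = r mod m)"
    unfolding card_fm_def sat.simps * fun_upd_same by (intro ex_cong1) blast
  also have "\<dots> \<longleftrightarrow> (\<exists>S. S = {a \<in> univ A. sat A (e(x := a)) s \<theta>} \<and> card S mod m = r mod m)"
    by (intro ex_cong1) blast
  finally show ?thesis by simp
qed

lemma fv_card_fm [simp]:
  "elem_fv (card_fm r m W x \<theta>) = elem_fv \<theta> - {x}"
  "set_fv (card_fm r m W x \<theta>) = set_fv \<theta> - {W}"
  "over_voc voc (card_fm r m W x \<theta>) \<longleftrightarrow> over_voc voc \<theta> \<and> m > 0"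
  by (auto simp: card_fm_def)

primrec lin_fm :: "nat \<Rightarrow> nat \<Rightarrow> ('f::field \<times> mso) list \<Rightarrow> 'f \<Rightarrow> mso" where
  "lin_fm W x [] c = (if c = 0 then FTrue else FFalse)"
| "lin_fm W x (p # ps) c =
     Disj (map (\<lambda>r. Conj (card_fm r CHAR('f) W x (snd p)) (lin_fm W x ps (c + of_nat r * fst p)))
       [0..<CHAR('f)])"

lemma CHAR_pos: "CHAR('f::{finite,field}) > 0"
  by (rule finite_imp_CHAR_pos) simp

lemma of_nat_mod_CHAR: "(of_nat (m mod CHAR('f)) :: 'f::field) = of_nat m"
  by (simp add: of_nat_eq_iff_cong_CHAR)

text \<open>A cardinality enters the field only through its residue modulo the characteristic.
  Guessing these residues one term after another, with the partial sum accumulated in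
  \<open>c\<close>, evaluates the sum.\<close>

lemma sat_lin_fm:
  fixes ps :: "('f::{finite,field} \<times> mso) list"
  assumes "\<forall>p\<in>set ps. W \<notin> set_fv (snd p)"
  shows "sat A e s (lin_fm W x ps c) \<longleftrightarrow>
    c + (\<Sum>(\<alpha>, \<theta>)\<leftarrow>ps. \<alpha> * of_nat (card {a \<in> univ A. sat A (e(x := a)) s \<theta>})) = 0"
  using assms
proof (induction ps arbitrary: c)
  case (Cons p ps)
  let ?C = "card {a \<in> univ A. sat A (e(x := a)) s (snd p)}"
  have "sat A e s (lin_fm W x (p # ps) c) \<longleftrightarrow>
      (\<exists>r<CHAR('f). ?C mod CHAR('f) = r \<and> sat A e s (lin_fm W x ps (c + of_nat r * fst p)))"
    using Cons.prems by (auto simp: sat_card_fm)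
  also have "\<dots> \<longleftrightarrow> sat A e s (lin_fm W x ps (c + of_nat ?C * fst p))"
    using CHAR_pos[where 'f = 'f] by (auto simp: of_nat_mod_CHAR)
  also have "\<dots> \<longleftrightarrow> c + (\<Sum>(\<alpha>, \<theta>)\<leftarrow>p # ps.
      \<alpha> * of_nat (card {a \<in> univ A. sat A (e(x := a)) s \<theta>})) = 0"
  proof -
    have "\<forall>p\<in>set ps. W \<notin> set_fv (snd p)" using Cons.prems by simp
    note IH = Cons.IH[OF this]
    show ?thesis
      unfolding IH by (simp only: list.map sum_list.Cons case_prod_beta add.assoc mult.commute)
  qed
  finally show ?case .
qed simp

lemma elem_fv_lin_fm: "elem_fv (lin_fm W x ps c) \<subseteq> (\<Union>p\<in>set ps. elem_fv (snd p)) - {x}"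
proof (induction ps arbitrary: c)
  case (Cons p ps)
  then show ?case by (simp add: UN_subset_iff) blast
qed simp

lemma set_fv_lin_fm: "set_fv (lin_fm W x ps c) \<subseteq> (\<Union>p\<in>set ps. set_fv (snd p)) - {W}"
proof (induction ps arbitrary: c)
  case (Cons p ps)
  then show ?case by (simp add: UN_subset_iff) blast
qed simp

lemma over_voc_lin_fm:
  "\<forall>p\<in>set ps. over_voc voc (snd p) \<Longrightarrow> over_voc voc (lin_fm W x (ps :: ('f::{finite,field} \<times> _) list) c)"
  by (induction ps arbitrary: c) (auto simp: CHAR_pos)


section \<open>Linear dependence with restricted coefficients\<close>

definition vanishes :: "'a set \<Rightarrow> ('a \<Rightarrow> 'c \<Rightarrow> 'f::field) \<Rightarrow> ('a \<Rightarrow> 'f) \<Rightarrow> bool" where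
  "vanishes U v k \<longleftrightarrow> (\<forall>z. (\<Sum>x\<in>U. k x * v x z) = 0)"

text \<open>The coefficient set \<open>K\<close> is a parameter: \<open>UNIV\<close> gives linear
  dependence over the field, \<open>prime_field\<close> the dependence that the null relation can
  express. Coefficients belong to elements rather than vectors, so repeated vectors can be cancelled
  against each other.\<close>

definition dependent_over ::
  "'f::field set \<Rightarrow> ('a \<Rightarrow> 'c \<Rightarrow> 'f) \<Rightarrow> 'a set \<Rightarrow> bool"
where
  "dependent_over K v X \<longleftrightarrow> (\<exists>k. (\<forall>x\<in>X. k x \<in> K) \<and> (\<forall>x. x \<notin> X \<longrightarrow> k x = 0) \<and>
     vanishes X v k \<and> (\<exists>x\<in>X. k x \<noteq> 0))"

lemma vanishes_superset:
  assumes "finite U" "X \<subseteq> U" "\<And>x. x \<notin> X \<Longrightarrow> k x = 0"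
  shows "vanishes U v k \<longleftrightarrow> vanishes X v k"
proof -
  have "(\<Sum>x\<in>U. k x * v x z) = (\<Sum>x\<in>X. k x * v x z)" for z
    by (rule sum.mono_neutral_right) (use assms in auto)
  then show ?thesis by (simp add: vanishes_def)
qed

lemma sum_list_fun_apply: "(\<Sum>x\<leftarrow>xs. f x) z = (\<Sum>x\<leftarrow>xs. f x z)"
  for f :: "'a \<Rightarrow> 'b \<Rightarrow> 'c::comm_monoid_add"
  by (induction xs) auto

lemma sum_fun_apply: "(\<Sum>x\<in>X. f x) z = (\<Sum>x\<in>X. f x z)"
  for f :: "'a \<Rightarrow> 'b \<Rightarrow> 'c::comm_monoid_add"
  by (induction X rule: infinite_finite_induct) auto

lemma zip_replicate_1: "length Ys = n \<Longrightarrow> zip (replicate n a) Ys = map (Pair a) Ys"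
  by (induction Ys arbitrary: n) auto

lemma null_iff_vanishes:
  fixes v :: "'a \<Rightarrow> 'c \<Rightarrow> 'f::field"
  assumes "finite U" "\<forall>Y\<in>set Ys. Y \<subseteq> U"
  shows "(\<Sum>Y\<leftarrow>Ys. \<Sum>x\<in>Y. v x) = 0 \<longleftrightarrow> vanishes U v (coef (zip (replicate (length Ys) 1) Ys))"
proof -
  have "(\<Sum>x\<in>U. coef (map (Pair 1) Ys) x * v x z) = (\<Sum>Y\<leftarrow>Ys. \<Sum>x\<in>Y. v x) z" for z
    using sum_coef[of U "map (Pair 1) Ys" "\<lambda>x. v x z"] assms
    by (simp add: comp_def sum_list_fun_apply sum_fun_apply)
  then show ?thesis by (simp add: vanishes_def zip_replicate_1 fun_eq_iff)
qed

primrec subset_sums :: "'f::field list \<Rightarrow> 'f set" where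
  "subset_sums [] = {0}"
| "subset_sums (\<alpha> # \<alpha>s) = subset_sums \<alpha>s \<union> (+) \<alpha> ` subset_sums \<alpha>s"

lemma coef_in_subset_sums: "coef (zip \<alpha>s Ys) x \<in> subset_sums \<alpha>s"
proof (induction \<alpha>s arbitrary: Ys)
  case (Cons \<alpha> \<alpha>s)
  show ?case
  proof (cases Ys)
    case Nil
    then show ?thesis using Cons[of "[]"] by simp
  next
    case (Cons Y Ys')
    then show ?thesis using Cons.IH[of Ys'] by auto
  qed
qed simp

lemma coef_eq_0: "\<forall>Y\<in>set Ys. x \<notin> Y \<Longrightarrow> coef (zip \<alpha>s Ys) x = 0"
proof (induction \<alpha>s arbitrary: Ys)
  case (Cons \<alpha> \<alpha>s)
  then show ?case by (cases Ys) auto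
qed simp

text \<open>Greedy decomposition: a value that the remaining weights already produce is left to
  them, and any other value must use the first weight.\<close>

lemma ex_coef_eq:
  assumes "\<forall>x\<in>X. k x \<in> subset_sums \<alpha>s" "\<forall>x. x \<notin> X \<longrightarrow> k x = 0"
  shows "\<exists>Ys. length Ys = length \<alpha>s \<and> (\<forall>Y\<in>set Ys. Y \<subseteq> X) \<and> coef (zip \<alpha>s Ys) = k"
  using assms
proof (induction \<alpha>s arbitrary: k)
  case Nil
  then show ?case by (auto simp: fun_eq_iff)
next
  case (Cons \<alpha> \<alpha>s)
  define Y where "Y = {x \<in> X. k x \<notin> subset_sums \<alpha>s}"
  define k' where "k' x = (if x \<in> Y then k x - \<alpha> else k x)" for x
  have "\<forall>x\<in>X. k' x \<in> subset_sums \<alpha>s" "\<forall>x. x \<notin> X \<longrightarrow> k' x = 0"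
    using Cons.prems by (auto simp: k'_def Y_def)
  then obtain Ys where "length Ys = length \<alpha>s" "\<forall>Y\<in>set Ys. Y \<subseteq> X" "coef (zip \<alpha>s Ys) = k'"
    using Cons.IH by blast
  then have "length (Y # Ys) = length (\<alpha> # \<alpha>s) \<and> (\<forall>Y\<in>set (Y # Ys). Y \<subseteq> X) \<and>
      coef (zip (\<alpha> # \<alpha>s) (Y # Ys)) = k"
    by (auto simp: fun_eq_iff k'_def Y_def)
  then show ?case by blast
qed

text \<open>This is how MSO quantifies over coefficient functions: a function with values in
  \<open>subset_sums \<alpha>s\<close> amounts to a list of sets weighted by
  \<open>\<alpha>s\<close>.\<close>

lemma ex_sets_iff_ex_coef:
  "(\<exists>Ys. length Ys = length \<alpha>s \<and> (\<forall>Y\<in>set Ys. Y \<subseteq> X) \<and> Q (coef (zip \<alpha>s Ys))) \<longleftrightarrow>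
   (\<exists>k. (\<forall>x\<in>X. k x \<in> subset_sums \<alpha>s) \<and> (\<forall>x. x \<notin> X \<longrightarrow> k x = 0) \<and> Q k)" (is "?L \<longleftrightarrow> ?R")
proof
  assume ?L
  then obtain Ys where "\<forall>Y\<in>set Ys. Y \<subseteq> X" "Q (coef (zip \<alpha>s Ys))" by blast
  then show ?R
    by (intro exI[of _ "coef (zip \<alpha>s Ys)"]) (auto intro: coef_in_subset_sums coef_eq_0)
next
  assume ?R
  then show ?L using ex_coef_eq by metis
qed

lemma subset_sums_replicate: "subset_sums (replicate n 1) = of_nat ` {..n}"
proof (induction n)
  case (Suc n)
  have "of_nat ` {..Suc n} = of_nat ` {..n} \<union> (+) 1 ` of_nat ` {..n}"
  proof -
    have "{..Suc n} = {..n} \<union> Suc ` {..n}"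
      by (auto simp: image_iff) (metis Suc_le_mono atMost_iff not0_implies_Suc zero_le)
    then show ?thesis by (simp only: image_Un image_image of_nat_Suc)
  qed
  then show ?case unfolding replicate_Suc subset_sums.simps Suc ..
qed simp

lemma zero_in_subset_sums: "0 \<in> subset_sums \<alpha>s"
  by (induction \<alpha>s) auto

lemma in_subset_sums: "\<alpha> \<in> set \<alpha>s \<Longrightarrow> \<alpha> \<in> subset_sums \<alpha>s"
  by (induction \<alpha>s) (auto simp: image_iff intro: zero_in_subset_sums bexI[of _ 0])

section \<open>The prime field, and weights producing all prime-field or all field
  coefficients\<close>

definition null_arity :: "'f::{finite,field} itself \<Rightarrow> nat" where
  "null_arity F = card (UNIV :: 'f set) - 1"

definition prime_field :: "'f::{finite,field} set" where
  "prime_field = range of_nat"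

definition prime_weights :: "'f::{finite,field} list" where
  "prime_weights = replicate (null_arity TYPE('f)) 1"

lemma length_prime_weights [simp]:
  "length (prime_weights :: 'f::{finite,field} list) = null_arity TYPE('f)"
  by (simp add: prime_weights_def)

text \<open>The subset sums are the multiples of 1 from 0 to |F| - 1. The multiples below the
  characteristic are distinct, so the characteristic is at most |F| and every residue
  occurs.\<close>

lemma subset_sums_prime_weights: "subset_sums (prime_weights :: 'f::{finite,field} list) = prime_field"
proof -
  have "inj_on (of_nat :: nat \<Rightarrow> 'f) {..<CHAR('f)}"
    by (auto simp: inj_on_def of_nat_eq_iff_cong_CHAR cong_def)
  then have "card ((of_nat :: nat \<Rightarrow> 'f) ` {..<CHAR('f)}) = CHAR('f)" by (simp add: card_image)
  then have "CHAR('f) \<le> card (UNIV :: 'f set)" by (metis card_mono finite subset_UNIV)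
  then have "m mod CHAR('f) \<le> null_arity TYPE('f)" for m
    using CHAR_pos[where 'f = 'f] mod_less_divisor[of "CHAR('f)" m] unfolding null_arity_def by linarith
  then have "(of_nat m :: 'f) \<in> of_nat ` {..null_arity TYPE('f)}" for m
    using of_nat_mod_CHAR[of m, where 'f = 'f] by (metis atMost_iff image_eqI)
  then show ?thesis by (auto simp: prime_weights_def subset_sums_replicate prime_field_def)
qed

text \<open>With every scalar listed, each coefficient is already produced by membership in a single
  set. Such weights serve where a formula evaluates the scalars itself, not for arguments of the
  null relation, whose weights are all 1.\<close>

definition field_weights :: "'f::{finite,field} list" where
  "field_weights = (SOME \<alpha>s. set \<alpha>s = UNIV)"

lemma subset_sums_field_weights: "subset_sums (field_weights :: 'f::{finite,field} list) = UNIV"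
proof -
  have "\<exists>\<alpha>s :: 'f list. set \<alpha>s = UNIV" by (simp add: finite_list)
  then have "set (field_weights :: 'f list) = UNIV" unfolding field_weights_def by (rule someI_ex)
  then show ?thesis using in_subset_sums by auto
qed

lemma prime_field_closed:
  shows "0 \<in> (prime_field :: 'f::{finite,field} set)" "1 \<in> (prime_field :: 'f set)"
    "- 1 \<in> (prime_field :: 'f set)"
    "a \<in> prime_field \<Longrightarrow> b \<in> prime_field \<Longrightarrow> a + b \<in> (prime_field :: 'f set)"
    "a \<in> prime_field \<Longrightarrow> b \<in> prime_field \<Longrightarrow> a * b \<in> (prime_field :: 'f set)"
proof -
  show "0 \<in> (prime_field :: 'f set)" by (auto simp: prime_field_def intro: range_eqI[of _ _ 0])
  show "1 \<in> (prime_field :: 'f set)" by (auto simp: prime_field_def intro: range_eqI[of _ _ 1])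
  have "of_nat (CHAR('f) - 1) + (1 :: 'f) = of_nat (CHAR('f) - 1 + 1)" by (simp only: of_nat_add of_nat_1)
  also have "\<dots> = 0" using CHAR_pos[where 'f = 'f] by simp
  finally have "(- 1 :: 'f) = of_nat (CHAR('f) - 1)" by (metis add.commute minus_unique)
  then show "- 1 \<in> (prime_field :: 'f set)" by (simp add: prime_field_def)
  show "a + b \<in> (prime_field :: 'f set)" if "a \<in> prime_field" "b \<in> prime_field"
    using that by (auto simp: prime_field_def of_nat_add[symmetric] simp del: of_nat_add)
  show "a * b \<in> (prime_field :: 'f set)" if "a \<in> prime_field" "b \<in> prime_field"
    using that by (auto simp: prime_field_def of_nat_mult[symmetric] simp del: of_nat_mult)
qed

lemma prime_field_uminus: "a \<in> prime_field \<Longrightarrow> - a \<in> (prime_field :: 'f::{finite,field} set)"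
  using prime_field_closed(5)[OF prime_field_closed(3), of a] by simp

lemma prime_field_sum: "(\<And>x. x \<in> X \<Longrightarrow> f x \<in> prime_field) \<Longrightarrow> sum f X \<in> (prime_field :: 'f::{finite,field} set)"
  by (induction X rule: infinite_finite_induct) (auto simp: prime_field_closed)

text \<open>Two powers of \<open>a\<close> coincide in a finite field, so the inverse of a nonzero
  \<open>a\<close> is itself a power of \<open>a\<close>, and the prime field is closed under
  products.\<close>

lemma prime_field_inverse:
  assumes "a \<in> prime_field"
  shows "inverse a \<in> (prime_field :: 'f::{finite,field} set)"
proof (cases "a = 0")
  case False
  have pow: "a ^ m \<in> prime_field" for m
    by (induction m) (auto simp: prime_field_closed assms)
  have "\<not> inj (\<lambda>m::nat. a ^ m)"
    using finite_imageD[of "\<lambda>m::nat. a ^ m" UNIV] finite[of "range (\<lambda>m::nat. a ^ m)"] by auto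
  then obtain i j where "i < j" "a ^ i = a ^ j"
    unfolding inj_def by (metis linorder_neqE_nat)
  then have "a ^ i * (a * a ^ (j - i - 1)) = a ^ i * 1"
  proof -
    have "a ^ i * (a * a ^ (j - i - 1)) = a ^ (i + Suc (j - i - 1))"
      by (simp only: power_add power_Suc)
    also have "i + Suc (j - i - 1) = j" using \<open>i < j\<close> by simp
    finally show ?thesis using \<open>a ^ i = a ^ j\<close> by simp
  qed
  then have "a * a ^ (j - i - 1) = 1" using False by simp
  then have "inverse a = a ^ (j - i - 1)" by (rule inverse_unique)
  then show ?thesis using pow by simp
qed (simp add: prime_field_closed)

text \<open>\<open>\<nu>\<close> is to say that the combination coded by the set variables from
  \<open>k\<close> on vanishes. Leaving it open lets one formula serve null matroids, where
  \<open>\<nu>\<close> is an atom, and the matrix of a relation, where \<open>\<nu>\<close> counts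
  entries.\<close>

definition dep_fm :: "'f::{finite,field} list \<Rightarrow> nat \<Rightarrow> nat \<Rightarrow> nat \<Rightarrow> mso \<Rightarrow> mso" where
  "dep_fm \<alpha>s X k y \<nu> = (let vs = [k..<k + length \<alpha>s] in ExSets k (length \<alpha>s)
     (Conj (Neg (Disj (map (\<lambda>i. ExElem y (Conj (Mem y i) (Neg (Mem y X)))) vs)))
        (Conj \<nu> (ExElem y (coef_fm (\<lambda>c. c \<noteq> 0) y (zip \<alpha>s vs) 0)))))"

lemma map_apsnd_zip: "map (apsnd f) (zip xs ys) = zip xs (map f ys)"
  by (simp add: zip_map2 apsnd_def map_prod_def)

lemma sat_dep_fm:
  fixes A :: "'a struct" and \<alpha>s :: "'f::{finite,field} list"
  assumes fin: "finite (univ A)" and X: "X < k" "s X \<subseteq> univ A"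
    and \<nu>: "\<And>Ys. length Ys = length \<alpha>s \<Longrightarrow> \<forall>Y\<in>set Ys. Y \<subseteq> univ A \<Longrightarrow>
      sat A e (upd_sets k Ys s) \<nu> \<longleftrightarrow> vanishes (univ A) v (coef (zip \<alpha>s Ys))"
  shows "sat A e s (dep_fm \<alpha>s X k y \<nu>) \<longleftrightarrow> dependent_over (subset_sums \<alpha>s) v (s X)"
proof -
  let ?n = "length \<alpha>s"
  have body: "sat A e (upd_sets k Ys s) (Conj (Neg (Disj (map (\<lambda>i. ExElem y (Conj (Mem y i) (Neg (Mem y X)))) [k..<k + ?n])))
        (Conj \<nu> (ExElem y (coef_fm (\<lambda>c. c \<noteq> 0) y (zip \<alpha>s [k..<k + ?n]) 0)))) \<longleftrightarrow>
      (\<forall>Y\<in>set Ys. Y \<subseteq> s X) \<and> vanishes (univ A) v (coef (zip \<alpha>s Ys)) \<and>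
        (\<exists>x\<in>univ A. coef (zip \<alpha>s Ys) x \<noteq> 0)" (is "?l \<longleftrightarrow> ?r")
    if Ys: "length Ys = ?n" "\<forall>Y\<in>set Ys. Y \<subseteq> univ A" for Ys
  proof -
    let ?s = "upd_sets k Ys s"
    have X': "?s X = s X" using X by (simp add: upd_sets_def)
    have "(\<exists>i\<in>set [k..<k + ?n]. \<exists>a\<in>univ A. a \<in> ?s i \<and> a \<notin> s X) \<longleftrightarrow>
        (\<exists>Y\<in>set (map ?s [k..<k + ?n]). \<exists>a\<in>univ A. a \<in> Y \<and> a \<notin> s X)"
      unfolding set_map by blast
    also have "\<dots> \<longleftrightarrow> \<not> (\<forall>Y\<in>set Ys. Y \<subseteq> s X)"
      unfolding Ys(1)[symmetric] map_upd_sets using Ys(2) by blast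
    finally have 1: "(\<exists>i\<in>set [k..<k + ?n]. \<exists>a\<in>univ A. a \<in> ?s i \<and> a \<notin> s X) \<longleftrightarrow>
        \<not> (\<forall>Y\<in>set Ys. Y \<subseteq> s X)" .
    have 2: "map (apsnd ?s) (zip \<alpha>s [k..<k + ?n]) = zip \<alpha>s Ys"
      unfolding map_apsnd_zip Ys(1)[symmetric] map_upd_sets ..
    have "?l \<longleftrightarrow> \<not> (\<exists>i\<in>set [k..<k + ?n]. \<exists>a\<in>univ A. a \<in> ?s i \<and> a \<notin> s X) \<and>
        sat A e ?s \<nu> \<and> (\<exists>x\<in>univ A. coef (map (apsnd ?s) (zip \<alpha>s [k..<k + ?n])) x \<noteq> 0)"
      by (simp add: sat_coef_fm X')
    also have "\<dots> \<longleftrightarrow> ?r" unfolding 1 2 \<nu>[OF Ys] by blast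
    finally show ?thesis .
  qed
  have "sat A e s (dep_fm \<alpha>s X k y \<nu>) \<longleftrightarrow> (\<exists>Ys. length Ys = ?n \<and> (\<forall>Y\<in>set Ys. Y \<subseteq> univ A) \<and>
      (\<forall>Y\<in>set Ys. Y \<subseteq> s X) \<and> vanishes (univ A) v (coef (zip \<alpha>s Ys)) \<and>
        (\<exists>x\<in>univ A. coef (zip \<alpha>s Ys) x \<noteq> 0))"
    unfolding dep_fm_def Let_def sat_ExSets using body by (intro ex_cong1) blast
  also have "\<dots> \<longleftrightarrow> (\<exists>Ys. length Ys = ?n \<and> (\<forall>Y\<in>set Ys. Y \<subseteq> s X) \<and>
      (vanishes (univ A) v (coef (zip \<alpha>s Ys)) \<and> (\<exists>x\<in>univ A. coef (zip \<alpha>s Ys) x \<noteq> 0)))"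
    using X(2) by (intro ex_cong1) blast
  also have "\<dots> \<longleftrightarrow> (\<exists>k. (\<forall>x\<in>s X. k x \<in> subset_sums \<alpha>s) \<and> (\<forall>x. x \<notin> s X \<longrightarrow> k x = 0) \<and>
      (vanishes (univ A) v k \<and> (\<exists>x\<in>univ A. k x \<noteq> 0)))"
    by (rule ex_sets_iff_ex_coef)
  also have "\<dots> \<longleftrightarrow> dependent_over (subset_sums \<alpha>s) v (s X)"
    unfolding dependent_over_def
  proof (intro ex_cong1 conj_cong refl)
    fix k :: "'a \<Rightarrow> 'f" assume k: "\<forall>x. x \<notin> s X \<longrightarrow> k x = 0"
    show "vanishes (univ A) v k \<longleftrightarrow> vanishes (s X) v k"
      by (rule vanishes_superset[OF fin X(2)]) (use k in simp)
    show "(\<exists>x\<in>univ A. k x \<noteq> 0) \<longleftrightarrow> (\<exists>x\<in>s X. k x \<noteq> 0)" using k X(2) by blast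
  qed
  finally show ?thesis .
qed

lemma elem_fv_dep_fm: "elem_fv (dep_fm \<alpha>s X k y \<nu>) \<subseteq> elem_fv \<nu>"
  using elem_fv_coef_fm by (fastforce simp: dep_fm_def Let_def)

lemma set_fv_dep_fm:
  "set_fv (dep_fm \<alpha>s X k y \<nu>) \<subseteq> insert X (set_fv \<nu> - {k..<k + length \<alpha>s})"
proof -
  have "set_fv (coef_fm P y (zip \<alpha>s [k..<k + length \<alpha>s]) c) \<subseteq> {k..<k + length \<alpha>s}" for P c
    by (rule order_trans[OF set_fv_coef_fm]) (auto dest: set_zip_rightD)
  then show ?thesis by (auto simp: dep_fm_def Let_def)
qed

lemma over_voc_dep_fm [simp]: "over_voc voc (dep_fm \<alpha>s X k y \<nu>) \<longleftrightarrow> over_voc voc \<nu>"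
  by (auto simp: dep_fm_def Let_def)

lemma isomorphicI: "isomorphism voc h A B \<Longrightarrow> isomorphic voc A B"
  by (auto simp: isomorphic_def)

section \<open>Represented matroids\<close>

definition represents :: "'f::field list \<Rightarrow> ('a \<Rightarrow> 'c \<Rightarrow> 'f) \<Rightarrow> 'a struct \<Rightarrow> bool" where
  "represents \<alpha>s v X \<longleftrightarrow> (\<forall>Ys. length Ys = length \<alpha>s \<longrightarrow> (\<forall>Y\<in>set Ys. Y \<subseteq> univ X) \<longrightarrow>
     (rel X 0 [] Ys \<longleftrightarrow> vanishes (univ X) v (coef (zip \<alpha>s Ys))))"

definition indep_represents :: "'f::field set \<Rightarrow> ('a \<Rightarrow> 'c \<Rightarrow> 'f) \<Rightarrow> 'a struct \<Rightarrow> bool" where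
  "indep_represents K v X \<longleftrightarrow> (\<forall>Y\<subseteq>univ X. rel X 0 [] [Y] \<longleftrightarrow> \<not> dependent_over K v Y)"

text \<open>The matroid classes index coordinates by naturals, the constructions by elements or
  pairs. Reindexing along \<open>from_nat\<close> loses no coordinate because that map is
  surjective.\<close>

lemma vanishes_from_nat:
  fixes v :: "'a \<Rightarrow> 'c::countable \<Rightarrow> 'f::field"
  shows "vanishes U (\<lambda>x i. v x (from_nat i)) k \<longleftrightarrow> vanishes U v k"
  unfolding vanishes_def by (metis from_nat_to_nat)

lemma coef_image:
  assumes "inj_on g U" "\<forall>Y\<in>set Ys. Y \<subseteq> U" "x \<in> U"
  shows "coef (zip \<alpha>s (map ((`) g) Ys)) (g x) = coef (zip \<alpha>s Ys) x"
  using assms(2)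
proof (induction Ys arbitrary: \<alpha>s)
  case (Cons Y Ys)
  have "g x \<in> g ` Y \<longleftrightarrow> x \<in> Y"
    using inj_on_image_mem_iff[OF assms(1,3)] Cons.prems by simp
  then show ?case using Cons by (cases \<alpha>s) simp_all
qed simp

lemma vanishes_reindex:
  assumes "bij_betw g U V" "\<And>x. x \<in> U \<Longrightarrow> k' (g x) = k x"
  shows "vanishes V v k' \<longleftrightarrow> vanishes U (\<lambda>x. v (g x)) k"
proof -
  have "(\<Sum>y\<in>V. k' y * v y z) = (\<Sum>x\<in>U. k x * v (g x) z)" for z
    unfolding sum.reindex_bij_betw[OF assms(1), symmetric]
    by (intro sum.cong refl) (simp add: assms(2))
  then show ?thesis by (simp add: vanishes_def)
qed

lemma represents_pullback:
  assumes iso: "isomorphism [(0, length \<alpha>s)] g B X" and rep: "represents \<alpha>s v X"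
  shows "represents \<alpha>s (\<lambda>b. v (g b)) B"
  unfolding represents_def
proof (intro allI impI)
  fix Ys :: "'a set list"
  assume Ys: "length Ys = length \<alpha>s" "\<forall>Y\<in>set Ys. Y \<subseteq> univ B"
  have bij: "bij_betw g (univ B) (univ X)" using iso by (simp add: isomorphism_def)
  then have sub: "\<forall>Y\<in>set (map ((`) g) Ys). Y \<subseteq> univ X"
    using Ys(2) by (auto simp: bij_betw_def)
  have "rel B 0 [] Ys \<longleftrightarrow> rel X 0 [] (map ((`) g) Ys)"
    using isomorphism_rel[OF iso, of 0 "[]" Ys] Ys by (simp add: args_def)
  also have "\<dots> \<longleftrightarrow> vanishes (univ X) v (coef (zip \<alpha>s (map ((`) g) Ys)))"
    using rep sub Ys(1) by (simp add: represents_def)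
  also have "\<dots> \<longleftrightarrow> vanishes (univ B) (\<lambda>b. v (g b)) (coef (zip \<alpha>s Ys))"
    by (rule vanishes_reindex[OF bij coef_image[OF _ Ys(2)]]) (use bij in \<open>simp add: bij_betw_def\<close>)
  finally show "rel B 0 [] Ys \<longleftrightarrow> vanishes (univ B) (\<lambda>b. v (g b)) (coef (zip \<alpha>s Ys))" .
qed

lemma dependent_over_image:
  assumes inj: "inj_on g Y"
  shows "dependent_over K v (g ` Y) \<longleftrightarrow> dependent_over K (\<lambda>b. v (g b)) Y"
proof
  have bij: "bij_betw g Y (g ` Y)" using inj by (simp add: bij_betw_def)
  assume "dependent_over K v (g ` Y)"
  then obtain k where k: "\<forall>x\<in>g ` Y. k x \<in> K" "vanishes (g ` Y) v k" "\<exists>x\<in>g ` Y. k x \<noteq> 0"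
    by (auto simp: dependent_over_def)
  let ?k = "\<lambda>x. if x \<in> Y then k (g x) else 0"
  have "vanishes Y (\<lambda>b. v (g b)) ?k"
    using vanishes_reindex[OF bij, of k ?k v] k(2) by simp
  then show "dependent_over K (\<lambda>b. v (g b)) Y"
    unfolding dependent_over_def using k by (intro exI[of _ ?k]) auto
next
  have bij: "bij_betw g Y (g ` Y)" using inj by (simp add: bij_betw_def)
  assume "dependent_over K (\<lambda>b. v (g b)) Y"
  then obtain k where k: "\<forall>x\<in>Y. k x \<in> K" "vanishes Y (\<lambda>b. v (g b)) k" "\<exists>x\<in>Y. k x \<noteq> 0"
    by (auto simp: dependent_over_def)
  let ?k = "\<lambda>y. if y \<in> g ` Y then k (inv_into Y g y) else 0"
  have *: "?k (g x) = k x" if "x \<in> Y" for x using that inj by simp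
  have "vanishes (g ` Y) v ?k"
    using vanishes_reindex[OF bij, of ?k k v] k(2) * by simp
  moreover have "\<exists>x\<in>g ` Y. ?k x \<noteq> 0"
  proof -
    obtain x where "x \<in> Y" "k x \<noteq> 0" using k(3) by blast
    then show ?thesis using * by (intro bexI[of _ "g x"]) auto
  qed
  ultimately show "dependent_over K v (g ` Y)"
    unfolding dependent_over_def using k(1) inj by (intro exI[of _ ?k]) auto
qed

lemma indep_represents_pullback:
  assumes iso: "isomorphism independence_voc g B X" and rep: "indep_represents K v X"
  shows "indep_represents K (\<lambda>b. v (g b)) B"
  unfolding indep_represents_def
proof (intro allI impI)
  fix Y assume Y: "Y \<subseteq> univ B"
  have bij: "bij_betw g (univ B) (univ X)" using iso by (simp add: isomorphism_def)
  then have sub: "g ` Y \<subseteq> univ X" using Y by (auto simp: bij_betw_def)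
  have "rel B 0 [] [Y] \<longleftrightarrow> rel X 0 [] [g ` Y]"
    using isomorphism_rel[OF iso, of 0 "[]" "[Y]"] Y by (simp add: args_def independence_voc_def)
  also have "\<dots> \<longleftrightarrow> \<not> dependent_over K v (g ` Y)" using rep sub by (simp add: indep_represents_def)
  also have "\<dots> \<longleftrightarrow> \<not> dependent_over K (\<lambda>b. v (g b)) Y"
    using dependent_over_image[of g Y K v] bij Y inj_on_subset by (auto simp: bij_betw_def)
  finally show "rel B 0 [] [Y] \<longleftrightarrow> \<not> dependent_over K (\<lambda>b. v (g b)) Y" .
qed

text \<open>Injectivity is absorbed into dependence on elements: two elements with the same vector
  cancel with coefficients 1 and -1. On an injective family, coefficients of elements and of vectors
  correspond.\<close>

lemma independent_iff_not_dependent_over: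
  fixes w :: "'a \<Rightarrow> nat \<Rightarrow> 'f::field"
  assumes fin: "finite Y"
  shows "inj_on w Y \<and> \<not> module.dependent pointwise_scale (w ` Y) \<longleftrightarrow> \<not> dependent_over UNIV w Y"
proof -
  interpret vector_space "pointwise_scale :: 'f \<Rightarrow> _" by (rule vector_space_pointwise_scale)
  have eval: "(\<Sum>y\<in>w ` Y. pointwise_scale (u y) y) = 0 \<longleftrightarrow> (\<forall>z. (\<Sum>x\<in>Y. u (w x) * w x z) = 0)"
    if "inj_on w Y" for u :: "(nat \<Rightarrow> 'f) \<Rightarrow> 'f"
  proof -
    have "(\<Sum>y\<in>w ` Y. pointwise_scale (u y) y) z = (\<Sum>x\<in>Y. u (w x) * w x z)" for z
      by (simp add: sum_fun_apply sum.reindex[OF that] pointwise_scale_def)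
    then show ?thesis by (simp add: fun_eq_iff)
  qed
  show ?thesis
  proof
    assume *: "inj_on w Y \<and> \<not> dependent (w ` Y)"
    show "\<not> dependent_over UNIV w Y"
    proof
      assume "dependent_over UNIV w Y"
      then obtain k where k: "vanishes Y w k" "\<exists>x\<in>Y. k x \<noteq> 0" by (auto simp: dependent_over_def)
      define u where "u y = k (inv_into Y w y)" for y
      have u: "u (w x) = k x" if "x \<in> Y" for x using that * by (simp add: u_def)
      have "(\<Sum>y\<in>w ` Y. pointwise_scale (u y) y) = 0"
        using k(1) * u by (subst eval) (auto simp: vanishes_def cong: sum.cong)
      moreover have "\<exists>y\<in>w ` Y. u y \<noteq> 0" using k(2) u by auto
      ultimately have "dependent (w ` Y)" using fin by (subst dependent_finite) auto
      then show False using * by blast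
    qed
  next
    assume nd: "\<not> dependent_over UNIV w Y"
    have inj: "inj_on w Y"
    proof (rule inj_onI, rule ccontr)
      fix x y assume xy: "x \<in> Y" "y \<in> Y" "w x = w y" "x \<noteq> y"
      let ?k = "\<lambda>t. (if t = x then 1 else 0) + (if t = y then - 1 else 0 :: 'f)"
      have "(\<Sum>t\<in>Y. ?k t * w t z) = 0" for z
      proof -
        have "(\<Sum>t\<in>Y. ?k t * w t z) =
            (\<Sum>t\<in>Y. (if t = x then w x z else 0) + (if t = y then - w y z else 0))"
          by (intro sum.cong) auto
        also have "\<dots> = 0" using xy fin by (simp add: sum.distrib)
        finally show ?thesis .
      qed
      then have "vanishes Y w ?k" by (simp add: vanishes_def)
      moreover have "?k x \<noteq> 0" using xy(4) by simp
      ultimately have "dependent_over UNIV w Y"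
        unfolding dependent_over_def using xy by (intro exI[of _ ?k]) auto
      then show False using nd by blast
    qed
    moreover have "\<not> dependent (w ` Y)"
    proof
      assume "dependent (w ` Y)"
      then obtain u where u: "\<exists>y\<in>w ` Y. u y \<noteq> 0" "(\<Sum>y\<in>w ` Y. pointwise_scale (u y) y) = 0"
        using fin by (subst (asm) dependent_finite) auto
      let ?k = "\<lambda>x. if x \<in> Y then u (w x) else 0"
      have "vanishes Y w ?k"
        using u(2) unfolding eval[OF inj] vanishes_def by (simp cong: sum.cong)
      then have "dependent_over UNIV w Y"
        unfolding dependent_over_def using u(1) by (intro exI[of _ ?k]) auto
      then show False using nd by blast
    qed
    ultimately show "inj_on w Y \<and> \<not> dependent (w ` Y)" by blast
  qed
qed

lemma null_voc_eq: "null_voc TYPE('f::{finite,field}) = [(0, length (prime_weights :: 'f list))]"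
  by (simp add: null_voc_def null_arity_def)

lemma fst_null_matroids: "fst (null_matroids TYPE('f::{finite,field})) = null_voc TYPE('f)"
  by (simp add: null_matroids_def)

lemma represents_null_rep:
  fixes v :: "'a \<Rightarrow> 'c \<Rightarrow> 'f::{finite,field}"
  assumes "finite E"
  shows "represents prime_weights v (null_rep E v)"
  unfolding represents_def
proof (intro allI impI)
  fix Ys :: "'a set list"
  assume Ys: "length Ys = length (prime_weights :: 'f list)" "\<forall>Y\<in>set Ys. Y \<subseteq> univ (null_rep E v)"
  have "prime_weights = replicate (length Ys) (1 :: 'f)" using Ys(1) by (simp add: prime_weights_def)
  then show "rel (null_rep E v) 0 [] Ys \<longleftrightarrow>
      vanishes (univ (null_rep E v)) v (coef (zip prime_weights Ys))"
    using null_iff_vanishes[of E Ys v] assms Ys(2) by (simp add: null_rep_def)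
qed

lemma null_matroidsE:
  fixes A :: "nat struct"
  assumes "A \<in> snd (null_matroids TYPE('f))"
  obtains v :: "nat \<Rightarrow> nat \<Rightarrow> 'f::{finite,field}" where "is_struct A" "represents prime_weights v A"
proof -
  obtain E and v :: "nat \<Rightarrow> nat \<Rightarrow> 'f" where E: "finite E" "E \<noteq> {}"
    and iso: "isomorphic (null_voc TYPE('f)) (null_rep E v) A"
    using assms by (auto simp: null_matroids_def)
  have "is_struct (null_rep E v)" using E by (simp add: is_struct_def null_rep_def)
  then have A: "is_struct A" using isomorphic_is_struct[OF iso] by simp
  obtain g where g: "isomorphism (null_voc TYPE('f)) g A (null_rep E v)"
    using isomorphic_sym[OF iso] unfolding isomorphic_def by (rule exE)
  show thesis
    by (rule that[OF A represents_pullback[OF g[unfolded null_voc_eq] represents_null_rep[OF E(1)]]])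
qed

lemma null_matroidsI:
  fixes X :: "'a struct" and v :: "'a \<Rightarrow> 'c::countable \<Rightarrow> 'f::{finite,field}"
  assumes rep: "represents prime_weights v X" and iso: "isomorphic (null_voc TYPE('f)) X B"
    and B: "is_struct B"
  shows "B \<in> snd (null_matroids TYPE('f))"
proof -
  obtain g where g: "isomorphism (null_voc TYPE('f)) g B X"
    using isomorphic_sym[OF iso] unfolding isomorphic_def by (rule exE)
  define w where "w = (\<lambda>b i. v (g b) (from_nat i))"
  have w: "vanishes U w k \<longleftrightarrow> vanishes U (\<lambda>b. v (g b)) k" for U k
    unfolding w_def by (rule vanishes_from_nat)
  have "represents prime_weights (\<lambda>b. v (g b)) B"
    by (rule represents_pullback[OF g[unfolded null_voc_eq] rep])
  then have repB: "represents prime_weights w B"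
    by (simp add: represents_def w)
  have fin: "finite (univ B)" using B by (simp add: is_struct_def)
  have "rel (null_rep (univ B) w) 0 [] Ys \<longleftrightarrow> rel B 0 [] Ys"
    if "length Ys = length (prime_weights :: 'f list)" "\<forall>Y\<in>set Ys. Y \<subseteq> univ B" for Ys
  proof -
    have "rel (null_rep (univ B) w) 0 [] Ys \<longleftrightarrow> vanishes (univ B) w (coef (zip prime_weights Ys))"
      using represents_null_rep[OF fin, of w, unfolded represents_def] that
      by (simp add: null_rep_def)
    then show ?thesis using repB that by (simp add: represents_def)
  qed
  then have "isomorphism (null_voc TYPE('f)) id (null_rep (univ B) w) B"
    by (auto simp: isomorphism_def null_voc_eq args_def null_rep_def)
  then have "isomorphic (null_voc TYPE('f)) (null_rep (univ B) w) B"
    by (rule isomorphicI)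
  then show ?thesis using B by (auto simp: null_matroids_def is_struct_def)
qed

lemma independence_matroidsI:
  fixes X :: "'a struct" and v :: "'a \<Rightarrow> 'c::countable \<Rightarrow> 'f::{finite,field}"
  assumes rep: "indep_represents UNIV v X" and iso: "isomorphic independence_voc X B"
    and B: "is_struct B"
  shows "B \<in> snd (independence_matroids TYPE('f))"
proof -
  obtain g where g: "isomorphism independence_voc g B X"
    using isomorphic_sym[OF iso] unfolding isomorphic_def by (rule exE)
  define w where "w = (\<lambda>b i. v (g b) (from_nat i))"
  have w: "vanishes U w k \<longleftrightarrow> vanishes U (\<lambda>b. v (g b)) k" for U k
    unfolding w_def by (rule vanishes_from_nat)
  have "indep_represents UNIV (\<lambda>b. v (g b)) B"
    by (rule indep_represents_pullback[OF g rep])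
  then have repB: "indep_represents UNIV w B"
    by (simp add: indep_represents_def dependent_over_def w)
  have fin: "finite (univ B)" using B by (simp add: is_struct_def)
  have "rel B 0 [] [Y] \<longleftrightarrow> inj_on w Y \<and> \<not> module.dependent pointwise_scale (w ` Y)"
    if "Y \<subseteq> univ B" for Y
    using independent_iff_not_dependent_over[of Y w] finite_subset[OF that fin] repB that
    by (simp add: indep_represents_def)
  then have "isomorphism independence_voc id (independence_rep pointwise_scale (univ B) w) B"
    by (auto simp: isomorphism_def independence_voc_def args_def length_Suc_conv
        independence_rep_def[of pointwise_scale "univ B" w])
  then have "isomorphic independence_voc (independence_rep pointwise_scale (univ B) w) B"
    by (rule isomorphicI)
  then show ?thesis using B by (auto simp: independence_matroids_def is_struct_def)
qed

section \<open>The matrix of a binary relation\<close>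

text \<open>The first nine copies form blocks of sizes 2, 3 and 4. The first copy of a block names
  the coordinate of its unit vector, so coordinates are themselves elements of the matroid.\<close>

definition base :: "nat \<Rightarrow> nat" where
  "base t = (if t < 2 then 0 else if t < 5 then 2 else 5)"

text \<open>
  With \<open>c\<^sub>u\<close>, \<open>b\<^sub>u\<close>, \<open>d\<^sub>u\<close> for the unit vectors at \<open>(u, 0)\<close>, \<open>(u, 2)\<close>, \<open>(u, 5)\<close>, the eleven copies of \<open>u\<close> are
  two parallel copies of \<open>c\<^sub>u\<close>, three of \<open>b\<^sub>u\<close>, four of \<open>d\<^sub>u\<close>, the vector \<open>c\<^sub>u + b\<^sub>u\<close>, and the vector that
  adds \<open>c\<^sub>u + d\<^sub>u\<close> to the sum of the \<open>b\<^sub>w\<close> over all edges from \<open>u\<close> to \<open>w\<close>.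
\<close>

definition support :: "'a struct \<Rightarrow> 'a \<times> nat \<Rightarrow> ('a \<times> nat) set" where
  "support A x = (if snd x < 9 then {(fst x, base (snd x))}
     else if snd x = 9 then {(fst x, 0), (fst x, 2)}
     else {(fst x, 0), (fst x, 5)} \<union> {(w, 2) |w. w \<in> univ A \<and> rel A 0 [fst x, w] []})"

definition gadget :: "'a struct \<Rightarrow> 'a \<times> nat \<Rightarrow> 'a \<times> nat \<Rightarrow> 'f::field" where
  "gadget A x z = of_bool (z \<in> support A x)"

definition copies :: "'a struct \<Rightarrow> ('a \<times> nat) set" where
  "copies A = univ A \<times> {..<11}"

text \<open>In \<open>gadget_voc\<close> position 0 is the edge relation, position 1 relates copies
  of one vertex, and the copy predicates start at position 2.\<close>

abbreviation "InCopy t x \<equiv> Rel (Suc (Suc t)) [x] []"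

text \<open>Copy numbers of a vector and of a coordinate belonging to the same vertex, for all
  entries that are 1 regardless of the edges.\<close>

definition same_source :: "(nat \<times> nat) list" where
  "same_source = [(0, 0), (1, 0), (2, 2), (3, 2), (4, 2), (5, 5), (6, 5), (7, 5), (8, 5),
     (9, 0), (9, 2), (10, 0), (10, 5)]"

text \<open>Element variable 1 is the vector, 0 the coordinate. After copying, an edge holds only
  within one copy, so the coordinate in copy 2 is replaced by its companion in copy 10, where the
  vector lives.\<close>

definition gadget_fm :: mso where
  "gadget_fm = Or
     (Conj (Rel 1 [1, 0] [])
       (Disj (map (\<lambda>ts. Conj (InCopy (fst ts) 1) (InCopy (snd ts) 0)) same_source)))
     (Conj (InCopy 10 1) (Conj (InCopy 2 0)
       (ExElem 2 (Conj (InCopy 10 2) (Conj (Rel 1 [2, 0] []) (Rel 0 [1, 2] []))))))"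

text \<open>The universe indexes both vectors and coordinates: the universal quantifier runs over
  coordinates, and \<open>lin_fm\<close> counts, for each set, the vectors with entry 1
  there.\<close>

definition gadget_comb_fm :: "'f::{finite,field} list \<Rightarrow> nat list \<Rightarrow> nat \<Rightarrow> mso" where
  "gadget_comb_fm \<alpha>s vs W = AllElem 0
     (lin_fm W 1 (map (apsnd (\<lambda>Y. Conj (Mem 1 Y) gadget_fm)) (zip \<alpha>s vs)) 0)"

abbreviation "gadget_copies \<equiv> copy_struct [(2, 0)] 11"
abbreviation "gadget_voc \<equiv> copy_voc 11 [(2, 0)]"

lemma same_source_iff:
  assumes "t < 11"
  shows "(t, s) \<in> set same_source \<longleftrightarrow>
    (t < 9 \<and> s = base t) \<or> (t = 9 \<and> (s = 0 \<or> s = 2)) \<or> (t = 10 \<and> (s = 0 \<or> s = 5))"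
proof -
  have "t = 0 \<or> t = 1 \<or> t = 2 \<or> t = 3 \<or> t = 4 \<or> t = 5 \<or> t = 6 \<or> t = 7 \<or> t = 8 \<or> t = 9 \<or> t = 10"
    using assms by presburger
  then show ?thesis by (auto simp: same_source_def base_def)
qed

lemma univ_gadget_copies: "univ (gadget_copies A) = copies A"
  by (simp add: copy_struct_def copies_def)

lemma rel_gadget_copies:
  "rel (gadget_copies A) (Suc (Suc t)) [x] [] \<longleftrightarrow> snd x = t"
  "rel (gadget_copies A) 4 [x] [] \<longleftrightarrow> snd x = 2"
  "rel (gadget_copies A) 12 [x] [] \<longleftrightarrow> snd x = 10"
  "rel (gadget_copies A) (Suc 0) [x, y] [] \<longleftrightarrow> fst x = fst y"
  "rel (gadget_copies A) 0 [x, y] [] \<longleftrightarrow>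
    snd x < 11 \<and> snd y = snd x \<and> rel A 0 [fst x, fst y] []"
  by (auto simp: copy_struct_def)

lemma sat_gadget_fm:
  assumes "e 0 \<in> copies A" "e 1 \<in> copies A"
  shows "sat (gadget_copies A) e s gadget_fm \<longleftrightarrow> e 0 \<in> support A (e 1)"
proof -
  obtain u t where x: "e 1 = (u, t)" "u \<in> univ A" "t < 11" using assms(2) by (auto simp: copies_def)
  obtain w r where z: "e 0 = (w, r)" "w \<in> univ A" "r < 11" using assms(1) by (auto simp: copies_def)
  have "sat (gadget_copies A) e s gadget_fm \<longleftrightarrow>
      (u = w \<and> (\<exists>p\<in>set same_source. t = fst p \<and> r = snd p)) \<or> (t = 10 \<and> r = 2 \<and>
        (\<exists>y\<in>copies A. snd y = 10 \<and> fst y = w \<and> rel A 0 [u, fst y] []))"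
    using x z by (simp add: gadget_fm_def rel_gadget_copies univ_gadget_copies cong: conj_cong)
      blast
  also have "\<dots> \<longleftrightarrow> (u = w \<and> (t, r) \<in> set same_source) \<or> (t = 10 \<and> r = 2 \<and> rel A 0 [u, w] [])"
    using z by (force simp: copies_def)
  also have "\<dots> \<longleftrightarrow> e 0 \<in> support A (e 1)"
    using x z unfolding same_source_iff[OF x(3)] by (auto simp: support_def)
  finally show ?thesis .
qed

lemma fv_gadget_fm:
  "elem_fv gadget_fm = {0, 1}" "set_fv gadget_fm = {}" "over_voc gadget_voc gadget_fm"
  by (auto simp: gadget_fm_def same_source_def copy_voc_def nth_append nth_Cons split: nat.splits)

lemma sat_gadget_comb_fm:
  fixes \<alpha>s :: "'f::{finite,field} list"
  assumes fin: "finite (univ A)" and vs: "\<And>Y. Y \<in> set vs \<Longrightarrow> s Y \<subseteq> copies A"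
    and W: "W \<notin> set vs"
  shows "sat (gadget_copies A) e s (gadget_comb_fm \<alpha>s vs W) \<longleftrightarrow>
    vanishes (copies A) (gadget A) (coef (zip \<alpha>s (map s vs)))"
proof -
  let ?C = "gadget_copies A"
  have U: "univ ?C = copies A" by (simp add: copy_struct_def copies_def)
  have finU: "finite (copies A)" using fin by (simp add: copies_def)
  have *: "sat ?C (e(0 := z)) s
      (lin_fm W 1 (map (apsnd (\<lambda>Y. Conj (Mem 1 Y) gadget_fm)) (zip \<alpha>s vs)) 0) \<longleftrightarrow>
      (\<Sum>x\<in>copies A. coef (zip \<alpha>s (map s vs)) x * gadget A x z) = 0" if z: "z \<in> copies A" for z
  proof -
    have card: "of_nat (card {a \<in> univ ?C. sat ?C (e(0 := z, 1 := a)) s (Conj (Mem 1 Y) gadget_fm)})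
        = (\<Sum>x\<in>s Y. gadget A x z :: 'f)" if "Y \<in> set vs" for Y
    proof -
      have "{a \<in> univ ?C. sat ?C (e(0 := z, 1 := a)) s (Conj (Mem 1 Y) gadget_fm)} =
          {a \<in> s Y. z \<in> support A a}"
        unfolding U using vs[OF that] z by (auto simp: sat_gadget_fm)
      moreover have "finite (s Y)" using vs[OF that] finU finite_subset by blast
      then have "(\<Sum>x\<in>s Y. gadget A x z :: 'f) = of_nat (card {a \<in> s Y. z \<in> support A a})"
        by (simp add: gadget_def sum_of_bool_eq Int_def)
      ultimately show ?thesis by simp
    qed
    have "(\<Sum>x\<in>copies A. coef (zip \<alpha>s (map s vs)) x * gadget A x z) =
        (\<Sum>(\<alpha>, Y)\<leftarrow>zip \<alpha>s (map s vs). \<alpha> * (\<Sum>x\<in>Y. gadget A x z))"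
      by (rule sum_coef[OF finU]) (auto dest!: set_zip_rightD simp: vs[THEN subsetD])
    also have "\<dots> = (\<Sum>p\<leftarrow>zip \<alpha>s vs. fst p * (\<Sum>x\<in>s (snd p). gadget A x z))"
      by (simp add: map_apsnd_zip[symmetric] case_prod_beta comp_def del: map_apsnd_zip)
    also have "\<dots> = (\<Sum>p\<leftarrow>zip \<alpha>s vs. fst p * of_nat (card {a \<in> univ ?C.
        sat ?C (e(0 := z, 1 := a)) s (Conj (Mem 1 (snd p)) gadget_fm)}))"
    proof (rule arg_cong[of _ _ sum_list], rule map_cong[OF refl])
      fix p assume "p \<in> set (zip \<alpha>s vs)"
      then have "snd p \<in> set vs" using set_zip_rightD[of "fst p" "snd p" \<alpha>s vs] by simp
      then show "fst p * (\<Sum>x\<in>s (snd p). gadget A x z) = fst p * of_nat (card {a \<in> univ ?C.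
          sat ?C (e(0 := z, 1 := a)) s (Conj (Mem 1 (snd p)) gadget_fm)})"
        by (simp only: card)
    qed
    finally have sum: "(\<Sum>x\<in>copies A. coef (zip \<alpha>s (map s vs)) x * gadget A x z) = \<dots>" .
    have "\<forall>p\<in>set (map (apsnd (\<lambda>Y. Conj (Mem 1 Y) gadget_fm)) (zip \<alpha>s vs)). W \<notin> set_fv (snd p)"
      using W by (auto simp: fv_gadget_fm dest: set_zip_rightD)
    then show ?thesis
      unfolding sum by (subst sat_lin_fm) (simp_all only: list.map_comp comp_def case_prod_beta
          fst_apsnd snd_apsnd add_0)
  qed
  have "sat ?C e s (gadget_comb_fm \<alpha>s vs W) \<longleftrightarrow>
      (\<forall>z\<in>copies A. (\<Sum>x\<in>copies A. coef (zip \<alpha>s (map s vs)) x * gadget A x z) = 0)"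
    unfolding gadget_comb_fm_def sat.simps U using * by blast
  also have "\<dots> \<longleftrightarrow> vanishes (copies A) (gadget A) (coef (zip \<alpha>s (map s vs)))"
  proof -
    \<comment> \<open>\<open>vanishes\<close> speaks of all coordinates, the formula only of those
      in the universe; no support reaches beyond it.\<close>
    have "(\<Sum>x\<in>copies A. coef (zip \<alpha>s (map s vs)) x * gadget A x z) = 0" if "z \<notin> copies A" for z
    proof (rule sum.neutral, rule ballI)
      fix x assume "x \<in> copies A"
      then have "z \<notin> support A x" using that by (auto simp: copies_def support_def base_def)
      then show "coef (zip \<alpha>s (map s vs)) x * gadget A x z = 0" by (simp add: gadget_def)
    qed
    then show ?thesis unfolding vanishes_def by blast
  qed
  finally show ?thesis .
qed

lemma fv_gadget_comb_fm:
  "elem_fv (gadget_comb_fm \<alpha>s vs W) = {}" "set_fv (gadget_comb_fm \<alpha>s vs W) \<subseteq> set vs"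
  "over_voc gadget_voc (gadget_comb_fm \<alpha>s vs W)"
proof -
  let ?ps = "map (apsnd (\<lambda>Y. Conj (Mem 1 Y) gadget_fm)) (zip \<alpha>s vs)"
  show "elem_fv (gadget_comb_fm \<alpha>s vs W) = {}"
  proof -
    have "(\<Union>p\<in>set ?ps. elem_fv (snd p)) \<subseteq> {0, 1}" by (auto simp: fv_gadget_fm)
    then have "elem_fv (lin_fm W 1 ?ps 0) \<subseteq> {0}" using elem_fv_lin_fm[of W 1 ?ps 0] by blast
    then show ?thesis by (simp add: gadget_comb_fm_def)
  qed
  show "set_fv (gadget_comb_fm \<alpha>s vs W) \<subseteq> set vs"
  proof -
    have "(\<Union>p\<in>set ?ps. set_fv (snd p)) \<subseteq> set vs"
      by (auto simp: fv_gadget_fm dest: set_zip_rightD)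
    then have "set_fv (lin_fm W 1 ?ps 0) \<subseteq> set vs" using set_fv_lin_fm[of W 1 ?ps 0] by blast
    then show ?thesis by (simp add: gadget_comb_fm_def)
  qed
  show "over_voc gadget_voc (gadget_comb_fm \<alpha>s vs W)"
    by (auto simp: gadget_comb_fm_def fv_gadget_fm intro!: over_voc_lin_fm)
qed

definition gadget_null_fm :: "'f::{finite,field} itself \<Rightarrow> mso" where
  "gadget_null_fm F = (let n = null_arity F in
     gadget_comb_fm (prime_weights :: 'f list) [0..<n] n)"

text \<open>Set variable 0 is the tested set, the next \<open>m\<close> carry the coefficients, and
  \<open>1 + m\<close> is the auxiliary variable for counting.\<close>

definition gadget_indep_fm :: "'f::{finite,field} itself \<Rightarrow> mso" where
  "gadget_indep_fm F = (let m = length (field_weights :: 'f list) in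
     Neg (dep_fm (field_weights :: 'f list) 0 1 0 (gadget_comb_fm (field_weights :: 'f list) [1..<1 + m] (1 + m))))"

definition null_indep_fm :: "'f::{finite,field} itself \<Rightarrow> mso" where
  "null_indep_fm F =
     Neg (dep_fm (prime_weights :: 'f list) 0 1 0 (Rel 0 [] [1..<1 + null_arity F]))"

lemma mso_formula_FTrue: "mso_formula voc mn FTrue"
  by (simp add: mso_formula_def)

lemma univ_interpret_FTrue [simp]: "univ (interpret_struct FTrue \<psi>s A) = univ A"
  by (simp add: interpret_struct_def holds_def)

lemma rel_interpret: "rel (interpret_struct \<phi> \<psi>s A) i xs Xs = holds A xs Xs (\<psi>s ! i)"
  by (simp add: interpret_struct_def)

lemma mso_formula_gadget_null: "mso_formula gadget_voc (0, null_arity F) (gadget_null_fm F)"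
  for F :: "'f::{finite,field} itself"
proof -
  have "set_fv (gadget_null_fm F) \<subseteq> {..<null_arity F}"
    using fv_gadget_comb_fm(2)[of "prime_weights :: 'f list" "[0..<null_arity F]" "null_arity F"]
    by (auto simp: gadget_null_fm_def Let_def)
  then show ?thesis by (simp add: mso_formula_def gadget_null_fm_def Let_def fv_gadget_comb_fm)
qed

lemma mso_formula_gadget_indep: "mso_formula gadget_voc (0, 1) (gadget_indep_fm F)"
  for F :: "'f::{finite,field} itself"
proof -
  let ?m = "length (field_weights :: 'f list)"
  let ?\<nu> = "gadget_comb_fm (field_weights :: 'f list) [1..<1 + ?m] (1 + ?m)"
  let ?\<phi> = "dep_fm (field_weights :: 'f list) 0 1 0 ?\<nu>"
  have "elem_fv ?\<phi> = {}"
    using elem_fv_dep_fm[of "field_weights :: 'f list" 0 1 0 ?\<nu>] by (simp add: fv_gadget_comb_fm)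
  moreover have "set_fv ?\<phi> \<subseteq> {0}"
    using set_fv_dep_fm[of "field_weights :: 'f list" 0 1 0 ?\<nu>]
      fv_gadget_comb_fm(2)[of "field_weights :: 'f list" "[1..<1 + ?m]" "1 + ?m"]
    unfolding set_upt by blast
  moreover have "over_voc gadget_voc ?\<phi>" by (simp only: over_voc_dep_fm fv_gadget_comb_fm)
  moreover have "gadget_indep_fm F = Neg ?\<phi>" by (simp only: gadget_indep_fm_def Let_def)
  ultimately show ?thesis by (simp add: mso_formula_def subset_iff del: upt_Suc)
qed

lemma mso_formula_null_indep: "mso_formula (null_voc F) (0, 1) (null_indep_fm F)"
  for F :: "'f::{finite,field} itself"
proof -
  let ?\<nu> = "Rel 0 [] [1..<1 + null_arity F]"
  let ?\<phi> = "dep_fm (prime_weights :: 'f list) 0 1 0 ?\<nu>"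
  have "elem_fv ?\<phi> = {}"
    using elem_fv_dep_fm[of "prime_weights :: 'f list" 0 1 0 ?\<nu>] by simp
  moreover have "set_fv ?\<phi> \<subseteq> {0}"
    using set_fv_dep_fm[of "prime_weights :: 'f list" 0 1 0 ?\<nu>]
    unfolding set_fv.simps set_upt length_prime_weights null_arity_def by blast
  moreover have "over_voc (null_voc F) ?\<phi>" by (simp add: null_voc_def null_arity_def del: upt_Suc)
  moreover have "null_indep_fm F = Neg ?\<phi>" by (simp only: null_indep_fm_def)
  ultimately show ?thesis by (simp add: mso_formula_def subset_iff del: upt_Suc)
qed

definition null_gadget :: "'f::{finite,field} itself \<Rightarrow> 'a struct \<Rightarrow> ('a \<times> nat) struct" where
  "null_gadget F A = interpret_struct FTrue [gadget_null_fm F] (gadget_copies A)"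

definition indep_gadget :: "'f::{finite,field} itself \<Rightarrow> 'a struct \<Rightarrow> ('a \<times> nat) struct" where
  "indep_gadget F A = interpret_struct FTrue [gadget_indep_fm F] (gadget_copies A)"

lemma univ_gadget [simp]:
  "univ (null_gadget F A) = copies A" "univ (indep_gadget F A) = copies A"
  by (simp_all add: null_gadget_def indep_gadget_def copy_struct_def copies_def)

lemma represents_null_gadget:
  assumes "finite (univ A)"
  shows "represents (prime_weights :: 'f list) (gadget A) (null_gadget TYPE('f::{finite,field}) A)"
  unfolding represents_def
proof (intro allI impI)
  fix Ys assume Ys: "length Ys = length (prime_weights :: 'f list)"
    "\<forall>Y\<in>set Ys. Y \<subseteq> univ (null_gadget TYPE('f) A)"
  let ?n = "null_arity TYPE('f)"
  have "map ((!) Ys) [0..<?n] = Ys" using map_nth[of Ys] Ys(1) by simp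
  moreover have "sat (gadget_copies A) (\<lambda>i. [] ! i) (\<lambda>i. Ys ! i) (gadget_comb_fm (prime_weights :: 'f list) [0..<?n] ?n) \<longleftrightarrow>
      vanishes (copies A) (gadget A) (coef (zip (prime_weights :: 'f list) (map (\<lambda>i. Ys ! i) [0..<?n])))"
    by (rule sat_gadget_comb_fm[OF assms]) (use Ys in auto)
  ultimately show "rel (null_gadget TYPE('f) A) 0 [] Ys \<longleftrightarrow>
      vanishes (univ (null_gadget TYPE('f) A)) (gadget A) (coef (zip (prime_weights :: 'f list) Ys))"
    by (simp add: null_gadget_def rel_interpret holds_def gadget_null_fm_def Let_def
        univ_gadget_copies)
qed

lemma indep_represents_indep_gadget:
  assumes "finite (univ A)"
  shows "indep_represents UNIV (gadget A :: _ \<Rightarrow> _ \<Rightarrow> 'f) (indep_gadget TYPE('f::{finite,field}) A)"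
  unfolding indep_represents_def
proof (intro allI impI)
  fix Y assume Y: "Y \<subseteq> univ (indep_gadget TYPE('f) A)"
  let ?m = "length (field_weights :: 'f list)" and ?s = "\<lambda>i. [Y] ! i"
  have U: "univ (gadget_copies A) = copies A" by (simp add: copy_struct_def copies_def)
  have "sat (gadget_copies A) (\<lambda>i. [] ! i) ?s
      (dep_fm (field_weights :: 'f list) 0 1 0 (gadget_comb_fm (field_weights :: 'f list) [1..<1 + ?m] (1 + ?m))) \<longleftrightarrow>
      dependent_over (subset_sums (field_weights :: 'f list)) (gadget A) (?s 0)"
  proof (rule sat_dep_fm)
    fix Ys assume Ys: "length Ys = ?m" "\<forall>Y\<in>set Ys. Y \<subseteq> univ (gadget_copies A)"
    have map: "map (upd_sets 1 Ys ?s) [1..<1 + ?m] = Ys"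
      unfolding Ys(1)[symmetric] by (rule map_upd_sets)
    have "upd_sets 1 Ys ?s Z \<in> set Ys" if "Z \<in> set [1..<1 + ?m]" for Z
      using imageI[OF that, of "upd_sets 1 Ys ?s"] map set_map by metis
    then have "sat (gadget_copies A) (\<lambda>i. [] ! i) (upd_sets 1 Ys ?s)
        (gadget_comb_fm (field_weights :: 'f list) [1..<1 + ?m] (1 + ?m)) \<longleftrightarrow>
        vanishes (copies A) (gadget A) (coef (zip (field_weights :: 'f list) (map (upd_sets 1 Ys ?s) [1..<1 + ?m])))"
      by (intro sat_gadget_comb_fm[OF assms]) (use Ys U in auto)
    then show "sat (gadget_copies A) (\<lambda>i. [] ! i) (upd_sets 1 Ys ?s)
        (gadget_comb_fm (field_weights :: 'f list) [1..<1 + ?m] (1 + ?m)) \<longleftrightarrow>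
        vanishes (univ (gadget_copies A)) (gadget A) (coef (zip (field_weights :: 'f list) Ys))"
      unfolding map U .
  qed (use assms Y in \<open>simp_all add: U copies_def\<close>)
  then show "rel (indep_gadget TYPE('f) A) 0 [] [Y] \<longleftrightarrow>
      \<not> dependent_over UNIV (gadget A :: _ \<Rightarrow> _ \<Rightarrow> 'f) Y"
    by (simp add: indep_gadget_def rel_interpret holds_def gadget_indep_fm_def Let_def
        subset_sums_field_weights)
qed

lemma sat_null_dep_fm:
  fixes v :: "'a \<Rightarrow> 'c \<Rightarrow> 'f::{finite,field}"
  assumes fin: "finite (univ S)" and rep: "represents prime_weights v S"
    and X: "X < k" "s X \<subseteq> univ S"
  shows "sat S e s (dep_fm (prime_weights :: 'f list) X k y
      (Rel 0 [] [k..<k + null_arity TYPE('f)])) \<longleftrightarrow> dependent_over prime_field v (s X)"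
  unfolding subset_sums_prime_weights[symmetric]
proof (rule sat_dep_fm[where X = X and k = k and s = s, OF fin X])
  fix Ys assume Ys: "length Ys = length (prime_weights :: 'f list)" "\<forall>Y\<in>set Ys. Y \<subseteq> univ S"
  have "map (upd_sets k Ys s) [k..<k + length Ys] = Ys" by (rule map_upd_sets)
  then have "sat S e (upd_sets k Ys s) (Rel 0 [] [k..<k + null_arity TYPE('f)]) \<longleftrightarrow> rel S 0 [] Ys"
    using Ys(1) by simp
  also have "\<dots> \<longleftrightarrow> vanishes (univ S) v (coef (zip prime_weights Ys))"
    using rep Ys by (simp add: represents_def)
  finally show "sat S e (upd_sets k Ys s) (Rel 0 [] [k..<k + null_arity TYPE('f)]) \<longleftrightarrow>
      vanishes (univ S) v (coef (zip prime_weights Ys))" .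
qed

lemma indep_represents_null_indep:
  fixes v :: "'a \<Rightarrow> 'c \<Rightarrow> 'f::{finite,field}"
  assumes fin: "finite (univ X)" and rep: "represents prime_weights v X"
  shows "indep_represents prime_field v (interpret_struct FTrue [null_indep_fm TYPE('f)] X)"
  unfolding indep_represents_def
proof (intro allI impI)
  fix Y assume Y: "Y \<subseteq> univ (interpret_struct FTrue [null_indep_fm TYPE('f)] X)"
  then show "rel (interpret_struct FTrue [null_indep_fm TYPE('f)] X) 0 [] [Y] \<longleftrightarrow>
      \<not> dependent_over prime_field v Y"
    using sat_null_dep_fm[OF fin rep, of 0 1 "\<lambda>i. [Y] ! i" "\<lambda>i. [] ! i" 0]
    by (simp add: rel_interpret holds_def null_indep_fm_def del: upt_Suc)
qed

section \<open>Recovering a binary relation from the independent sets of its matrix\<close>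

lemma isomorphism_binaryI:
  assumes "bij_betw h (univ A) (univ B)"
    and "\<And>u w. u \<in> univ A \<Longrightarrow> w \<in> univ A \<Longrightarrow> rel A 0 [u, w] [] \<longleftrightarrow> rel B 0 [h u, h w] []"
  shows "isomorphism [(2, 0)] h A B"
  unfolding isomorphism_def
proof (intro conjI allI impI ballI)
  fix i p assume i: "i < length [(2 :: nat, 0 :: nat)]" and p: "p \<in> args ([(2, 0)] ! i) (univ A)"
  have "length (fst p) = 2" "set (fst p) \<subseteq> univ A" "snd p = []" using i p by (auto simp: args_def)
  then obtain u w where "fst p = [u, w]" "u \<in> univ A" "w \<in> univ A"
    by (cases "fst p"; cases "tl (fst p)") auto
  then show "case p of (xs, Xs) \<Rightarrow> rel A i xs Xs \<longleftrightarrow> rel B i (map h xs) (map ((`) h) Xs)"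
    using i assms(2) \<open>snd p = []\<close> by (cases p) simp
qed (fact assms(1))

definition parallel :: "'a struct \<Rightarrow> 'a \<Rightarrow> 'a \<Rightarrow> bool" where
  "parallel S a b \<longleftrightarrow> a = b \<or> \<not> rel S 0 [] [{a, b}]"

text \<open>In the matrix matroid of a relation all parallel classes have size 1, 2, 3 or 4, and
  modulus 5 is the least that separates these sizes without confusing any of them with 0.\<close>

definition class_size :: "'a struct \<Rightarrow> nat \<Rightarrow> 'a \<Rightarrow> bool" where
  "class_size S t a \<longleftrightarrow> card {x \<in> univ S. parallel S a x} mod 5 = t mod 5"

text \<open>Elements with a parallel class of more than one element are multiples of unit vectors;
  \<open>has_coord S a b\<close> says that \<open>a\<close> is not spanned by those of them that are not parallel to \<open>b\<close>.\<close>

definition has_coord :: "'a struct \<Rightarrow> 'a \<Rightarrow> 'a \<Rightarrow> bool" where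
  "has_coord S a b \<longleftrightarrow> \<not> (\<exists>I\<subseteq>univ S. (\<forall>y\<in>I. \<not> class_size S 1 y \<and> \<not> parallel S b y) \<and>
     rel S 0 [] [I] \<and> \<not> rel S 0 [] [insert a I])"

text \<open>The summand \<open>d_u\<close> exists for this test. Without it, the adjacency vector of
  a vertex with no out-edges would be another copy of \<open>c_u\<close>, and that of a vertex whose
  only out-edge is a loop would equal \<open>c_u + b_u\<close>.\<close>

definition marked :: "'a struct \<Rightarrow> 'a \<Rightarrow> bool" where
  "marked S a \<longleftrightarrow> (\<exists>d\<in>univ S. class_size S 4 d \<and> has_coord S a d)"

text \<open>Intended reading: \<open>x\<close> and \<open>y\<close> are the vectors
  \<open>c_u + b_u\<close> and \<open>c_w + b_w\<close>. The unit vector \<open>c\<close> leads from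
  \<open>x\<close> to the adjacency vector \<open>a\<close> of the same vertex, and \<open>b\<close>
  leads from an entry of \<open>a\<close> to \<open>y\<close>.\<close>

definition edge :: "'a struct \<Rightarrow> 'a \<Rightarrow> 'a \<Rightarrow> bool" where
  "edge S x y \<longleftrightarrow> (\<exists>a\<in>univ S. \<exists>c\<in>univ S. \<exists>b\<in>univ S. class_size S 1 a \<and> marked S a \<and>
     class_size S 2 c \<and> class_size S 3 b \<and>
     has_coord S x c \<and> has_coord S a c \<and> has_coord S a b \<and> has_coord S y b)"

text \<open>Bound variables are allotted by nesting: element variables 9, 8, 7, 6 and set variables
  0, 1, then 2 and 3, belong to successive formulas. No inner formula captures a variable of an
  outer one.\<close>

definition parallel_fm :: "nat \<Rightarrow> nat \<Rightarrow> mso" where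
  "parallel_fm a b = Or (Eq a b) (ExSet 0 (Conj
     (AllElem 9 (Iff (Mem 9 0) (Or (Eq 9 a) (Eq 9 b)))) (Neg (Rel 0 [] [0]))))"

definition class_size_fm :: "nat \<Rightarrow> nat \<Rightarrow> mso" where
  "class_size_fm t a = card_fm t 5 1 8 (parallel_fm a 8)"

definition has_coord_fm :: "nat \<Rightarrow> nat \<Rightarrow> mso" where
  "has_coord_fm a b = Neg (ExSet 2 (Conj
     (AllElem 7 (Imp (Mem 7 2) (Conj (Neg (class_size_fm 1 7)) (Neg (parallel_fm b 7)))))
     (Conj (Rel 0 [] [2]) (ExSet 3 (Conj
       (AllElem 7 (Iff (Mem 7 3) (Or (Eq 7 a) (Mem 7 2)))) (Neg (Rel 0 [] [3])))))))"

definition marked_fm :: "nat \<Rightarrow> mso" where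
  "marked_fm a = ExElem 6 (Conj (class_size_fm 4 6) (has_coord_fm a 6))"

definition vertex_fm :: mso where
  "vertex_fm = Conj (class_size_fm 1 0) (Neg (marked_fm 0))"

definition edge_fm :: mso where
  "edge_fm = ExElem 2 (ExElem 3 (ExElem 4
     (Conj (class_size_fm 1 2) (Conj (marked_fm 2) (Conj (class_size_fm 2 3) (Conj (class_size_fm 3 4)
       (Conj (has_coord_fm 0 3) (Conj (has_coord_fm 2 3) (Conj (has_coord_fm 2 4) (has_coord_fm 1 4))))))))))"

text \<open>Formulas name a set by quantifying over it and describing its elements; the described
  set is unique, so the quantifier disappears.\<close>

lemma ex_subset_eq: "B \<subseteq> U \<Longrightarrow> (\<exists>S\<subseteq>U. (\<forall>x\<in>U. x \<in> S \<longleftrightarrow> x \<in> B) \<and> P S) \<longleftrightarrow> P B"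
  by (metis subset_antisym subset_iff)

lemma sat_parallel_fm:
  assumes "a \<noteq> 9" "b \<noteq> 9" "e a \<in> univ S" "e b \<in> univ S"
  shows "sat S e s (parallel_fm a b) \<longleftrightarrow> parallel S (e a) (e b)"
proof -
  have "sat S e s (parallel_fm a b) \<longleftrightarrow> e a = e b \<or>
      (\<exists>T\<subseteq>univ S. (\<forall>x\<in>univ S. x \<in> T \<longleftrightarrow> x \<in> {e a, e b}) \<and> \<not> rel S 0 [] [T])"
    using assms(1,2) by (simp add: parallel_fm_def) blast
  also have "\<dots> \<longleftrightarrow> e a = e b \<or> \<not> rel S 0 [] [{e a, e b}]"
    by (subst ex_subset_eq) (use assms in auto)
  finally show ?thesis by (simp add: parallel_def)
qed

lemma fv_parallel_fm:
  "elem_fv (parallel_fm a b) \<subseteq> {a, b}" "set_fv (parallel_fm a b) = {}"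
  "over_voc independence_voc (parallel_fm a b)"
  by (auto simp: parallel_fm_def independence_voc_def)

lemma sat_class_size_fm:
  assumes "a \<noteq> 8" "a \<noteq> 9" "e a \<in> univ S"
  shows "sat S e s (class_size_fm t a) \<longleftrightarrow> class_size S t (e a)"
proof -
  have "{x \<in> univ S. sat S (e(8 := x)) s (parallel_fm a 8)} = {x \<in> univ S. parallel S (e a) x}"
    using assms by (auto simp: sat_parallel_fm)
  then show ?thesis
    by (simp only: class_size_fm_def class_size_def sat_card_fm fv_parallel_fm empty_iff not_False_eq_True)
qed

lemma fv_class_size_fm:
  "elem_fv (class_size_fm t a) \<subseteq> {a}" "set_fv (class_size_fm t a) = {}"
  "over_voc independence_voc (class_size_fm t a)"
proof -
  show "elem_fv (class_size_fm t a) \<subseteq> {a}"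
    using fv_parallel_fm(1)[of a 8] unfolding class_size_fm_def fv_card_fm by blast
qed (simp_all add: class_size_fm_def fv_parallel_fm)

lemma sat_has_coord_fm:
  assumes "a \<notin> {7, 8, 9}" "b \<notin> {7, 8, 9}" "e a \<in> univ S" "e b \<in> univ S"
  shows "sat S e s (has_coord_fm a b) \<longleftrightarrow> has_coord S (e a) (e b)"
proof -
  have "sat S e s (has_coord_fm a b) \<longleftrightarrow>
      \<not> (\<exists>I\<subseteq>univ S. (\<forall>y\<in>univ S. y \<in> I \<longrightarrow> \<not> class_size S 1 y \<and> \<not> parallel S (e b) y) \<and>
        rel S 0 [] [I] \<and>
        (\<exists>J\<subseteq>univ S. (\<forall>x\<in>univ S. x \<in> J \<longleftrightarrow> x \<in> insert (e a) I) \<and> \<not> rel S 0 [] [J]))"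
    using assms by (simp add: has_coord_fm_def sat_class_size_fm sat_parallel_fm cong: conj_cong) blast
  also have "\<dots> \<longleftrightarrow> \<not> (\<exists>I\<subseteq>univ S. (\<forall>y\<in>univ S. y \<in> I \<longrightarrow> \<not> class_size S 1 y \<and> \<not> parallel S (e b) y) \<and>
        rel S 0 [] [I] \<and> \<not> rel S 0 [] [insert (e a) I])"
    using ex_subset_eq[of "insert (e a) _" "univ S"] assms(3) by (simp cong: conj_cong)
  also have "\<dots> \<longleftrightarrow> has_coord S (e a) (e b)"
    unfolding has_coord_def by blast
  finally show ?thesis .
qed

lemma fv_has_coord_fm:
  "elem_fv (has_coord_fm a b) \<subseteq> {a, b}" "set_fv (has_coord_fm a b) = {}"
  "over_voc independence_voc (has_coord_fm a b)"
proof -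
  show "elem_fv (has_coord_fm a b) \<subseteq> {a, b}"
    using fv_class_size_fm(1)[of 1 7] fv_parallel_fm(1)[of b 7]
    unfolding has_coord_fm_def elem_fv.simps by auto
qed (auto simp: has_coord_fm_def fv_class_size_fm fv_parallel_fm independence_voc_def[symmetric],
    simp_all add: independence_voc_def)

lemma sat_marked_fm:
  assumes "a \<notin> {6, 7, 8, 9}" "e a \<in> univ S"
  shows "sat S e s (marked_fm a) \<longleftrightarrow> marked S (e a)"
  using assms by (simp add: marked_fm_def marked_def sat_class_size_fm sat_has_coord_fm cong: bex_cong)

lemma fv_marked_fm:
  "elem_fv (marked_fm a) \<subseteq> {a}" "set_fv (marked_fm a) = {}"
  "over_voc independence_voc (marked_fm a)"
proof -
  show "elem_fv (marked_fm a) \<subseteq> {a}"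
    using fv_class_size_fm(1)[of 4 6] fv_has_coord_fm(1)[of a 6]
    unfolding marked_fm_def elem_fv.simps by blast
qed (auto simp: marked_fm_def fv_class_size_fm fv_has_coord_fm)

lemma mso_formula_vertex_fm: "mso_formula independence_voc (1, 0) vertex_fm"
proof -
  have "elem_fv vertex_fm \<subseteq> {0}"
    using fv_class_size_fm(1)[of 1 0] fv_marked_fm(1)[of 0]
    unfolding vertex_fm_def elem_fv.simps by blast
  then show ?thesis
    by (auto simp: mso_formula_def) (simp_all add: vertex_fm_def fv_class_size_fm fv_marked_fm)
qed

lemma mso_formula_edge_fm: "mso_formula independence_voc (2, 0) edge_fm"
proof -
  have "elem_fv edge_fm \<subseteq> {0, 1}"
    using fv_class_size_fm(1) fv_marked_fm(1) fv_has_coord_fm(1) unfolding edge_fm_def elem_fv.simps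
    by blast
  then show ?thesis
    by (auto simp: mso_formula_def) (simp_all add: edge_fm_def fv_class_size_fm fv_marked_fm fv_has_coord_fm)
qed

definition decode :: "'a struct \<Rightarrow> 'a struct" where
  "decode S = interpret_struct vertex_fm [edge_fm] S"

lemma univ_decode: "univ (decode S) = {x \<in> univ S. class_size S 1 x \<and> \<not> marked S x}"
  by (auto simp: decode_def interpret_struct_def holds_def vertex_fm_def sat_class_size_fm sat_marked_fm)

lemma rel_decode:
  assumes "x \<in> univ S" "y \<in> univ S"
  shows "rel (decode S) 0 [x, y] [] \<longleftrightarrow> edge S x y"
  using assms
  by (simp add: decode_def interpret_struct_def holds_def edge_fm_def edge_def sat_class_size_fm
      sat_marked_fm sat_has_coord_fm cong: bex_cong)

section \<open>Decoding the matrix matroid for any coefficient set containing 0, 1 and -1\<close>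

context
  fixes A :: "'a struct" and S :: "('a \<times> nat) struct" and K :: "'f::field set"
  assumes A: "is_struct A" and S: "univ S = copies A"
    and rep: "indep_represents K (gadget A) S"
    and K: "0 \<in> K" "1 \<in> K" "- 1 \<in> K"
begin

lemma finite_copies: "finite (copies A)"
  using A by (simp add: is_struct_def copies_def)

lemma support_ne: "support A x \<noteq> {}"
  by (auto simp: support_def)

text \<open>Both vectors are nonzero, so both coefficients of a nontrivial relation are nonzero, and
  it can vanish only if the two supports agree. Equal supports mean equal vectors, cancelled by 1
  and -1.\<close>

lemma dependent_pair:
  assumes xy: "x \<noteq> y"
  shows "dependent_over K (gadget A :: _ \<Rightarrow> _ \<Rightarrow> 'f) {x, y} \<longleftrightarrow> support A x = support A y"
proof
  assume "dependent_over K (gadget A :: _ \<Rightarrow> _ \<Rightarrow> 'f) {x, y}"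
  then obtain k where k: "vanishes {x, y} (gadget A :: _ \<Rightarrow> _ \<Rightarrow> 'f) k" "k x \<noteq> 0 \<or> k y \<noteq> 0"
    by (auto simp: dependent_over_def)
  have eq: "k x * of_bool (z \<in> support A x) + k y * of_bool (z \<in> support A y) = 0" for z
  proof -
    have "k x * gadget A x z + k y * gadget A y z = (\<Sum>t\<in>{x, y}. k t * gadget A t z)"
      using xy by simp
    also have "\<dots> = 0" using k(1) unfolding vanishes_def by blast
    finally show ?thesis by (simp only: gadget_def)
  qed
  have ne: "k x \<noteq> 0" "k y \<noteq> 0"
  proof -
    obtain z w where zw: "z \<in> support A x" "w \<in> support A y" using support_ne by blast
    show "k x \<noteq> 0"
    proof
      assume "k x = 0"
      then show False using eq[of w] zw(2) k(2) by simp
    qed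
    show "k y \<noteq> 0"
    proof
      assume "k y = 0"
      then show False using eq[of z] zw(1) k(2) by simp
    qed
  qed
  then show "support A x = support A y"
  proof (intro set_eqI)
    fix z show "z \<in> support A x \<longleftrightarrow> z \<in> support A y"
      using eq[of z] ne by (cases "z \<in> support A x"; cases "z \<in> support A y"; simp)
  qed
next
  assume eq: "support A x = support A y"
  let ?k = "\<lambda>t. if t = x then 1 else if t = y then - 1 else 0 :: 'f"
  have "vanishes {x, y} (gadget A :: _ \<Rightarrow> _ \<Rightarrow> 'f) ?k"
  proof -
    have "(gadget A x z :: 'f) = gadget A y z" for z by (simp add: gadget_def eq)
    then show ?thesis using xy by (simp add: vanishes_def)
  qed
  then show "dependent_over K (gadget A :: _ \<Rightarrow> _ \<Rightarrow> 'f) {x, y}"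
    unfolding dependent_over_def using K xy by (intro exI[of _ ?k]) auto
qed

lemma parallel_iff_support:
  assumes "x \<in> copies A" "y \<in> copies A"
  shows "parallel S x y \<longleftrightarrow> x = y \<or> support A x = support A y"
  using dependent_pair[of x y] rep assms by (auto simp: parallel_def indep_represents_def S)

text \<open>Copies 0 to 8 have singleton supports, copies 9 and 10 have at least two coordinates.
  Among the latter, the only coordinate in copy 0 gives the vertex, and a coordinate in copy 5 is
  present exactly for copy 10.\<close>

lemma support_eq_iff:
  assumes "x \<in> copies A" "y \<in> copies A"
  shows "support A x = support A y \<longleftrightarrow>
    x = y \<or> (fst x = fst y \<and> snd x < 9 \<and> snd y < 9 \<and> base (snd x) = base (snd y))"
proof
  assume eq: "support A x = support A y"
  obtain u t where x: "x = (u, t)" by (cases x)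
  obtain w r where y: "y = (w, r)" by (cases y)
  have t: "t < 11" "r < 11" using assms by (auto simp: copies_def x y)
  show "x = y \<or> (fst x = fst y \<and> snd x < 9 \<and> snd y < 9 \<and> base (snd x) = base (snd y))"
  proof -
    consider "t < 9" "r < 9" | "t < 9" "9 \<le> r" | "9 \<le> t" "r < 9" | "9 \<le> t" "9 \<le> r" by linarith
    then show ?thesis
    proof cases
      case 1
      then show ?thesis using eq by (simp add: support_def x y)
    next
      case 2
      have "(w, 0) \<in> support A y" "(w, 2) \<in> support A y \<or> (w, 5) \<in> support A y"
        using 2 by (auto simp: support_def y)
      moreover have "support A x = {(u, base t)}" using 2 by (simp add: support_def x)
      ultimately show ?thesis using eq by auto
    next
      case 3
      have "(u, 0) \<in> support A x" "(u, 2) \<in> support A x \<or> (u, 5) \<in> support A x"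
        using 3 by (auto simp: support_def x)
      moreover have "support A y = {(w, base r)}" using 3 by (simp add: support_def y)
      ultimately show ?thesis using eq by auto
    next
      case 4
      have m: "(w', 0) \<in> support A x \<longleftrightarrow> w' = u" "(w', 0) \<in> support A y \<longleftrightarrow> w' = w" for w'
        using 4 by (auto simp: support_def x y)
      have m': "(u, 5) \<in> support A x \<longleftrightarrow> t \<noteq> 9" "(w, 5) \<in> support A y \<longleftrightarrow> r \<noteq> 9"
        using 4 by (auto simp: support_def x y)
      have "u = w" using m[of u] eq by simp
      moreover have "t = 9 \<longleftrightarrow> r = 9" using m' eq \<open>u = w\<close> by simp
      ultimately show ?thesis using 4 t by (auto simp: x y)
    qed
  qed
qed (auto simp: support_def)

lemma card_base: "t < 9 \<Longrightarrow> card {r. r < 9 \<and> base r = base t} = (if t < 2 then 2 else if t < 5 then 3 else 4)"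
proof -
  assume t: "t < 9"
  have "{r. r < 9 \<and> base r = base t} = (if t < 2 then {0..<2} else if t < 5 then {2..<5} else {5..<9})"
    using t by (auto simp: base_def split: if_splits)
  then show ?thesis by simp
qed

lemma card_parallel:
  assumes x: "x \<in> copies A"
  shows "card {y \<in> univ S. parallel S x y} =
    (if snd x < 2 then 2 else if snd x < 5 then 3 else if snd x < 9 then 4 else 1)"
proof -
  have *: "{y \<in> univ S. parallel S x y} = {y \<in> copies A. x = y \<or>
      (fst x = fst y \<and> snd x < 9 \<and> snd y < 9 \<and> base (snd x) = base (snd y))}"
    unfolding S using x parallel_iff_support support_eq_iff by blast
  show ?thesis
  proof (cases "snd x < 9")
    case True
    then have "{y \<in> univ S. parallel S x y} = {fst x} \<times> {r. r < 9 \<and> base r = base (snd x)}"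
      unfolding * using x by (auto simp: copies_def)
    then show ?thesis using card_base[OF True] True by (simp add: card_cartesian_product)
  next
    case False
    then have "{y \<in> univ S. parallel S x y} = {x}" unfolding * using x by auto
    then show ?thesis using False by simp
  qed
qed

lemma class_size_iff:
  assumes "x \<in> copies A"
  shows "class_size S 1 x \<longleftrightarrow> 9 \<le> snd x" "class_size S 2 x \<longleftrightarrow> snd x < 2"
    "class_size S 3 x \<longleftrightarrow> 2 \<le> snd x \<and> snd x < 5" "class_size S 4 x \<longleftrightarrow> 5 \<le> snd x \<and> snd x < 9"
  unfolding class_size_def card_parallel[OF assms] by auto

text \<open>Elements with \<open>support A y = {y}\<close> are unit vectors indexed by themselves,
  so the entries of a combination of them are its coefficients.\<close>

lemma vanishes_units:
  assumes I: "finite I" "\<And>y. y \<in> I \<Longrightarrow> support A y = {y}"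
  shows "(\<Sum>x\<in>I. k x * (gadget A x z :: 'f)) = (if z \<in> I then k z else 0)"
proof -
  have "(\<Sum>x\<in>I. k x * (gadget A x z :: 'f)) = (\<Sum>x\<in>I. if x = z then k x else 0)"
    by (intro sum.cong refl) (auto simp: gadget_def I(2))
  then show ?thesis using I(1) by (simp add: sum.delta)
qed

text \<open>If \<open>a\<close> is spanned by unit vectors not parallel to \<open>b\<close>, then
  \<open>a\<close> occurs with nonzero coefficient while all others vanish at the coordinate of
  \<open>b\<close>, hence so does \<open>a\<close>. Conversely, if \<open>a\<close> lacks this
  coordinate, it is the sum of unit vectors at its own coordinates, none parallel to
  \<open>b\<close>.\<close>

lemma has_coord_iff:
  assumes a: "a \<in> copies A" "9 \<le> snd a" and b: "b \<in> copies A" "snd b < 9"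
  shows "has_coord S a b \<longleftrightarrow> (fst b, base (snd b)) \<in> support A a"
proof -
  let ?z = "(fst b, base (snd b))"
  let ?Q = "\<lambda>I. I \<subseteq> copies A \<and> (\<forall>y\<in>I. \<not> class_size S 1 y \<and> \<not> parallel S b y) \<and>
     \<not> dependent_over K (gadget A :: _ \<Rightarrow> _ \<Rightarrow> 'f) I \<and>
     dependent_over K (gadget A :: _ \<Rightarrow> _ \<Rightarrow> 'f) (insert a I)"
  have "has_coord S a b \<longleftrightarrow> \<not> (\<exists>I. ?Q I)"
    using rep a(1) unfolding has_coord_def S indep_represents_def by (metis insert_subset)
  moreover have "?z \<notin> support A a" if Q: "?Q I" for I
  proof -
    obtain k where k: "\<forall>x\<in>insert a I. k x \<in> K" "\<forall>x. x \<notin> insert a I \<longrightarrow> k x = 0"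
      "vanishes (insert a I) (gadget A :: _ \<Rightarrow> _ \<Rightarrow> 'f) k" "\<exists>x\<in>insert a I. k x \<noteq> 0"
      using Q by (auto simp: dependent_over_def)
    have fin: "finite I" using Q finite_copies finite_subset by blast
    have "a \<notin> I" using Q class_size_iff(1)[OF a(1)] a(2) by blast
    have "k a \<noteq> 0"
    proof
      assume "k a = 0"
      then have "vanishes I (gadget A :: _ \<Rightarrow> _ \<Rightarrow> 'f) k"
        using k(3) fin \<open>a \<notin> I\<close> by (simp add: vanishes_def)
      then have "dependent_over K (gadget A :: _ \<Rightarrow> _ \<Rightarrow> 'f) I"
        unfolding dependent_over_def using k \<open>k a = 0\<close> by (intro exI[of _ k]) auto
      then show False using Q by blast
    qed
    moreover have "gadget A y ?z = (0 :: 'f)" if y: "y \<in> I" for y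
    proof -
      have yc: "y \<in> copies A" "snd y < 9" using Q y class_size_iff(1)[of y] by auto
      then have "\<not> support A b = support A y" using Q y parallel_iff_support[OF b(1), of y] by blast
      then show ?thesis using yc b by (auto simp: gadget_def support_def)
    qed
    then have "(\<Sum>y\<in>I. k y * gadget A y ?z) = 0" by (intro sum.neutral) simp
    then have "k a * gadget A a ?z = 0"
      using k(3)[unfolded vanishes_def, THEN spec, of ?z] fin \<open>a \<notin> I\<close> by simp
    ultimately show ?thesis by (simp add: gadget_def)
  qed
  moreover have "\<exists>I. ?Q I" if nz: "?z \<notin> support A a"
  proof (intro exI conjI)
    \<comment> \<open>Every coordinate in a support is an element of copy 0, 2 or 5 and its own unit
      vector, so the support doubles as the set of unit vectors that sum to
      \<open>a\<close>.\<close>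
    let ?I = "support A a"
    have u: "fst a \<in> univ A" using a(1) by (auto simp: copies_def)
    then show sub: "?I \<subseteq> copies A" using a by (auto simp: support_def copies_def)
    have unit: "snd y < 9" "support A y = {y}" if "y \<in> ?I" for y
      using that a(2) by (auto simp: support_def base_def split: if_splits)
    have fin: "finite ?I" using sub finite_copies finite_subset by blast
    have a_notin: "a \<notin> ?I" using unit(1)[of a] a(2) by auto
    show "\<forall>y\<in>?I. \<not> class_size S 1 y \<and> \<not> parallel S b y"
    proof
      fix y assume y: "y \<in> ?I"
      have yc: "y \<in> copies A" using y sub by blast
      have "support A b = {?z}" using b(2) by (simp add: support_def)
      then have "\<not> parallel S b y"
        using parallel_iff_support[OF b(1) yc] unit(2)[OF y] y nz by auto
      then show "\<not> class_size S 1 y \<and> \<not> parallel S b y"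
        using class_size_iff(1)[OF yc] unit(1)[OF y] by simp
    qed
    show "\<not> dependent_over K (gadget A :: _ \<Rightarrow> _ \<Rightarrow> 'f) ?I"
    proof
      assume "dependent_over K (gadget A :: _ \<Rightarrow> _ \<Rightarrow> 'f) ?I"
      then obtain k y where k: "vanishes ?I (gadget A :: _ \<Rightarrow> _ \<Rightarrow> 'f) k" "y \<in> ?I" "k y \<noteq> 0"
        by (auto simp: dependent_over_def)
      then show False
        using vanishes_units[OF fin unit(2), of k y] k(1)[unfolded vanishes_def, THEN spec, of y]
        by simp
    qed
    let ?k = "\<lambda>x. if x = a then 1 else if x \<in> ?I then - 1 else 0 :: 'f"
    have "vanishes (insert a ?I) (gadget A :: _ \<Rightarrow> _ \<Rightarrow> 'f) ?k"
      unfolding vanishes_def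
    proof
      fix z
      have sum: "(\<Sum>x\<in>?I. ?k x * gadget A x z) = (if z \<in> ?I then ?k z else 0)"
        by (rule vanishes_units[OF fin unit(2)])
      then show "(\<Sum>x\<in>insert a ?I. ?k x * gadget A x z) = 0"
        unfolding sum.insert[OF fin a_notin] sum
        using a_notin by (cases "z \<in> ?I") (auto simp: gadget_def)
    qed
    then show "dependent_over K (gadget A :: _ \<Rightarrow> _ \<Rightarrow> 'f) (insert a ?I)"
      unfolding dependent_over_def using K a_notin by (intro exI[of _ ?k]) auto
  qed
  ultimately show ?thesis by blast
qed

lemma marked_iff:
  assumes a: "a \<in> copies A" "9 \<le> snd a"
  shows "marked S a \<longleftrightarrow> snd a = 10"
proof
  assume "marked S a"
  then obtain d where d: "d \<in> copies A" "class_size S 4 d" "has_coord S a d"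
    by (auto simp: marked_def S)
  then have "5 \<le> snd d" "snd d < 9" using class_size_iff(4) by auto
  then have "(fst d, 5) \<in> support A a" using has_coord_iff[OF a d(1)] d(3) by (auto simp: base_def)
  then show "snd a = 10" using a by (auto simp: support_def copies_def split: if_splits)
next
  assume a10: "snd a = 10"
  let ?d = "(fst a, 5)"
  have d: "?d \<in> copies A" using a(1) by (auto simp: copies_def)
  moreover have "class_size S 4 ?d" using class_size_iff(4)[OF d] by simp
  moreover have "has_coord S a ?d"
    using has_coord_iff[OF a d] a10 by (simp add: base_def support_def)
  ultimately show "marked S a" by (auto simp: marked_def S)
qed

text \<open>Copy 9 of a vertex has exactly one coordinate in copy 0 and one in copy 2, which forces
  \<open>c\<close> to belong to \<open>u\<close> and \<open>b\<close> to \<open>w\<close>. Sharing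
  the coordinate of \<open>c\<close> then makes \<open>a\<close> the adjacency vector of
  \<open>u\<close>.\<close>

lemma edge_iff:
  assumes u: "u \<in> univ A" and w: "w \<in> univ A"
  shows "edge S (u, 9) (w, 9) \<longleftrightarrow> rel A 0 [u, w] []"
proof
  have uc: "(u, t) \<in> copies A" "(w, t) \<in> copies A" if "t < 11" for t
    using u w that by (auto simp: copies_def)
  assume "edge S (u, 9) (w, 9)"
  then obtain a c b where abc: "a \<in> copies A" "c \<in> copies A" "b \<in> copies A"
    and "class_size S 1 a" "marked S a" "class_size S 2 c" "class_size S 3 b"
    and co: "has_coord S (u, 9) c" "has_coord S a c" "has_coord S a b" "has_coord S (w, 9) b"
    by (auto simp: edge_def S)
  then have s: "9 \<le> snd a" "snd a = 10" "snd c < 2" "2 \<le> snd b" "snd b < 5"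
    using class_size_iff marked_iff by auto
  then have cb: "base (snd c) = 0" "base (snd b) = 2" by (auto simp: base_def)
  have "(fst c, 0) \<in> support A (u, 9)" "(fst c, 0) \<in> support A a" "(fst b, 2) \<in> support A a"
    "(fst b, 2) \<in> support A (w, 9)"
    using co has_coord_iff[of "(u, 9)" c] has_coord_iff[of a c] has_coord_iff[of a b]
      has_coord_iff[of "(w, 9)" b] abc s uc[of 9] unfolding cb by auto
  then show "rel A 0 [u, w] []" using s by (auto simp: support_def)
next
  have uc: "(u, t) \<in> copies A" "(w, t) \<in> copies A" if "t < 11" for t
    using u w that by (auto simp: copies_def)
  assume r: "rel A 0 [u, w] []"
  have "class_size S 1 (u, 10)" "marked S (u, 10)" "class_size S 2 (u, 0)" "class_size S 3 (w, 2)"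
    using class_size_iff(1)[OF uc(1)[of 10]] marked_iff[OF uc(1)[of 10]]
      class_size_iff(2)[OF uc(1)[of 0]] class_size_iff(3)[OF uc(2)[of 2]] by auto
  moreover have "has_coord S (u, 9) (u, 0)" "has_coord S (u, 10) (u, 0)" "has_coord S (u, 10) (w, 2)"
    "has_coord S (w, 9) (w, 2)"
    using has_coord_iff[OF uc(1)[of 9] _ uc(1)[of 0]] has_coord_iff[OF uc(1)[of 10] _ uc(1)[of 0]]
      has_coord_iff[OF uc(1)[of 10] _ uc(2)[of 2]] has_coord_iff[OF uc(2)[of 9] _ uc(2)[of 2]] r w
    by (auto simp: base_def support_def)
  ultimately have body: "class_size S 1 (u, 10) \<and> marked S (u, 10) \<and> class_size S 2 (u, 0) \<and>
      class_size S 3 (w, 2) \<and> has_coord S (u, 9) (u, 0) \<and> has_coord S (u, 10) (u, 0) \<and>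
      has_coord S (u, 10) (w, 2) \<and> has_coord S (w, 9) (w, 2)" by simp
  show "edge S (u, 9) (w, 9)"
    unfolding edge_def S
    by (rule bexI[of _ "(u, 10)"], rule bexI[of _ "(u, 0)"], rule bexI[of _ "(w, 2)"], rule body)
      (simp_all add: uc)
qed

lemma isomorphic_decode: "isomorphic [(2, 0)] A (decode S)"
proof (rule isomorphicI)
  have U: "univ (decode S) = (\<lambda>u. (u, 9)) ` univ A"
  proof (intro set_eqI iffI)
    fix x assume "x \<in> univ (decode S)"
    then have x: "x \<in> copies A" "9 \<le> snd x" "snd x \<noteq> 10"
      using class_size_iff(1)[of x] marked_iff[of x] by (auto simp: univ_decode S)
    then have "snd x = 9" by (auto simp: copies_def)
    then show "x \<in> (\<lambda>u. (u, 9)) ` univ A" using x(1) by (auto simp: copies_def image_iff)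
  next
    fix x assume "x \<in> (\<lambda>u. (u, 9 :: nat)) ` univ A"
    then obtain u where "x = (u, 9)" "u \<in> univ A" by auto
    then have "x \<in> copies A" "snd x = 9" by (auto simp: copies_def)
    then show "x \<in> univ (decode S)"
      using class_size_iff(1)[of x] marked_iff[of x] by (auto simp: univ_decode S)
  qed
  have "bij_betw (\<lambda>u. (u, 9 :: nat)) (univ A) (univ (decode S))"
    unfolding U by (rule bij_betw_imageI) (auto intro: inj_onI)
  moreover have "rel A 0 [u, w] [] \<longleftrightarrow> rel (decode S) 0 [(u, 9), (w, 9)] []"
    if "u \<in> univ A" "w \<in> univ A" for u w
    using edge_iff[OF that] rel_decode[of "(u, 9)" S "(w, 9)"] that by (simp add: S copies_def)
  ultimately show "isomorphism [(2, 0)] (\<lambda>u. (u, 9)) A (decode S)"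
    by (rule isomorphism_binaryI)
qed

end

section \<open>Null matroids in binary relations\<close>


subsection \<open>Coordinates with respect to a basis over the prime field\<close>

text \<open>\<open>d\<close> is the negated coordinate vector of \<open>e\<close>. With this sign it
  is read directly from a vanishing combination whose coefficient at \<open>e\<close> is 1, which is
  what the null relation offers.\<close>

definition expansion :: "('a \<Rightarrow> 'c \<Rightarrow> 'f::{finite,field}) \<Rightarrow> 'a set \<Rightarrow> 'a \<Rightarrow> ('a \<Rightarrow> 'f) \<Rightarrow> bool" where
  "expansion v B e d \<longleftrightarrow> (\<forall>b. d b \<in> prime_field) \<and> (\<forall>b. b \<notin> B \<longrightarrow> d b = 0) \<and>
     (\<forall>z. v e z + (\<Sum>b\<in>B. d b * v b z) = 0)"

definition level :: "'f::{finite,field} \<Rightarrow> nat" where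
  "level c = (THE r. r < CHAR('f) \<and> of_nat r = c)"

lemma level:
  assumes "c \<in> (prime_field :: 'f::{finite,field} set)"
  shows "level c < CHAR('f)" "of_nat (level c) = c"
    and "r < CHAR('f) \<Longrightarrow> of_nat r = c \<Longrightarrow> level c = r"
proof -
  obtain m where m: "c = of_nat m" using assms by (auto simp: prime_field_def)
  have "\<exists>!r. r < CHAR('f) \<and> of_nat r = c"
  proof (rule ex1I)
    show "m mod CHAR('f) < CHAR('f) \<and> of_nat (m mod CHAR('f)) = c"
      using CHAR_pos[where 'f = 'f] m by (simp add: of_nat_mod_CHAR)
    fix r assume "r < CHAR('f) \<and> of_nat r = c"
    then show "r = m mod CHAR('f)"
      unfolding m by (auto simp: of_nat_eq_iff_cong_CHAR cong_def)
  qed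
  then have *: "level c < CHAR('f) \<and> of_nat (level c) = c" "\<And>r. r < CHAR('f) \<and> of_nat r = c \<Longrightarrow> r = level c"
    unfolding level_def by (rule theI', metis (mono_tags, lifting) the1_equality)
  show "level c < CHAR('f)" "of_nat (level c) = c" using *(1) by blast+
  show "level c = r" if "r < CHAR('f)" "of_nat r = c" using *(2)[of r] that by blast
qed

lemma level_ge_iff:
  assumes "c \<in> (prime_field :: 'f::{finite,field} set)"
  shows "c \<in> of_nat ` {j..<CHAR('f)} \<longleftrightarrow> j \<le> level c"
proof
  assume "c \<in> of_nat ` {j..<CHAR('f)}"
  then obtain r where "j \<le> r" "r < CHAR('f)" "c = of_nat r" by auto
  then show "j \<le> level c" using level(3)[OF assms, of r] by simp
next
  assume "j \<le> level c"
  then show "c \<in> of_nat ` {j..<CHAR('f)}"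
    using level(1,2)[OF assms] by (intro image_eqI[of _ _ "level c"]) auto
qed

text \<open>Only prime-field relations are excluded: \<open>B\<close> may be linearly dependent over
  the whole field and exceed the dimension of the span.\<close>

locale prime_basis =
  fixes U :: "'a set" and v :: "'a \<Rightarrow> 'c \<Rightarrow> 'f::{finite,field}" and B :: "'a set"
  assumes fin: "finite U" and sub: "B \<subseteq> U"
    and indep: "\<not> dependent_over prime_field v B"
    and maxi: "\<And>e. e \<in> U \<Longrightarrow> e \<notin> B \<Longrightarrow> dependent_over prime_field v (insert e B)"
begin

lemma finB: "finite B"
  using fin sub finite_subset by blast

lemma indep_zero:
  assumes "\<And>b. b \<in> B \<Longrightarrow> k b \<in> prime_field" "\<And>z. (\<Sum>b\<in>B. k b * v b z) = 0" "b \<in> B"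
  shows "k b = 0"
proof (rule ccontr)
  assume "k b \<noteq> 0"
  let ?k = "\<lambda>x. if x \<in> B then k x else 0"
  have "(\<Sum>x\<in>B. ?k x * v x z) = (\<Sum>x\<in>B. k x * v x z)" for z by (intro sum.cong) auto
  then have "vanishes B v ?k" using assms(2) by (simp add: vanishes_def)
  then have "dependent_over prime_field v B"
    unfolding dependent_over_def using assms \<open>k b \<noteq> 0\<close> by (intro exI[of _ ?k]) auto
  then show False using indep by blast
qed

lemma expansion_unique:
  assumes "expansion v B e d" "expansion v B e d'"
  shows "d = d'"
proof
  fix b
  have "d b - d' b = 0" if "b \<in> B"
  proof (rule indep_zero[of "\<lambda>b. d b - d' b", OF _ _ that])
    fix b show "d b - d' b \<in> prime_field"
      using assms prime_field_closed(4)[of "d b" "- d' b"] prime_field_uminus[of "d' b"]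
      by (simp add: expansion_def)
    fix z
    have "v e z + (\<Sum>b\<in>B. d b * v b z) = v e z + (\<Sum>b\<in>B. d' b * v b z)"
      using assms by (simp add: expansion_def)
    then show "(\<Sum>b\<in>B. (d b - d' b) * v b z) = 0"
      by (simp add: left_diff_distrib sum_subtractf)
  qed
  then show "d b = d' b" using assms by (cases "b \<in> B") (auto simp: expansion_def)
qed

lemma expansion_basis:
  assumes "e \<in> B"
  shows "expansion v B e (\<lambda>b. if b = e then - 1 else 0)"
proof -
  have "(\<Sum>b\<in>B. (if b = e then - 1 else 0) * v b z) = (\<Sum>b\<in>B. if b = e then - v e z else 0)" for z
    by (intro sum.cong) auto
  then show ?thesis using assms finB by (auto simp: expansion_def prime_field_closed)
qed

text \<open>Dividing by \<open>k e\<close> normalises the coefficient of \<open>e\<close> to 1 and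
  stays in the prime field, which is closed under inverses. The value at \<open>e\<close> is reset
  to 0 because an expansion is supported on \<open>B\<close>.\<close>

lemma expansion_of_combination:
  assumes e: "e \<notin> B" and k: "\<And>x. k x \<in> prime_field" "\<And>x. x \<notin> insert e B \<Longrightarrow> k x = 0"
    "vanishes (insert e B) v k" "k e \<noteq> 0"
  shows "expansion v B e (\<lambda>b. if b = e then 0 else k b / k e)"
  unfolding expansion_def
proof (intro conjI allI impI)
  fix b
  show "(if b = e then 0 else k b / k e) \<in> prime_field"
    using prime_field_closed(5)[OF k(1)[of b] prime_field_inverse[OF k(1)[of e]]]
    by (simp add: prime_field_closed divide_inverse)
  show "(if b = e then 0 else k b / k e) = 0" if "b \<notin> B" using k(2)[of b] that by auto
next
  fix z
  have "k e * v e z + (\<Sum>b\<in>B. k b * v b z) = 0"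
    using k(3)[unfolded vanishes_def, THEN spec, of z] e finB by simp
  then have "(\<Sum>b\<in>B. k b * v b z) = - (k e * v e z)"
    by (simp add: eq_neg_iff_add_eq_0 add.commute)
  moreover have "(\<Sum>b\<in>B. (if b = e then 0 else k b / k e) * v b z) = (\<Sum>b\<in>B. k b * v b z) / k e"
    unfolding sum_divide_distrib using e by (intro sum.cong) auto
  ultimately show "v e z + (\<Sum>b\<in>B. (if b = e then 0 else k b / k e) * v b z) = 0"
    using k(4) by simp
qed

lemma expansion_exists:
  assumes "e \<in> U"
  shows "\<exists>d. expansion v B e d"
proof (cases "e \<in> B")
  case True
  then show ?thesis using expansion_basis by blast
next
  case False
  obtain k where k: "\<forall>x\<in>insert e B. k x \<in> prime_field" "\<forall>x. x \<notin> insert e B \<longrightarrow> k x = 0"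
    "vanishes (insert e B) v k" "\<exists>x\<in>insert e B. k x \<noteq> 0"
    using maxi[OF assms False] by (auto simp: dependent_over_def)
  have K: "k x \<in> prime_field" for x using k(1,2) prime_field_closed(1) by (cases "x \<in> insert e B") auto
  have "k e \<noteq> 0"
  proof
    assume "k e = 0"
    then have "(\<Sum>b\<in>B. k b * v b z) = 0" for z
      using k(3)[unfolded vanishes_def, THEN spec, of z] False finB by simp
    then have "k b = 0" if "b \<in> B" for b using indep_zero[of k, OF K _ that] by blast
    then show False using k(4) \<open>k e = 0\<close> by auto
  qed
  then show ?thesis using expansion_of_combination[OF False K _ k(3)] k(2) by blast
qed

definition coord :: "'a \<Rightarrow> 'a \<Rightarrow> 'f" where
  "coord e = (SOME d. expansion v B e d)"

lemma expansion_coord: "e \<in> U \<Longrightarrow> expansion v B e (coord e)"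
  unfolding coord_def by (rule someI_ex[OF expansion_exists])

lemma coord_eqI: "e \<in> U \<Longrightarrow> expansion v B e d \<Longrightarrow> coord e = d"
  using expansion_unique expansion_coord by blast

lemma coord_prime_field: "e \<in> U \<Longrightarrow> coord e b \<in> prime_field"
  using expansion_coord by (simp add: expansion_def)

lemma coord_outside: "e \<in> U \<Longrightarrow> b \<notin> B \<Longrightarrow> coord e b = 0"
  using expansion_coord by (simp add: expansion_def)

text \<open>Substituting the expansions turns a combination of vectors into a combination of basis
  vectors, whose coefficients are the entries of the combined coordinate vectors. For prime-field
  \<open>k\<close> these lie in the prime field, so independence of \<open>B\<close> forces them to
  be 0.\<close>

lemma vanishes_iff_coord:
  assumes k: "\<And>x. k x \<in> prime_field"
  shows "vanishes U v k \<longleftrightarrow> vanishes U coord k"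
proof -
  have eq: "(\<Sum>x\<in>U. k x * v x z) = - (\<Sum>b\<in>B. (\<Sum>x\<in>U. k x * coord x b) * v b z)" for z
  proof -
    have "(\<Sum>x\<in>U. k x * v x z) = (\<Sum>x\<in>U. k x * - (\<Sum>b\<in>B. coord x b * v b z))"
    proof (intro sum.cong refl)
      fix x assume "x \<in> U"
      then have "v x z + (\<Sum>b\<in>B. coord x b * v b z) = 0"
        using expansion_coord by (simp add: expansion_def)
      then have "v x z = - (\<Sum>b\<in>B. coord x b * v b z)" by (simp only: eq_neg_iff_add_eq_0)
      then show "k x * v x z = k x * - (\<Sum>b\<in>B. coord x b * v b z)" by simp
    qed
    also have "\<dots> = - (\<Sum>x\<in>U. \<Sum>b\<in>B. k x * coord x b * v b z)"
      by (simp add: sum_negf sum_distrib_left mult.assoc)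
    also have "(\<Sum>x\<in>U. \<Sum>b\<in>B. k x * coord x b * v b z) = (\<Sum>b\<in>B. (\<Sum>x\<in>U. k x * coord x b) * v b z)"
      by (subst sum.swap) (simp add: sum_distrib_right)
    finally show ?thesis .
  qed
  show ?thesis
  proof
    assume v: "vanishes U v k"
    have "(\<Sum>x\<in>U. k x * coord x b) = 0" for b
    proof (cases "b \<in> B")
      case True
      show ?thesis
      proof (rule indep_zero[of "\<lambda>b. \<Sum>x\<in>U. k x * coord x b", OF _ _ True])
        show "(\<Sum>x\<in>U. k x * coord x b) \<in> prime_field" for b
          by (intro prime_field_sum prime_field_closed(5) k coord_prime_field)
        show "(\<Sum>b\<in>B. (\<Sum>x\<in>U. k x * coord x b) * v b z) = 0" for z
          using eq[of z] v[unfolded vanishes_def, THEN spec, of z] by simp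
      qed
    next
      case False
      then show ?thesis by (intro sum.neutral) (simp add: coord_outside)
    qed
    then show "vanishes U coord k" by (simp add: vanishes_def)
  next
    assume "vanishes U coord k"
    then have "(\<Sum>x\<in>U. k x * coord x b) = 0" for b by (simp only: vanishes_def)
    then show "vanishes U v k" unfolding vanishes_def eq by simp
  qed
qed

end

lemma prime_basis_exists:
  fixes v :: "'a \<Rightarrow> 'c \<Rightarrow> 'f::{finite,field}"
  assumes "finite U"
  shows "\<exists>B. prime_basis U v B"
proof -
  let ?S = "{B. B \<subseteq> U \<and> \<not> dependent_over prime_field v B}"
  have "finite ?S" by (rule finite_subset[of _ "Pow U"]) (use assms in auto)
  moreover have "{} \<in> ?S" by (simp add: dependent_over_def)
  ultimately obtain B where B: "B \<in> ?S" "\<forall>C\<in>?S. B \<subseteq> C \<longrightarrow> B = C"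
    using finite_has_maximal[of ?S] by blast
  have "prime_basis U v B"
  proof
    show "dependent_over prime_field v (insert e B)" if "e \<in> U" "e \<notin> B" for e
    proof (rule ccontr)
      assume "\<not> dependent_over prime_field v (insert e B)"
      then have "insert e B \<in> ?S" using B(1) that by simp
      then have "B = insert e B" using B(2) by blast
      then show False using that by blast
    qed
  qed (use assms B(1) in auto)
  then show ?thesis by blast
qed

subsection \<open>From a null matroid to a binary relation\<close>

text \<open>Position 1 of the coloured vocabulary is colour 0, the candidate basis. Set variable 0
  holds it, 1 holds its one-element extensions, and the coefficient sets start at 2.\<close>

definition basis_fm :: "'f::{finite,field} itself \<Rightarrow> mso" where
  "basis_fm F = (let \<delta> = (\<lambda>X. dep_fm (prime_weights :: 'f list) X 2 1 (Rel 0 [] [2..<2 + null_arity F])) in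
     ExSet 0 (Conj (AllElem 0 (Iff (Mem 0 0) (Rel 1 [0] [])))
       (Conj (Neg (\<delta> 0)) (AllElem 0 (Imp (Neg (Mem 0 0))
         (ExSet 1 (Conj (AllElem 1 (Iff (Mem 1 1) (Or (Eq 1 0) (Mem 1 0)))) (\<delta> 1))))))))"

text \<open>A threshold relation: the entry at row 0, column 1, taken as a number below the
  characteristic, is at least \<open>j\<close>. The first disjunct handles a basis element's own
  entry -1, which is the largest such number and passes every threshold.\<close>

definition coord_fm :: "'f::{finite,field} itself \<Rightarrow> nat \<Rightarrow> mso" where
  "coord_fm F j = (let vs = [0..<null_arity F]; ps = zip (prime_weights :: 'f list) vs in
     Or (Conj (Eq 0 1) (Rel 1 [0] []))
       (Conj (Neg (Rel 1 [0] [])) (Conj (Rel 1 [1] []) (ExSets 0 (null_arity F)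
         (Conj (Neg (Disj (map (\<lambda>i. ExElem 2 (Conj (Mem 2 i) (Conj (Neg (Rel 1 [2] [])) (Neg (Eq 2 0))))) vs)))
           (Conj (Rel 0 [] vs) (Conj (coef_fm (\<lambda>c. c = 1) 0 ps 0)
             (coef_fm (\<lambda>c. c \<in> of_nat ` {j..<CHAR('f)}) 1 ps 0))))))))"

text \<open>Positions below \<open>m\<close> are the threshold relations, \<open>m\<close> is common
  origin, and \<open>m + 1 + t\<close> is copy \<open>t\<close>. Copied relations hold only within
  one copy, so the source in copy \<open>Suc i\<close> is replaced by its companion in copy
  0.\<close>

definition graph_fm :: "nat \<Rightarrow> mso" where
  "graph_fm m = Or (Conj (Rel (m + 1) [0] []) (Rel m [0, 1] []))
     (Conj (Rel (m + 1) [1] []) (Disj (map (\<lambda>i. Conj (Rel (m + 1 + Suc i) [0] [])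
        (ExElem 2 (Conj (Rel (m + 1) [2] []) (Conj (Rel m [0, 2] []) (Rel i [2, 1] []))))) [0..<m])))"

text \<open>A vertex with a loop stands for an element; the loopless vertices that it alone points to
  count, by their edges, the entries of its coordinate vector.\<close>

definition owner_fm :: "nat \<Rightarrow> nat \<Rightarrow> mso" where
  "owner_fm a y = Conj (Rel 0 [a, y] []) (Conj (Neg (Rel 0 [y, y] [])) (Conj (Rel 0 [a, a] [])
     (AllElem 3 (Imp (Conj (Rel 0 [3, 3] []) (Rel 0 [3, y] [])) (Eq 3 a)))))"

definition graph_null_fm :: "'f::{finite,field} itself \<Rightarrow> mso" where
  "graph_null_fm F = AllElem 0 (lin_fm (null_arity F) 1
     (map (apsnd (\<lambda>Y. ExElem 2 (Conj (Mem 2 Y) (Conj (owner_fm 2 1) (Rel 0 [1, 0] [])))))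
       (zip (prime_weights :: 'f list) [0..<null_arity F])) 0)"

abbreviation "cvoc F \<equiv> colour_voc 2 (null_voc F)"

lemma mso_formula_basis: "mso_formula (cvoc F) (0, 0) (basis_fm F)"
  for F :: "'f::{finite,field} itself"
proof -
  let ?\<nu> = "Rel 0 [] [2..<2 + null_arity F]"
  let ?\<delta> = "\<lambda>X. dep_fm (prime_weights :: 'f list) X 2 1 ?\<nu>"
  have 1: "elem_fv (?\<delta> X) = {}" for X
    using elem_fv_dep_fm[of "prime_weights :: 'f list" X 2 1 ?\<nu>] by simp
  have "set_fv (?\<delta> X) \<subseteq> {X}" for X
    using set_fv_dep_fm[of "prime_weights :: 'f list" X 2 1 ?\<nu>]
    unfolding set_fv.simps set_upt length_prime_weights null_arity_def by blast
  then have 2: "set_fv (?\<delta> 0) \<subseteq> {0}" "set_fv (?\<delta> 1) \<subseteq> {1}" by blast+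
  have 3: "over_voc (cvoc F) (?\<delta> X)" for X
    by (simp add: null_voc_def null_arity_def colour_voc_def del: upt_Suc)
  have "elem_fv (basis_fm F) = {}" using 1 by (auto simp: basis_fm_def Let_def simp del: upt_Suc)
  moreover have "set_fv (basis_fm F) = {}" using 2 by (auto simp: basis_fm_def Let_def simp del: upt_Suc)
  moreover have "over_voc (cvoc F) (basis_fm F)"
    using 3 by (auto simp: basis_fm_def Let_def colour_voc_def null_voc_def simp del: upt_Suc over_voc_dep_fm)
  ultimately show ?thesis by (simp add: mso_formula_def)
qed

lemma mso_formula_coord: "mso_formula (cvoc F) (2, 0) (coord_fm F j)"
  for F :: "'f::{finite,field} itself"
proof -
  let ?vs = "[0..<null_arity F]" and ?ps = "zip (prime_weights :: 'f list) [0..<null_arity F]"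
  have "elem_fv (coef_fm P x ?ps c) \<subseteq> {x}" for P x c by (rule elem_fv_coef_fm)
  then have "elem_fv (coord_fm F j) \<subseteq> {0, 1}"
    unfolding coord_fm_def Let_def elem_fv.simps elem_fv_ExSets elem_fv_Disj by fastforce
  moreover have "set_fv (coef_fm P x ?ps c) \<subseteq> {0..<null_arity F}" for P x c
    by (rule order_trans[OF set_fv_coef_fm]) (auto dest: set_zip_rightD)
  then have "set_fv (coord_fm F j) = {}" by (auto simp: coord_fm_def Let_def)
  moreover have "over_voc (cvoc F) (coord_fm F j)"
    by (auto simp: coord_fm_def Let_def colour_voc_def null_voc_def null_arity_def)
  ultimately show ?thesis by (auto simp: mso_formula_def)
qed

lemma mso_formula_graph:
  "mso_formula (copy_voc (Suc m) (replicate m (2, 0))) (2, 0) (graph_fm m)"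
  by (auto simp: mso_formula_def graph_fm_def copy_voc_def nth_append nth_Cons split: nat.splits)

lemma mso_formula_graph_null: "mso_formula [(2, 0)] (0, null_arity F) (graph_null_fm F)"
  for F :: "'f::{finite,field} itself"
proof -
  let ?ps = "map (apsnd (\<lambda>Y. ExElem 2 (Conj (Mem 2 Y) (Conj (owner_fm 2 1) (Rel 0 [1, 0] [])))))
       (zip (prime_weights :: 'f list) [0..<null_arity F])"
  have "(\<Union>p\<in>set ?ps. elem_fv (snd p)) \<subseteq> {0, 1}" by (auto simp: owner_fm_def)
  then have "elem_fv (lin_fm (null_arity F) 1 ?ps 0) \<subseteq> {0}"
    using elem_fv_lin_fm[of "null_arity F" 1 ?ps 0] by blast
  then have "elem_fv (graph_null_fm F) = {}" by (auto simp: graph_null_fm_def)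
  moreover have "(\<Union>p\<in>set ?ps. set_fv (snd p)) \<subseteq> {..<null_arity F}"
    by (auto simp: owner_fm_def dest: set_zip_rightD)
  then have "set_fv (lin_fm (null_arity F) 1 ?ps 0) \<subseteq> {..<null_arity F}"
    using set_fv_lin_fm[of "null_arity F" 1 ?ps 0] by blast
  then have "set_fv (graph_null_fm F) \<subseteq> {..<null_arity F}" by (simp add: graph_null_fm_def)
  moreover have "over_voc [(2, 0)] (lin_fm (null_arity F) 1 ?ps 0)"
    by (rule over_voc_lin_fm) (auto simp: owner_fm_def)
  then have "over_voc [(2, 0)] (graph_null_fm F)" by (simp add: graph_null_fm_def)
  ultimately show ?thesis by (simp add: mso_formula_def)
qed

section \<open>Correctness of the formulas for a basis and for coordinates\<close>

context
  fixes A :: "'a struct" and v :: "'a \<Rightarrow> 'c \<Rightarrow> 'f::{finite,field}" and c :: "'a \<Rightarrow> nat"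
    and B :: "'a set" and C :: "'a struct"
  assumes A: "is_struct A" and rep: "represents prime_weights v A"
  defines "B \<equiv> {x \<in> univ A. c x = 0}" and "C \<equiv> colour_struct (null_voc TYPE('f)) c A"
begin

lemma univ_C: "univ C = univ A" and rel_C: "rel C 0 [] Ys = rel A 0 [] Ys"
  "x \<in> univ A \<Longrightarrow> rel C (Suc 0) [x] [] \<longleftrightarrow> x \<in> B"
  by (auto simp: C_def colour_struct_def null_voc_def B_def)

lemma finA: "finite (univ A)" using A by (simp add: is_struct_def)

lemma represents_C: "represents prime_weights v C"
  using rep by (simp add: represents_def univ_C rel_C)

lemma holds_basis_fm:
  "holds C [] [] (basis_fm TYPE('f)) \<longleftrightarrow> prime_basis (univ A) v B"
proof -
  let ?\<delta> = "\<lambda>X. dep_fm (prime_weights :: 'f list) X 2 1 (Rel 0 [] [2..<2 + null_arity TYPE('f)])"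
  have d: "sat C e s (?\<delta> X) \<longleftrightarrow> dependent_over prime_field v (s X)"
    if "s X \<subseteq> univ A" "X < 2" for e s X
    using sat_null_dep_fm[OF _ represents_C, of X 2 s e 1] that finA by (simp add: univ_C)
  have skel: "sat C e s (ExSet 0 (Conj (AllElem 0 (Iff (Mem 0 0) (Rel 1 [0] [])))
       (Conj (Neg \<phi>) (AllElem 0 (Imp (Neg (Mem 0 0))
         (ExSet 1 (Conj (AllElem 1 (Iff (Mem 1 1) (Or (Eq 1 0) (Mem 1 0)))) \<psi>))))))) \<longleftrightarrow>
      (\<exists>S\<subseteq>univ A. (\<forall>a\<in>univ A. a \<in> S \<longleftrightarrow> a \<in> B) \<and>
      (\<not> sat C e (s(0 := S)) \<phi> \<and> (\<forall>x\<in>univ A. x \<in> S \<or>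
        (\<exists>T\<subseteq>univ A. (\<forall>y\<in>univ A. y \<in> T \<longleftrightarrow> y \<in> insert x S) \<and>
           sat C (e(0 := x)) (s(0 := S, 1 := T)) \<psi>))))" (is "_ \<longleftrightarrow> ?r e s \<phi> \<psi>") for e s \<phi> \<psi>
  proof -
    have 1: "(y \<in> Y \<longleftrightarrow> y = z \<or> w) \<longleftrightarrow> (y \<in> Y \<longrightarrow> y = z \<or> w) \<and> (y \<noteq> z \<and> \<not> w \<or> y \<in> Y)" for y z :: 'a and Y w
      by blast
    show ?thesis
      by (simp add: univ_C rel_C 1 iff_conv_conj_imp[of "x \<in> X" "y \<in> Y" for x X y Y]
          cong: conj_cong bex_cong ball_cong)
  qed
  have "holds C [] [] (basis_fm TYPE('f)) \<longleftrightarrow> ?r (\<lambda>i. [] ! i) (\<lambda>i. [] ! i) (?\<delta> 0) (?\<delta> 1)"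
    unfolding holds_def basis_fm_def Let_def by (rule skel)
  also have "\<dots> \<longleftrightarrow> (\<exists>S\<subseteq>univ A. (\<forall>a\<in>univ A. a \<in> S \<longleftrightarrow> a \<in> B) \<and>
      (\<not> dependent_over prime_field v S \<and> (\<forall>x\<in>univ A. x \<in> S \<or>
        (\<exists>T\<subseteq>univ A. (\<forall>y\<in>univ A. y \<in> T \<longleftrightarrow> y \<in> insert x S) \<and> dependent_over prime_field v T))))"
    (is "_ \<longleftrightarrow> ?r'")
  proof -
    have d0: "sat C e (s(0 := S)) (?\<delta> 0) \<longleftrightarrow> dependent_over prime_field v S"
      if "S \<subseteq> univ A" for e s S
      by (rule d[of "s(0 := S)" 0 e, unfolded fun_upd_same, OF that]) simp
    have d1: "sat C e (s(0 := S, 1 := T)) (?\<delta> 1) \<longleftrightarrow> dependent_over prime_field v T"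
      if "T \<subseteq> univ A" for e s S T
      by (rule d[of "s(0 := S, 1 := T)" 1 e, unfolded fun_upd_same, OF that]) simp
    have "?r e s (?\<delta> 0) (?\<delta> 1) \<longleftrightarrow> ?r'" for e s
      by (simp only: d0 d1 cong: conj_cong)
    then show ?thesis .
  qed
  also have "\<dots> \<longleftrightarrow> \<not> dependent_over prime_field v B \<and>
      (\<forall>x\<in>univ A. x \<in> B \<or> dependent_over prime_field v (insert x B))"
  proof -
    have B: "B \<subseteq> univ A" by (auto simp: B_def)
    have "(\<exists>T\<subseteq>univ A. (\<forall>y\<in>univ A. y \<in> T \<longleftrightarrow> y \<in> insert x B) \<and> dependent_over prime_field v T) \<longleftrightarrow>
        dependent_over prime_field v (insert x B)" if "x \<in> univ A" for x
      by (rule ex_subset_eq) (use B that in auto)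
    then show ?thesis by (subst ex_subset_eq[OF B]) simp
  qed
  also have "\<dots> \<longleftrightarrow> prime_basis (univ A) v B"
    using finA by (auto simp: prime_basis_def B_def)
  finally show ?thesis .
qed

text \<open>Expansions are unique: any vanishing combination supported on \<open>e\<close> and
  \<open>B\<close> with coefficient 1 at \<open>e\<close> carries the actual coordinates, so the
  existential quantifier can only read off the right value.\<close>

lemma holds_coord_fm:
  assumes basis: "prime_basis (univ A) v B" and eb: "e \<in> univ A" "b \<in> univ A"
    and j: "0 < j" "j < CHAR('f)"
  shows "holds C [e, b] [] (coord_fm TYPE('f) j) \<longleftrightarrow>
    b \<in> B \<and> j \<le> level (prime_basis.coord v B e b)"
proof -
  interpret prime_basis "univ A" v B by (rule basis)
  let ?n = "null_arity TYPE('f)"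
  let ?vs = "[0..<?n]" and ?w = "prime_weights :: 'f list"
  let ?Q = "\<lambda>k. vanishes (univ A) v k \<and> k e = 1 \<and> k b \<in> of_nat ` {j..<CHAR('f)}"
  let ?\<Phi> = "Conj (Neg (Disj (map (\<lambda>i. ExElem 2 (Conj (Mem 2 i) (Conj (Neg (Rel 1 [2] [])) (Neg (Eq 2 0))))) ?vs)))
        (Conj (Rel 0 [] ?vs) (Conj (coef_fm (\<lambda>c. c = 1) 0 (zip ?w ?vs) 0)
          (coef_fm (\<lambda>c. c \<in> of_nat ` {j..<CHAR('f)}) 1 (zip ?w ?vs) 0)))"
  have body: "sat C (\<lambda>i. [e, b] ! i) (upd_sets 0 Ys (\<lambda>i. [] ! i))
      ?\<Phi> \<longleftrightarrow>
      (\<forall>Y\<in>set Ys. Y \<subseteq> insert e B) \<and> ?Q (coef (zip ?w Ys))" (is "?l \<longleftrightarrow> _")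
    if Ys: "length Ys = ?n" "\<forall>Y\<in>set Ys. Y \<subseteq> univ A" for Ys
  proof -
    let ?s = "upd_sets 0 Ys (\<lambda>i. [] ! i)"
    have map: "map ?s ?vs = Ys"
      using map_upd_sets[of 0 Ys "\<lambda>i. [] ! i"] Ys(1) by simp
    have "(\<exists>i\<in>set ?vs. \<exists>a\<in>univ A. a \<in> ?s i \<and> a \<notin> B \<and> a \<noteq> e) \<longleftrightarrow>
        (\<exists>Y\<in>set (map ?s ?vs). \<exists>a\<in>univ A. a \<in> Y \<and> a \<notin> B \<and> a \<noteq> e)"
      unfolding set_map by blast
    also have "\<dots> \<longleftrightarrow> \<not> (\<forall>Y\<in>set Ys. Y \<subseteq> insert e B)"
      unfolding map using Ys(2) by blast
    finally have 1: "(\<exists>i\<in>set ?vs. \<exists>a\<in>univ A. a \<in> ?s i \<and> a \<notin> B \<and> a \<noteq> e) \<longleftrightarrow>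
        \<not> (\<forall>Y\<in>set Ys. Y \<subseteq> insert e B)" .
    have 2: "map (apsnd ?s) (zip ?w ?vs) = zip ?w Ys" unfolding map_apsnd_zip map ..
    have 3: "sat C (\<lambda>i. [e, b] ! i) ?s (Rel 0 [] ?vs) \<longleftrightarrow>
        vanishes (univ A) v (coef (zip ?w Ys))"
      using rep Ys unfolding sat.simps map rel_C list.map by (simp add: represents_def)
    have 4: "sat C (\<lambda>i. [e, b] ! i) ?s (Disj (map (\<lambda>i. ExElem 2 (Conj (Mem 2 i)
          (Conj (Neg (Rel 1 [2] [])) (Neg (Eq 2 0))))) ?vs)) \<longleftrightarrow>
        (\<exists>i\<in>set ?vs. \<exists>a\<in>univ A. a \<in> ?s i \<and> a \<notin> B \<and> a \<noteq> e)"
      by (simp add: univ_C rel_C cong: bex_cong)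
    show ?thesis
      unfolding sat.simps(5,6) 4 1 sat_coef_fm 2 3 by simp
  qed
  have "sat C (\<lambda>i. [e, b] ! i) (\<lambda>i. [] ! i) (ExSets 0 ?n
      ?\<Phi>) \<longleftrightarrow>
      (\<exists>Ys. length Ys = length ?w \<and> (\<forall>Y\<in>set Ys. Y \<subseteq> insert e B) \<and> ?Q (coef (zip ?w Ys)))"
  proof -
    have "insert e B \<subseteq> univ A" using eb(1) by (auto simp: B_def)
    then have sub: "(\<forall>Y\<in>set Ys. Y \<subseteq> insert e B) \<Longrightarrow> \<forall>Y\<in>set Ys. Y \<subseteq> univ A" for Ys by blast
    have "(length Ys = ?n \<and> (\<forall>Y\<in>set Ys. Y \<subseteq> univ A) \<and>
        sat C (\<lambda>i. [e, b] ! i) (upd_sets 0 Ys (\<lambda>i. [] ! i)) ?\<Phi>) \<longleftrightarrow>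
      (length Ys = ?n \<and> (\<forall>Y\<in>set Ys. Y \<subseteq> insert e B) \<and> ?Q (coef (zip ?w Ys)))" for Ys
    proof (cases "length Ys = ?n \<and> (\<forall>Y\<in>set Ys. Y \<subseteq> univ A)")
      case True
      show ?thesis unfolding body[OF conjunct1[OF True] conjunct2[OF True]] using True by blast
    next
      case False
      then show ?thesis using sub by auto
    qed
    then show ?thesis unfolding sat_ExSets univ_C length_prime_weights by (rule ex_cong1)
  qed
  also have "\<dots> \<longleftrightarrow> (\<exists>k. (\<forall>x\<in>insert e B. k x \<in> prime_field) \<and>
      (\<forall>x. x \<notin> insert e B \<longrightarrow> k x = 0) \<and> ?Q k)" (is "_ \<longleftrightarrow> ?E")
    unfolding subset_sums_prime_weights[symmetric] by (rule ex_sets_iff_ex_coef)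
  finally have ex: "sat C (\<lambda>i. [e, b] ! i) (\<lambda>i. [] ! i) (ExSets 0 ?n ?\<Phi>) \<longleftrightarrow> ?E" .
  have skel: "sat C (\<lambda>i. [e, b] ! i) s (Or (Conj (Eq 0 1) (Rel 1 [0] []))
       (Conj (Neg (Rel 1 [0] [])) (Conj (Rel 1 [1] []) \<psi>))) \<longleftrightarrow>
      (e = b \<and> e \<in> B) \<or> (e \<notin> B \<and> b \<in> B \<and> sat C (\<lambda>i. [e, b] ! i) s \<psi>)" for s \<psi>
  proof -
    have "sat C (\<lambda>i. [e, b] ! i) s (Rel 1 [0] []) \<longleftrightarrow> e \<in> B"
      "sat C (\<lambda>i. [e, b] ! i) s (Rel 1 [1] []) \<longleftrightarrow> b \<in> B"
      "sat C (\<lambda>i. [e, b] ! i) s (Eq 0 1) \<longleftrightarrow> e = b"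
      by (simp_all add: rel_C eb)
    then show ?thesis unfolding sat.simps(5,6) by argo
  qed
  have E: "holds C [e, b] [] (coord_fm TYPE('f) j) \<longleftrightarrow>
      (e = b \<and> e \<in> B) \<or> (e \<notin> B \<and> b \<in> B \<and> ?E)"
    unfolding holds_def coord_fm_def Let_def skel ex ..
  show ?thesis
  proof (cases "e \<in> B")
    case True
    \<comment> \<open>Here the entry at \<open>e\<close> has level one less than the characteristic,
      and all other entries have level 0, below \<open>j\<close>.\<close>
    have coord: "coord e = (\<lambda>b. if b = e then - 1 else 0)"
      by (rule coord_eqI[OF eb(1) expansion_basis[OF True]])
    have "(of_nat (CHAR('f) - 1) :: 'f) + 1 = of_nat (CHAR('f) - 1 + 1)"
      by (simp only: of_nat_add of_nat_1)
    also have "\<dots> = 0" using j by simp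
    finally have "of_nat (CHAR('f) - 1) = (- 1 :: 'f)" by (simp only: eq_neg_iff_add_eq_0)
    then have "level (- 1 :: 'f) = CHAR('f) - 1" "level (0 :: 'f) = 0"
      using j by (intro level(3) prime_field_closed; simp)+
    then show ?thesis using E True j by (auto simp: coord)
  next
    case False
    have "?E \<longleftrightarrow> j \<le> level (coord e b)" if b: "b \<in> B"
    proof
      assume ?E
      then obtain k where k: "\<forall>x\<in>insert e B. k x \<in> prime_field" "\<forall>x. x \<notin> insert e B \<longrightarrow> k x = 0" "?Q k"
        by blast
      have K: "k x \<in> prime_field" for x
        using k(1,2) prime_field_closed(1) by (cases "x \<in> insert e B") auto
      have van: "vanishes (insert e B) v k"
        using vanishes_superset[OF finA, of "insert e B" k v] k(2,3) eb(1) by (auto simp: B_def)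
      have "expansion v B e (\<lambda>b. if b = e then 0 else k b / k e)"
        by (rule expansion_of_combination[OF False K _ van]) (use k in auto)
      then have "coord e = (\<lambda>b. if b = e then 0 else k b / k e)" by (rule coord_eqI[OF eb(1)])
      then have "coord e b = k b" using k(3) b False by auto
      then show "j \<le> level (coord e b)" using k(3) level_ge_iff[OF K[of b], of j] by simp
    next
      assume le: "j \<le> level (coord e b)"
      \<comment> \<open>The expansion of \<open>e\<close>, completed by coefficient 1 at
        \<open>e\<close>, is the required combination.\<close>
      let ?k = "\<lambda>x. if x = e then 1 else coord e x"
      have outside: "?k x = 0" if "x \<notin> insert e B" for x using that coord_outside[OF eb(1)] by auto
      have "(\<Sum>x\<in>insert e B. ?k x * v x z) = 0" for z
      proof -
        have "(\<Sum>x\<in>insert e B. ?k x * v x z) = v e z + (\<Sum>x\<in>B. ?k x * v x z)"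
          using finB False by simp
        also have "(\<Sum>x\<in>B. ?k x * v x z) = (\<Sum>x\<in>B. coord e x * v x z)"
          using False by (intro sum.cong) auto
        also have "v e z + \<dots> = 0" using expansion_coord[OF eb(1)] by (simp add: expansion_def)
        finally show ?thesis .
      qed
      then have "vanishes (insert e B) v ?k" by (simp add: vanishes_def)
      then have "vanishes (univ A) v ?k"
        using vanishes_superset[OF finA, of "insert e B" ?k v, OF _ outside] eb(1) by (auto simp: B_def)
      moreover have "?k b \<in> of_nat ` {j..<CHAR('f)}"
        using level_ge_iff[OF coord_prime_field[OF eb(1)], of b j] le b False by auto
      moreover have "\<forall>x\<in>insert e B. ?k x \<in> prime_field"
        using coord_prime_field[OF eb(1)] prime_field_closed(2) by auto
      ultimately show ?E using outside by (intro exI[of _ ?k]) simp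
    qed
    then show ?thesis using E False by blast
  qed
qed

end

text \<open>Copy 0 represents the elements, and copy \<open>i + 1\<close> carries the threshold
  relation for level \<open>i + 1\<close>. There are as many copies as the characteristic, since the
  largest level is one less.\<close>

definition coord_graph :: "'f::{finite,field} itself \<Rightarrow> 'a struct \<Rightarrow> ('a \<times> nat) struct" where
  "coord_graph F C = (let m = CHAR('f) - 1 in
     interpret_struct FTrue [graph_fm m] (copy_struct (replicate m (2, 0)) (Suc m)
       (interpret_struct FTrue (map (\<lambda>i. coord_fm F (Suc i)) [0..<m]) C)))"

definition graph_null :: "'f::{finite,field} itself \<Rightarrow> 'a struct \<Rightarrow> 'a struct" where
  "graph_null F T = interpret_struct (Rel 0 [0, 0] []) [graph_null_fm F] T"

lemma univ_coord_graph: "univ (coord_graph TYPE('f::{finite,field}) C) = univ C \<times> {..<CHAR('f)}"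
  using CHAR_pos[where 'f = 'f] by (simp add: coord_graph_def Let_def copy_struct_def)

lemma rel_copy_struct_replicate:
  "i < m \<Longrightarrow> rel (copy_struct (replicate m (2, 0)) (Suc m) L) i [x, y] [] \<longleftrightarrow>
    snd x < Suc m \<and> snd y = snd x \<and> rel L i [fst x, fst y] []"
  "rel (copy_struct (replicate m (2, 0)) (Suc m) L) m [x, y] [] \<longleftrightarrow> fst x = fst y"
  "rel (copy_struct (replicate m (2, 0)) (Suc m) L) (m + 1 + t) [x] [] \<longleftrightarrow> snd x = t"
  by (auto simp: copy_struct_def)

lemma holds_graph_fm:
  assumes x: "x \<in> univ L \<times> {..<Suc m}" and y: "y \<in> univ L \<times> {..<Suc m}"
  shows "holds (copy_struct (replicate m (2, 0)) (Suc m) L) [x, y] [] (graph_fm m) \<longleftrightarrow>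
    (snd x = 0 \<and> fst x = fst y) \<or>
    (snd y = 0 \<and> (\<exists>i<m. snd x = Suc i \<and> rel L i [fst x, fst y] []))"
proof -
  let ?D = "copy_struct (replicate m (2, 0)) (Suc m) L"
  let ?e = "\<lambda>i. [x, y] ! i" and ?s = "\<lambda>i. ([] :: ('a \<times> nat) set list) ! i"
  have U: "univ ?D = univ L \<times> {..<Suc m}" by (simp add: copy_struct_def)
  have copy: "rel ?D (m + 1) [a] [] \<longleftrightarrow> snd a = 0" "rel ?D (Suc m) [a] [] \<longleftrightarrow> snd a = 0" for a
    using rel_copy_struct_replicate(3)[of m L 0 a] by simp_all
  have inner: "sat ?D ?e ?s (Conj (Rel (m + 1 + Suc i) [0] [])
        (ExElem 2 (Conj (Rel (m + 1) [2] []) (Conj (Rel m [0, 2] []) (Rel i [2, 1] []))))) \<longleftrightarrow>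
      snd x = Suc i \<and> (\<exists>a\<in>univ L \<times> {..<Suc m}. snd a = 0 \<and> fst x = fst a \<and>
        snd y = snd a \<and> rel L i [fst a, fst y] [])" if "i < m" for i
    using rel_copy_struct_replicate(1)[OF that, of L _ y] rel_copy_struct_replicate(2)[of m L]
      rel_copy_struct_replicate(3)[of m L "Suc i"]
    unfolding sat.simps U list.map by (auto simp: copy)
  have "holds ?D [x, y] [] (graph_fm m) \<longleftrightarrow> (snd x = 0 \<and> fst x = fst y) \<or>
      (snd y = 0 \<and> (\<exists>i<m. snd x = Suc i \<and> (\<exists>a\<in>univ L \<times> {..<Suc m}. snd a = 0 \<and> fst x = fst a \<and>
        snd y = snd a \<and> rel L i [fst a, fst y] [])))"
  proof -
    have "sat ?D ?e ?s (Disj (map (\<lambda>i. Conj (Rel (m + 1 + Suc i) [0] [])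
        (ExElem 2 (Conj (Rel (m + 1) [2] []) (Conj (Rel m [0, 2] []) (Rel i [2, 1] []))))) [0..<m])) \<longleftrightarrow>
      (\<exists>i<m. snd x = Suc i \<and> (\<exists>a\<in>univ L \<times> {..<Suc m}. snd a = 0 \<and> fst x = fst a \<and>
        snd y = snd a \<and> rel L i [fst a, fst y] []))" (is "?l \<longleftrightarrow> ?r")
      unfolding sat_Disj set_map bex_simps(7) set_upt using inner by (meson atLeastLessThan_iff zero_le)
    moreover have "sat ?D ?e ?s (Rel (m + 1) [0] []) \<longleftrightarrow> snd x = 0"
      "sat ?D ?e ?s (Rel (m + 1) [1] []) \<longleftrightarrow> snd y = 0"
      unfolding sat.simps list.map copy by simp_all
    moreover have "sat ?D ?e ?s (Rel m [0, 1] []) \<longleftrightarrow> fst x = fst y"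
      unfolding sat.simps list.map rel_copy_struct_replicate by simp
    ultimately show ?thesis unfolding holds_def graph_fm_def sat.simps(5,6) by blast
  qed
  also have "\<dots> \<longleftrightarrow> (snd x = 0 \<and> fst x = fst y) \<or>
    (snd y = 0 \<and> (\<exists>i<m. snd x = Suc i \<and> rel L i [fst x, fst y] []))"
    using x by force
  finally show ?thesis .
qed

definition owns :: "'a struct \<Rightarrow> 'a \<Rightarrow> 'a \<Rightarrow> bool" where
  "owns T a y \<longleftrightarrow> rel T 0 [a, y] [] \<and> \<not> rel T 0 [y, y] [] \<and> rel T 0 [a, a] [] \<and>
     (\<forall>a'\<in>univ T. rel T 0 [a', a'] [] \<and> rel T 0 [a', y] [] \<longrightarrow> a' = a)"

text \<open>The matrix that an arbitrary relation defines. The value 0 outside the universe makes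
  \<open>vanishes\<close>, which ranges over the whole type, agree with the formula.\<close>

definition weight :: "'a struct \<Rightarrow> 'a \<Rightarrow> 'a \<Rightarrow> 'f::field" where
  "weight T a z = (if z \<in> univ T then of_nat (card {y \<in> univ T. owns T a y \<and> rel T 0 [y, z] []}) else 0)"

lemma univ_graph_null: "univ (graph_null F T) = {x \<in> univ T. rel T 0 [x, x] []}"
  by (simp add: graph_null_def interpret_struct_def holds_def)

text \<open>Nothing but finiteness is assumed of \<open>T\<close>, so the decoder yields a null
  matroid from every binary relation with a loop; without a loop it has no output.\<close>

lemma represents_graph_null:
  assumes fin: "finite (univ T)"
  shows "represents (prime_weights :: 'f list) (weight T) (graph_null TYPE('f::{finite,field}) T)"
  unfolding represents_def
proof (intro allI impI)
  fix Ys
  assume Ys: "length Ys = length (prime_weights :: 'f list)"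
    "\<forall>Y\<in>set Ys. Y \<subseteq> univ (graph_null TYPE('f) T)"
  let ?n = "null_arity TYPE('f)" and ?w = "prime_weights :: 'f list"
  let ?U = "univ (graph_null TYPE('f) T)"
  let ?s = "\<lambda>i. Ys ! i"
  let ?\<theta> = "\<lambda>Y. ExElem 2 (Conj (Mem 2 Y) (Conj (owner_fm 2 1) (Rel 0 [1, 0] [])))"
  have U: "?U \<subseteq> univ T" by (auto simp: univ_graph_null)
  have finU: "finite ?U" using U fin finite_subset by blast
  have map: "map ?s [0..<?n] = Ys" using map_nth[of Ys] Ys(1) by simp
  have step: "sat T (e(0 := z)) ?s (lin_fm ?n 1 (map (apsnd ?\<theta>) (zip ?w [0..<?n])) 0) \<longleftrightarrow>
      (\<Sum>x\<in>?U. coef (zip ?w Ys) x * weight T x z) = 0" if z: "z \<in> univ T" for e z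
  proof -
    have card: "of_nat (card {y \<in> univ T. sat T (e(0 := z, 1 := y)) ?s (?\<theta> i)}) =
        (\<Sum>x\<in>?s i. weight T x z :: 'f)" if i: "i \<in> set [0..<?n]" for i
    proof -
      have "?s i \<in> set Ys" using i Ys(1) by simp
      then have sub: "?s i \<subseteq> univ T" using Ys(2) U by blast
      then have fini: "finite (?s i)" using fin finite_subset by blast
      have "{y \<in> univ T. sat T (e(0 := z, 1 := y)) ?s (?\<theta> i)} =
          (\<Union>a\<in>?s i. {y \<in> univ T. owns T a y \<and> rel T 0 [y, z] []})"
        using sub by (auto simp: owner_fm_def owns_def)
      also have "card \<dots> = (\<Sum>a\<in>?s i. card {y \<in> univ T. owns T a y \<and> rel T 0 [y, z] []})"
      \<comment> \<open>Unique ownership makes the counted sets disjoint, so counting once for a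
        whole set of elements adds up their weights.\<close>
      proof (rule card_UN_disjoint[OF fini])
        show "\<forall>a\<in>?s i. finite {y \<in> univ T. owns T a y \<and> rel T 0 [y, z] []}" using fin by simp
        have "a = a'" if "a \<in> ?s i" "a' \<in> ?s i" "owns T a y" "owns T a' y" for a a' y
          using that sub unfolding owns_def by blast
        then show "\<forall>a\<in>?s i. \<forall>a'\<in>?s i. a \<noteq> a' \<longrightarrow>
            {y \<in> univ T. owns T a y \<and> rel T 0 [y, z] []} \<inter>
            {y \<in> univ T. owns T a' y \<and> rel T 0 [y, z] []} = {}" by blast
      qed
      finally show ?thesis using z by (simp add: weight_def)
    qed
    have "(\<Sum>x\<in>?U. coef (zip ?w (map ?s [0..<?n])) x * weight T x z) =
        (\<Sum>(\<alpha>, Y)\<leftarrow>zip ?w (map ?s [0..<?n]). \<alpha> * (\<Sum>x\<in>Y. weight T x z))"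
      unfolding map by (rule sum_coef[OF finU]) (use Ys(2) in \<open>auto dest!: set_zip_rightD\<close>)
    also have "\<dots> = (\<Sum>p\<leftarrow>zip ?w [0..<?n]. fst p * (\<Sum>x\<in>?s (snd p). weight T x z))"
      by (simp only: map_apsnd_zip[symmetric] case_prod_beta comp_def list.map_comp fst_apsnd snd_apsnd)
    also have "\<dots> = (\<Sum>p\<leftarrow>zip ?w [0..<?n]. fst p *
        of_nat (card {y \<in> univ T. sat T (e(0 := z, 1 := y)) ?s (?\<theta> (snd p))}))"
    proof (rule arg_cong[of _ _ sum_list], rule map_cong[OF refl])
      fix p assume "p \<in> set (zip ?w [0..<?n])"
      then have "snd p \<in> set [0..<?n]" using set_zip_rightD[of "fst p" "snd p" ?w "[0..<?n]"] by simp
      then show "fst p * (\<Sum>x\<in>?s (snd p). weight T x z) = fst p *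
          of_nat (card {y \<in> univ T. sat T (e(0 := z, 1 := y)) ?s (?\<theta> (snd p))})"
        by (simp only: card)
    qed
    finally have sum: "(\<Sum>x\<in>?U. coef (zip ?w Ys) x * weight T x z) = \<dots>" unfolding map .
    have "\<forall>p\<in>set (map (apsnd ?\<theta>) (zip ?w [0..<?n])). ?n \<notin> set_fv (snd p)"
      by (auto simp: owner_fm_def dest: set_zip_rightD)
    then show ?thesis
      unfolding sum by (subst sat_lin_fm) (simp_all only: list.map_comp comp_def case_prod_beta
          fst_apsnd snd_apsnd add_0)
  qed
  have "rel (graph_null TYPE('f) T) 0 [] Ys \<longleftrightarrow>
      (\<forall>z\<in>univ T. (\<Sum>x\<in>?U. coef (zip ?w Ys) x * weight T x z) = 0)"
  proof -
    have "rel (graph_null TYPE('f) T) 0 [] Ys \<longleftrightarrow> sat T (\<lambda>i. [] ! i) ?s (graph_null_fm TYPE('f))"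
      by (simp add: graph_null_def rel_interpret holds_def)
    then show ?thesis unfolding graph_null_fm_def sat.simps using step by blast
  qed
  also have "\<dots> \<longleftrightarrow> vanishes ?U (weight T) (coef (zip ?w Ys))"
  proof -
    have "(\<Sum>x\<in>?U. coef (zip ?w Ys) x * weight T x z) = 0" if "z \<notin> univ T" for z
      using that by (simp add: weight_def)
    then show ?thesis unfolding vanishes_def by blast
  qed
  finally show "rel (graph_null TYPE('f) T) 0 [] Ys \<longleftrightarrow>
      vanishes ?U (weight T) (coef (zip ?w Ys))" .
qed

section \<open>The coordinate graph of a null matroid and its decoding\<close>

context
  fixes A :: "'a struct" and v :: "'a \<Rightarrow> 'c \<Rightarrow> 'f::{finite,field}" and c :: "'a \<Rightarrow> nat"
    and B :: "'a set" and C :: "'a struct" and T :: "('a \<times> nat) struct"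
  assumes A: "is_struct A" and rep: "represents prime_weights v A"
    and basis: "prime_basis (univ A) v {x \<in> univ A. c x = 0}"
  defines "B \<equiv> {x \<in> univ A. c x = 0}" and "C \<equiv> colour_struct (null_voc TYPE('f)) c A"
    and "T \<equiv> coord_graph TYPE('f) (colour_struct (null_voc TYPE('f)) c A)"
begin

interpretation prime_basis "univ A" v B
  using basis by (simp add: B_def)

lemma univ_T: "univ T = univ A \<times> {..<CHAR('f)}"
  by (simp add: T_def univ_coord_graph colour_struct_def)

lemma rel_T:
  assumes "x \<in> univ T" "y \<in> univ T"
  shows "rel T 0 [x, y] [] \<longleftrightarrow> (snd x = 0 \<and> fst x = fst y) \<or>
    (snd y = 0 \<and> 0 < snd x \<and> fst y \<in> B \<and> snd x \<le> level (coord (fst x) (fst y)))"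
proof -
  let ?m = "CHAR('f) - 1"
  let ?L = "interpret_struct FTrue (map (\<lambda>i. coord_fm TYPE('f) (Suc i)) [0..<?m]) C"
  have p: "Suc ?m = CHAR('f)" using CHAR_pos[where 'f = 'f] by simp
  have UL: "univ ?L = univ A" by (simp add: C_def colour_struct_def)
  have xy: "fst x \<in> univ A" "fst y \<in> univ A" "snd x < CHAR('f)" using assms by (auto simp: univ_T)
  have L: "rel ?L i [fst x, fst y] [] \<longleftrightarrow> fst y \<in> B \<and> Suc i \<le> level (coord (fst x) (fst y))"
    if "i < ?m" for i
    using holds_coord_fm[OF A rep basis xy(1,2), of "Suc i"] that
    by (simp add: rel_interpret C_def B_def)
  have "rel T 0 [x, y] [] \<longleftrightarrow> holds (copy_struct (replicate ?m (2, 0)) (Suc ?m) ?L) [x, y] [] (graph_fm ?m)"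
    by (simp add: T_def C_def coord_graph_def Let_def rel_interpret)
  also have "\<dots> \<longleftrightarrow> (snd x = 0 \<and> fst x = fst y) \<or>
    (snd y = 0 \<and> (\<exists>i<?m. snd x = Suc i \<and> rel ?L i [fst x, fst y] []))"
    by (rule holds_graph_fm) (use assms in \<open>simp_all only: UL p univ_T\<close>)
  also have "\<dots> \<longleftrightarrow> (snd x = 0 \<and> fst x = fst y) \<or>
    (snd y = 0 \<and> 0 < snd x \<and> fst y \<in> B \<and> snd x \<le> level (coord (fst x) (fst y)))"
  proof -
    have "(\<exists>i<?m. snd x = Suc i \<and> rel ?L i [fst x, fst y] []) \<longleftrightarrow>
        (\<exists>i<?m. snd x = Suc i \<and> fst y \<in> B \<and> Suc i \<le> level (coord (fst x) (fst y)))"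
      using L by blast
    also have "\<dots> \<longleftrightarrow> 0 < snd x \<and> fst y \<in> B \<and> snd x \<le> level (coord (fst x) (fst y))"
      using xy(3) by (cases "snd x") auto
    finally show ?thesis by blast
  qed
  finally show ?thesis .
qed

lemma loop_T: "x \<in> univ T \<Longrightarrow> rel T 0 [x, x] [] \<longleftrightarrow> snd x = 0"
  by (auto simp: rel_T)

text \<open>The looped vertices are those of copy 0, and such a vertex points exactly to the copies
  of its own element. It is therefore the unique owner of the copies other than itself.\<close>

lemma owns_T:
  assumes "a \<in> univ A" "y \<in> univ T"
  shows "owns T (a, 0) y \<longleftrightarrow> fst y = a \<and> 0 < snd y"
proof -
  have a: "(a, 0) \<in> univ T" using assms(1) CHAR_pos[where 'f = 'f] by (simp add: univ_T)
  have "a' = (a, 0)" if "a' \<in> univ T" "snd a' = 0" "rel T 0 [a', y] []" "fst y = a" for a'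
    using that(2,4) that(3)[unfolded rel_T[OF that(1) assms(2)]] by (cases a') auto
  moreover have "rel T 0 [(a, 0), y] [] \<longleftrightarrow> a = fst y" using rel_T[OF a assms(2)] by auto
  ultimately show ?thesis
    unfolding owns_def using loop_T[OF a] loop_T[OF assms(2)] loop_T by auto
qed

text \<open>At a basis coordinate the copies of \<open>a\<close> numbered from 1 up to the level of
  the entry point to it, so their number is the level, and its image in the field is the
  entry.\<close>

lemma weight_T:
  assumes a: "a \<in> univ A" and z: "z \<in> univ T"
  shows "weight T (a, 0) z = (if snd z = 0 then coord a (fst z) else (0 :: 'f))"
proof (cases "snd z = 0 \<and> fst z \<in> B")
  case True
  let ?l = "level (coord a (fst z))"
  have l: "?l < CHAR('f)" "of_nat ?l = coord a (fst z)" using level coord_prime_field[OF a] by blast+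
  have "{y \<in> univ T. owns T (a, 0) y \<and> rel T 0 [y, z] []} = (\<lambda>s. (a, s)) ` {0<..?l}"
  proof (intro set_eqI iffI)
    fix y assume "y \<in> {y \<in> univ T. owns T (a, 0) y \<and> rel T 0 [y, z] []}"
    then show "y \<in> (\<lambda>s. (a, s)) ` {0<..?l}"
      using owns_T[OF a, of y] rel_T[OF _ z, of y] by (cases y) auto
  next
    fix y assume "y \<in> (\<lambda>s. (a, s)) ` {0<..?l}"
    then obtain s where y: "y = (a, s)" "0 < s" "s \<le> ?l" by auto
    then have "y \<in> univ T" using a l(1) by (simp add: univ_T)
    then show "y \<in> {y \<in> univ T. owns T (a, 0) y \<and> rel T 0 [y, z] []}"
      using owns_T[OF a, of y] rel_T[OF _ z, of y] y True by simp
  qed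
  then have "card {y \<in> univ T. owns T (a, 0) y \<and> rel T 0 [y, z] []} = ?l"
    by (simp add: card_image inj_on_def)
  then show ?thesis using z True l(2) by (simp add: weight_def)
next
  case False
  have none: "{y \<in> univ T. owns T (a, 0) y \<and> rel T 0 [y, z] []} = {}"
    using owns_T[OF a] rel_T[OF _ z] False by auto
  show ?thesis unfolding weight_def none using z False coord_outside[OF a, of "fst z"] by auto
qed

lemma isomorphic_graph_null_coord_graph: "isomorphic (null_voc TYPE('f)) A (graph_null TYPE('f) T)"
proof (rule isomorphicI)
  let ?N = "graph_null TYPE('f) T" and ?h = "\<lambda>a :: 'a. (a, 0 :: nat)"
  let ?w = "prime_weights :: 'f list"
  have U: "univ ?N = ?h ` univ A"
    using loop_T CHAR_pos[where 'f = 'f] by (auto simp: univ_graph_null univ_T)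
  have bij: "bij_betw ?h (univ A) (univ ?N)"
    unfolding U by (rule bij_betw_imageI) (auto intro: inj_onI)
  have finT: "finite (univ T)" using fin by (simp add: univ_T)
  have rel: "rel A 0 [] Ys \<longleftrightarrow> rel ?N 0 [] (map ((`) ?h) Ys)"
    if Ys: "length Ys = length ?w" "\<forall>Y\<in>set Ys. Y \<subseteq> univ A" for Ys
  proof -
    let ?k = "coef (zip ?w Ys)"
    have sub: "\<forall>Y\<in>set (map ((`) ?h) Ys). Y \<subseteq> univ ?N" using Ys(2) U by auto
    have "rel ?N 0 [] (map ((`) ?h) Ys) \<longleftrightarrow>
        vanishes (univ ?N) (weight T) (coef (zip ?w (map ((`) ?h) Ys)))"
      using represents_graph_null[OF finT, where 'f = 'f] Ys(1) sub by (simp add: represents_def)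
    also have "\<dots> \<longleftrightarrow> vanishes (univ A) (\<lambda>a. weight T (?h a)) ?k"
      by (rule vanishes_reindex[OF bij coef_image[OF _ Ys(2)]]) (auto intro: inj_onI)
    also have "\<dots> \<longleftrightarrow> vanishes (univ A) coord ?k"
    proof
      assume vw: "vanishes (univ A) (\<lambda>a. weight T (?h a)) ?k"
      show "vanishes (univ A) coord ?k"
        unfolding vanishes_def
      proof
        fix b
        show "(\<Sum>x\<in>univ A. ?k x * coord x b) = 0"
        proof (cases "b \<in> univ A")
          case True
          then have "?h b \<in> univ T" using CHAR_pos[where 'f = 'f] by (simp add: univ_T)
          then have "(\<Sum>x\<in>univ A. ?k x * coord x b) = (\<Sum>x\<in>univ A. ?k x * weight T (?h x) (?h b))"
            by (intro sum.cong refl) (simp add: weight_T)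
          then show ?thesis using vw[unfolded vanishes_def, THEN spec, of "?h b"] by simp
        next
          case False
          then have "b \<notin> B" by (simp add: B_def)
          then show ?thesis by (intro sum.neutral) (simp add: coord_outside)
        qed
      qed
    next
      assume vc: "vanishes (univ A) coord ?k"
      show "vanishes (univ A) (\<lambda>a. weight T (?h a)) ?k"
        unfolding vanishes_def
      proof
        fix z
        show "(\<Sum>x\<in>univ A. ?k x * weight T (?h x) z) = 0"
        proof (cases "z \<in> univ T \<and> snd z = 0")
          case True
          then have "(\<Sum>x\<in>univ A. ?k x * weight T (?h x) z) = (\<Sum>x\<in>univ A. ?k x * coord x (fst z))"
            by (intro sum.cong refl) (simp add: weight_T)
          then show ?thesis using vc[unfolded vanishes_def, THEN spec, of "fst z"] by simp
        next
          case False
          then have "weight T (?h x) z = (0 :: 'f)" if "x \<in> univ A" for x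
            using weight_T[OF that, of z] by (cases "z \<in> univ T") (auto simp: weight_def)
          then show ?thesis by (intro sum.neutral) simp
        qed
      qed
    qed
    \<comment> \<open>Coefficients built from \<open>prime_weights\<close> lie in the prime field,
      as the passage from coordinates to vectors requires.\<close>
    also have "\<dots> \<longleftrightarrow> vanishes (univ A) v ?k"
      by (rule vanishes_iff_coord[symmetric])
        (simp only: subset_sums_prime_weights[symmetric] coef_in_subset_sums)
    also have "\<dots> \<longleftrightarrow> rel A 0 [] Ys" using rep Ys by (simp add: represents_def)
    finally show ?thesis ..
  qed
  show "isomorphism (null_voc TYPE('f)) ?h A ?N"
    unfolding isomorphism_def
  proof (intro conjI allI impI ballI)
    fix i p
    assume "i < length (null_voc TYPE('f))" "p \<in> args (null_voc TYPE('f) ! i) (univ A)"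
    then have "i = 0" "fst p = []" "length (snd p) = length ?w" "\<forall>Y\<in>set (snd p). Y \<subseteq> univ A"
      by (auto simp: null_voc_eq args_def simp del: length_prime_weights)
    then show "case p of (xs, Xs) \<Rightarrow> rel A i xs Xs \<longleftrightarrow> rel ?N i (map ?h xs) (map ((`) ?h) Xs)"
      using rel[of "snd p"] by (cases p) simp
  qed (fact bij)
qed

end

section \<open>The three encodings\<close>

lemma realizes_transduction: "realizes voc voc' f F \<Longrightarrow> mso_transduction voc voc' f"
  by (simp add: realizes_def)

lemma realizesD:
  assumes "realizes voc voc' f F" "f A B"
  shows "is_struct A" "is_struct B" "\<exists>X\<in>F A. isomorphic voc' X B"
  using assms by (simp_all add: realizes_def)

lemma realizesI: "realizes voc voc' f F \<Longrightarrow> is_struct A \<Longrightarrow> is_struct B \<Longrightarrow> X \<in> F A \<Longrightarrow>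
    isomorphic voc' X B \<Longrightarrow> f A B"
  by (auto simp: realizes_def)

text \<open>For a nondeterministic round trip, being the identity up to isomorphism means two
  things: some choice succeeds, and every successful choice returns a structure isomorphic to the
  input.\<close>

lemma mso_encodingI:
  assumes voc: "fst C = voc" "fst D = voc'"
    and f: "mso_transduction voc voc' f" and g: "mso_transduction voc' voc g"
    and fD: "\<And>A B. A \<in> snd C \<Longrightarrow> f A B \<Longrightarrow> B \<in> snd D"
    and gC: "\<And>A B. B \<in> snd D \<Longrightarrow> g B A \<Longrightarrow> A \<in> snd C"
    and fg: "realizes voc voc (f OO g) F"
    and C: "\<And>A. A \<in> snd C \<Longrightarrow> is_struct A" "\<And>A. A \<in> snd C \<Longrightarrow> F A \<noteq> {}"
      "\<And>A X. A \<in> snd C \<Longrightarrow> X \<in> F A \<Longrightarrow> isomorphic voc A X"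
  shows "mso_encoding f C D"
proof -
  have "(f OO g) A A' \<longleftrightarrow> isomorphic voc A A'" if A: "A \<in> snd C" for A A'
  proof
    assume "(f OO g) A A'"
    then obtain X where "X \<in> F A" "isomorphic voc X A'" using realizesD(3)[OF fg] by blast
    then show "isomorphic voc A A'" using C(3)[OF A] isomorphic_trans by blast
  next
    assume iso: "isomorphic voc A A'"
    obtain X where X: "X \<in> F A" using C(2)[OF A] by blast
    have "isomorphic voc X A'" by (rule isomorphic_trans[OF isomorphic_sym[OF C(3)[OF A X]] iso])
    moreover have "is_struct A'" using isomorphic_is_struct[OF iso] C(1)[OF A] by simp
    ultimately show "(f OO g) A A'" using realizesI[OF fg C(1)[OF A] _ X] by blast
  qed
  then have "\<forall>A\<in>snd C. \<forall>A'. (f OO g) A A' \<longleftrightarrow> isomorphic (fst C) A A'" by (simp add: voc)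
  then show ?thesis
    unfolding mso_encoding_def using f g fD gC by (intro conjI exI[of _ g]) (simp_all add: voc)
qed

lemma mso_transduction_interpreting:
  "mso_formula voc (1, 0) \<phi> \<Longrightarrow> length \<psi>s = length voc' \<Longrightarrow>
    (\<forall>i<length voc'. mso_formula voc (voc' ! i) (\<psi>s ! i)) \<Longrightarrow>
    mso_transduction voc voc' (interpreting voc' \<phi> \<psi>s)"
  unfolding interpreting_def by (rule interp)

lemma single_formula:
  "mso_formula voc mn \<psi> \<Longrightarrow> \<forall>i<length [mn]. mso_formula voc ([mn] ! i) ([\<psi>] ! i)"
  by simp

lemma fst_binary_relations: "fst binary_relations = [(2, 0)]"
  by (simp add: binary_relations_def)

lemma fst_independence_matroids:
  "fst (independence_matroids TYPE('f::{finite,field})) = independence_voc"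
  by (simp add: independence_matroids_def)

definition decoding :: "nat struct \<Rightarrow> nat struct \<Rightarrow> bool" where
  "decoding = interpreting [(2, 0)] vertex_fm [edge_fm]"

lemma mso_transduction_decoding: "mso_transduction independence_voc [(2, 0)] decoding"
  unfolding decoding_def
  by (rule mso_transduction_interpreting[OF mso_formula_vertex_fm _
        single_formula[OF mso_formula_edge_fm]]) simp

lemma realizes_decoding:
  assumes "realizes voc independence_voc f F"
  shows "realizes voc [(2, 0)] (f OO decoding) (\<lambda>A. \<Union>((\<lambda>X. {decode X}) ` F A))"
  unfolding decoding_def decode_def
  by (rule realizes_interpreting[OF assms mso_formula_vertex_fm _
        single_formula[OF mso_formula_edge_fm]]) simp

lemma null_into_binary:
  "\<exists>f. mso_encoding f (null_matroids TYPE('f::{finite,field})) binary_relations"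
proof -
  let ?N = "null_voc TYPE('f)" and ?m = "CHAR('f) - 1"
  let ?coords = "map (\<lambda>i. coord_fm TYPE('f) (Suc i)) [0..<?m]"
  let ?g = "interpreting ?N (Rel 0 [0, 0] []) [graph_null_fm TYPE('f)]"
  obtain f1 where f1: "realizes ?N (cvoc TYPE('f)) f1
      (\<lambda>A :: nat struct. {colour_struct ?N c A |c. c ` univ A \<subseteq> {..<2}})"
    using realizes_colour_base[of 2 ?N] by auto
  obtain f2 where f2: "realizes ?N (cvoc TYPE('f)) f2
      (\<lambda>A. \<Union>((\<lambda>X. {Y. Y = X \<and> holds X [] [] (basis_fm TYPE('f))}) `
        {colour_struct ?N c A |c. c ` univ A \<subseteq> {..<2}}))" (is "realizes _ _ _ ?F2")
    using realizes_filter[OF f1 mso_formula_basis] by blast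
  have f3: "realizes ?N (replicate ?m (2, 0)) (f2 OO interpreting (replicate ?m (2, 0)) FTrue ?coords)
      (\<lambda>A. \<Union>((\<lambda>X. {interpret_struct FTrue ?coords X}) ` ?F2 A))" (is "realizes _ _ _ ?F3")
    by (rule realizes_interpreting[OF f2 mso_formula_FTrue]) (simp_all add: mso_formula_coord)
  obtain f4 where f4: "realizes ?N (copy_voc (Suc ?m) (replicate ?m (2, 0))) f4
      (\<lambda>A. \<Union>((\<lambda>X. {copy_struct (replicate ?m (2, 0)) (Suc ?m) X}) ` ?F3 A))" (is "realizes _ _ _ ?F4")
    using realizes_copy[OF f3, of "Suc ?m"] by auto
  define f where "f = f4 OO interpreting [(2, 0)] FTrue [graph_fm ?m]"
  have f: "realizes ?N [(2, 0)] f
      (\<lambda>A. \<Union>((\<lambda>X. {interpret_struct FTrue [graph_fm ?m] X}) ` ?F4 A))" (is "realizes _ _ _ ?F5")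
    unfolding f_def
    by (rule realizes_interpreting[OF f4 mso_formula_FTrue _ single_formula[OF mso_formula_graph]]) simp
  have loop: "mso_formula [(2, 0)] (1, 0) (Rel 0 [0, 0] [])" by (simp add: mso_formula_def)
  have voc: "?N = [(0, null_arity TYPE('f))]" by (simp add: null_voc_eq)
  have graph_null: "\<forall>i<length ?N. mso_formula [(2, 0)] (?N ! i) ([graph_null_fm TYPE('f)] ! i)"
    unfolding voc by (rule single_formula[OF mso_formula_graph_null])
  have fg: "realizes ?N ?N (f OO ?g) (\<lambda>A. \<Union>((\<lambda>X. {graph_null TYPE('f) X}) ` ?F5 A))"
    (is "realizes _ _ _ ?F6")
    unfolding graph_null_def
    by (rule realizes_interpreting[OF f loop _ graph_null]) (simp add: voc)
  let ?colour = "colour_struct ?N :: _ \<Rightarrow> nat struct \<Rightarrow> nat struct"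
  define G where "G A = {graph_null TYPE('f) (coord_graph TYPE('f) (?colour c A)) |c.
    c ` univ A \<subseteq> {..<2} \<and> holds (?colour c A) [] [] (basis_fm TYPE('f))}" for A
  have "?F6 A = G A" for A
    unfolding G_def coord_graph_def Let_def by auto
  then have fg': "realizes ?N ?N (f OO ?g) G" using fg by presburger
  have "mso_encoding f (null_matroids TYPE('f)) binary_relations"
  proof (rule mso_encodingI[OF fst_null_matroids fst_binary_relations
        realizes_transduction[OF f] _ _ _ fg'])
    show "mso_transduction [(2, 0)] ?N ?g"
      by (rule mso_transduction_interpreting[OF loop _ graph_null]) (simp add: voc)
    show "B \<in> snd binary_relations" if "f A B" for A B
      using realizesD(2)[OF f that] by (simp add: binary_relations_def)
    show "A \<in> snd (null_matroids TYPE('f))" if "?g B A" for A B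
    proof (rule null_matroidsI[OF represents_graph_null])
      show "finite (univ B)" "is_struct A" "isomorphic ?N (graph_null TYPE('f) B) A"
        using that by (simp_all add: interpreting_def is_struct_def graph_null_def)
    qed
  next
    fix A assume "A \<in> snd (null_matroids TYPE('f))"
    then obtain v :: "nat \<Rightarrow> nat \<Rightarrow> 'f" where A: "is_struct A" and rep: "represents prime_weights v A"
      by (rule null_matroidsE)
    show "is_struct A" by fact
    have "finite (univ A)" using A by (simp add: is_struct_def)
    then obtain B where B: "prime_basis (univ A) v B" using prime_basis_exists by blast
    \<comment> \<open>Colouring a basis with 0 passes the filter, so the encoding has an
      output.\<close>
    define c where "c x = (if x \<in> B then 0 else 1 :: nat)" for x
    have "B = {x \<in> univ A. c x = 0}" using prime_basis.sub[OF B] by (auto simp: c_def)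
    then have "holds (colour_struct ?N c A) [] [] (basis_fm TYPE('f))"
      using holds_basis_fm[OF A rep, of c] B by simp
    moreover have "c ` univ A \<subseteq> {..<2}" by (auto simp: c_def)
    ultimately have "graph_null TYPE('f) (coord_graph TYPE('f) (colour_struct ?N c A)) \<in> G A"
      unfolding G_def by blast
    then show "G A \<noteq> {}" by blast
    show "isomorphic ?N A X" if X_G: "X \<in> G A" for X
    proof -
      obtain c where c: "holds (colour_struct ?N c A) [] [] (basis_fm TYPE('f))"
        and X: "X = graph_null TYPE('f) (coord_graph TYPE('f) (colour_struct ?N c A))"
        using X_G unfolding G_def by blast
      have "prime_basis (univ A) v {x \<in> univ A. c x = 0}"
        using holds_basis_fm[OF A rep, of c] c by simp
      then show ?thesis
        unfolding X by (rule isomorphic_graph_null_coord_graph[OF A rep])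
    qed
  qed
  then show ?thesis by blast
qed

text \<open>The decoder first defines independence over the prime field from the null relation and
  then decodes as for independence matroids; it never has to express independence over the whole
  field.\<close>

lemma binary_into_null:
  "\<exists>f. mso_encoding f binary_relations (null_matroids TYPE('f::{finite,field}))"
proof -
  let ?N = "null_voc TYPE('f)" and ?h = "interpreting independence_voc FTrue [null_indep_fm TYPE('f)]"
  have voc: "?N = [(0, null_arity TYPE('f))]" by (simp add: null_voc_eq)
  obtain f1 where f1: "realizes [(2, 0)] gadget_voc f1 (\<lambda>A :: nat struct. {gadget_copies A})"
    using realizes_copy_base[of 11 "[(2, 0)]"] by auto
  define f where "f = f1 OO interpreting ?N FTrue [gadget_null_fm TYPE('f)]"
  have gadget: "\<forall>i<length ?N. mso_formula gadget_voc (?N ! i) ([gadget_null_fm TYPE('f)] ! i)"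
    unfolding voc by (rule single_formula[OF mso_formula_gadget_null])
  have "realizes [(2, 0)] ?N f (\<lambda>A. \<Union>((\<lambda>X. {interpret_struct FTrue [gadget_null_fm TYPE('f)] X}) ` {gadget_copies A}))"
    unfolding f_def by (rule realizes_interpreting[OF f1 mso_formula_FTrue _ gadget]) (simp add: voc)
  then have f: "realizes [(2, 0)] ?N f (\<lambda>A. {null_gadget TYPE('f) A})"
    by (simp add: null_gadget_def)
  have indep: "\<forall>i<length independence_voc. mso_formula ?N (independence_voc ! i) ([null_indep_fm TYPE('f)] ! i)"
    unfolding independence_voc_def by (rule single_formula[OF mso_formula_null_indep])
  have "realizes [(2, 0)] independence_voc (f OO ?h)
      (\<lambda>A. \<Union>((\<lambda>X. {interpret_struct FTrue [null_indep_fm TYPE('f)] X}) ` {null_gadget TYPE('f) A}))"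
    by (rule realizes_interpreting[OF f mso_formula_FTrue _ indep]) (simp add: independence_voc_def)
  then have "realizes [(2, 0)] [(2, 0)] ((f OO ?h) OO decoding)
      (\<lambda>A. \<Union>((\<lambda>X. {decode X}) ` \<Union>((\<lambda>X. {interpret_struct FTrue [null_indep_fm TYPE('f)] X}) ` {null_gadget TYPE('f) A})))"
    by (rule realizes_decoding)
  then have fg: "realizes [(2, 0)] [(2, 0)] (f OO (?h OO decoding))
      (\<lambda>A. {decode (interpret_struct FTrue [null_indep_fm TYPE('f)] (null_gadget TYPE('f) A))})"
    by (simp add: relcompp_assoc)
  have "mso_transduction ?N independence_voc ?h"
    by (rule mso_transduction_interpreting[OF mso_formula_FTrue _ indep]) (simp add: independence_voc_def)
  then have g: "mso_transduction ?N [(2, 0)] (?h OO decoding)"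
    by (rule composition[OF _ mso_transduction_decoding])
  have "mso_encoding f binary_relations (null_matroids TYPE('f))"
  proof (rule mso_encodingI[OF fst_binary_relations fst_null_matroids
        realizes_transduction[OF f] g _ _ fg])
    show "B \<in> snd (null_matroids TYPE('f))" if "f A B" for A B
    proof (rule null_matroidsI[OF represents_null_gadget])
      show "finite (univ A)" "is_struct B" "isomorphic ?N (null_gadget TYPE('f) A) B"
        using realizesD[OF f that] by (simp_all add: is_struct_def)
    qed
    show "A \<in> snd binary_relations" if "(?h OO decoding) B A" for A B
      using mso_transduction_is_struct[OF g that] by (simp add: binary_relations_def)
  next
    fix A assume "A \<in> snd binary_relations"
    then show A: "is_struct A" by (simp add: binary_relations_def)
    then have fin: "finite (univ A)" by (simp add: is_struct_def)
    let ?S = "interpret_struct FTrue [null_indep_fm TYPE('f)] (null_gadget TYPE('f) A)"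
    have "indep_represents prime_field (gadget A :: _ \<Rightarrow> _ \<Rightarrow> 'f) ?S"
      by (rule indep_represents_null_indep[OF _ represents_null_gadget[OF fin]])
        (use fin in \<open>simp add: copies_def\<close>)
    then have "isomorphic [(2, 0)] A (decode ?S)"
      by (intro isomorphic_decode[OF A _ _ prime_field_closed(1-3)]) simp_all
    then show "isomorphic [(2, 0)] A X" if "X \<in> {decode ?S}" for X
      using that by simp
  qed simp
  then show ?thesis by blast
qed

lemma binary_into_independence:
  "\<exists>f. mso_encoding f binary_relations (independence_matroids TYPE('f::{finite,field}))"
proof -
  obtain f1 where f1: "realizes [(2, 0)] gadget_voc f1 (\<lambda>A :: nat struct. {gadget_copies A})"
    using realizes_copy_base[of 11 "[(2, 0)]"] by auto
  define f where "f = f1 OO interpreting independence_voc FTrue [gadget_indep_fm TYPE('f)]"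
  have indep: "\<forall>i<length independence_voc.
      mso_formula gadget_voc (independence_voc ! i) ([gadget_indep_fm TYPE('f)] ! i)"
    unfolding independence_voc_def by (rule single_formula[OF mso_formula_gadget_indep])
  have "realizes [(2, 0)] independence_voc f
      (\<lambda>A. \<Union>((\<lambda>X. {interpret_struct FTrue [gadget_indep_fm TYPE('f)] X}) ` {gadget_copies A}))"
    unfolding f_def
    by (rule realizes_interpreting[OF f1 mso_formula_FTrue _ indep]) (simp add: independence_voc_def)
  then have f: "realizes [(2, 0)] independence_voc f (\<lambda>A. {indep_gadget TYPE('f) A})"
    by (simp add: indep_gadget_def)
  have fg: "realizes [(2, 0)] [(2, 0)] (f OO decoding) (\<lambda>A. {decode (indep_gadget TYPE('f) A)})"
    using realizes_decoding[OF f] by simp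
  have "mso_encoding f binary_relations (independence_matroids TYPE('f))"
  proof (rule mso_encodingI[OF fst_binary_relations fst_independence_matroids
        realizes_transduction[OF f] mso_transduction_decoding _ _ fg])
    show "B \<in> snd (independence_matroids TYPE('f))" if "f A B" for A B
    proof (rule independence_matroidsI[OF indep_represents_indep_gadget])
      show "finite (univ A)" "is_struct B" "isomorphic independence_voc (indep_gadget TYPE('f) A) B"
        using realizesD[OF f that] by (simp_all add: is_struct_def)
    qed
    show "A \<in> snd binary_relations" if "decoding B A" for A B
      using mso_transduction_is_struct[OF mso_transduction_decoding that]
      by (simp add: binary_relations_def)
  next
    fix A assume "A \<in> snd binary_relations"
    then show A: "is_struct A" by (simp add: binary_relations_def)
    then have fin: "finite (univ A)" by (simp add: is_struct_def)
    have "isomorphic [(2, 0)] A (decode (indep_gadget TYPE('f) A))"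
      by (rule isomorphic_decode[OF A _ indep_represents_indep_gadget[OF fin]]) simp_all
    then show "isomorphic [(2, 0)] A X" if "X \<in> {decode (indep_gadget TYPE('f) A)}" for X
      using that by simp
  qed simp
  then show ?thesis by blast
qed

theorem mainTheorem3:
  shows "(\<exists>f. mso_encoding f (null_matroids TYPE('f::{finite,field})) binary_relations) \<and>
         (\<exists>f. mso_encoding f binary_relations (null_matroids TYPE('f))) \<and>
         (\<exists>f. mso_encoding f (null_matroids TYPE('f)) (independence_matroids TYPE('f)))"
proof (intro conjI)
  show "\<exists>f. mso_encoding f (null_matroids TYPE('f)) binary_relations"
    by (rule null_into_binary)
  show "\<exists>f. mso_encoding f binary_relations (null_matroids TYPE('f))"
    by (rule binary_into_null)
  obtain f where f: "mso_encoding f (null_matroids TYPE('f)) binary_relations"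
    using null_into_binary[where 'f = 'f] by (rule exE)
  obtain g where g: "mso_encoding g binary_relations (independence_matroids TYPE('f))"
    using binary_into_independence[where 'f = 'f] by (rule exE)
  show "\<exists>f. mso_encoding f (null_matroids TYPE('f)) (independence_matroids TYPE('f))"
    by (rule exI, rule mso_encoding_compose[OF f g])
qed

end
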